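(* Let $K$ be a field and let $n,d$ be integers with $n\geq 3$ and $n+1 \leq d \leq 2n-2$. Then there exists a finite connected graph $G$ on $n$ vertices with $\operatorname{depth}(S/J_G)=n+1$ and $\dim(S/J_G)=d$, where $S=K[x_1,\ldots,x_n,y_1,\ldots,y_n]$ and $J_G\subset S$ is the binomial edge ideal of $G$.
   Context: Every graph is finite, with no loops and no multiple edges (and no isolated vertices, which is automatic for connected graphs on at least two vertices). For a graph $G$ on the vertex set $[n]=\{1,\ldots,n\}$ with edge set $E(G)$, let $S=K[x_1,\ldots,x_n,y_1,\ldots,y_n]$ be the polynomial ring in $2n$ variables over a field $K$. The binomial edge ideal $J_G$ of $G$ is the ideal of $S$ generated by the binomials $x_iy_j-x_jy_i$ with $i<j$ and $\{i,j\}\in E(G)$. Here $\dim(S/J_G)$ is the Krull dimension and $\operatorname{depth}(S/J_G)$ is the depth of $S/J_G$ as a finitely generated graded $S$-module (with respect to the graded maximal ideal of $S$). *)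

theory Defs
  imports
    "HOL-Library.Poly_Mapping"
    "HOL-Library.Extended_Nat"
    "HOL-Algebra.Module"
    "HOL-Algebra.QuotRing"
    "HOL-Algebra.Algebraic_Closure_Type"
    "Graph_Theory.Graph_Theory"
begin

section \<open>Krull dimension and depth\<close>

text \<open>The supremum of the lengths \<open>r\<close> of chains \<open>P 0 \<subset> \<dots> \<subset> P r\<close> of prime ideals.
  The zero ring gets the value \<open>0\<close> here (the supremum of the empty set in \<^typ>\<open>enat\<close>).\<close>

definition krull_dim :: "('a, 'b) ring_scheme \<Rightarrow> enat" where
  "krull_dim R = Sup {enat r | r. \<exists>P :: nat \<Rightarrow> 'a set.
     (\<forall>i\<le>r. primeideal (P i) R) \<and> (\<forall>i<r. P i \<subset> P (Suc i))}"

text \<open>\<open>R/I\<close> as an \<open>R\<close>-module: the additive group (and multiplication) of \<^term>\<open>R Quot I\<close>,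
  with \<open>R\<close> acting through the projection \<open>R \<rightarrow> R/I\<close>.\<close>

definition quot_module :: "('a, 'b) ring_scheme \<Rightarrow> 'a set \<Rightarrow> ('a, 'a set) module" where
  "quot_module R I =
     \<lparr>carrier = carrier (R Quot I), monoid.mult = monoid.mult (R Quot I), one = one (R Quot I),
      ring.zero = ring.zero (R Quot I), add = add (R Quot I),
      module.smult = (\<lambda>r A. (I +>\<^bsub>R\<^esub> r) \<otimes>\<^bsub>R Quot I\<^esub> A)\<rparr>"

lemma quot_module_is_module:
  assumes "cring R" "ideal I R"
  shows "module R (quot_module R I)"
proof -
  interpret cring R by fact
  interpret I: ideal I R by fact
  interpret Q: cring "R Quot I"
    by (rule I.quotient_is_cring) (rule cring_axioms)
  interpret h: ring_hom_ring R "R Quot I" "(+>\<^bsub>R\<^esub>) I"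
    by (rule I.rcos_ring_hom_ring)
  have "abelian_group (quot_module R I)"
    by (rule abelian_groupI)
       (auto simp: quot_module_def Q.a_ac intro: bexI Q.l_neg)
  then show ?thesis
  proof (rule moduleI[OF cring_axioms])
    fix A assume "A \<in> carrier (quot_module R I)"
    then show "\<one>\<^bsub>R\<^esub> \<odot>\<^bsub>quot_module R I\<^esub> A = A"
      using Q.l_one[of A] h.hom_one by (simp add: quot_module_def del: h.hom_one)
  next
    fix a b A assume "a \<in> carrier R" "b \<in> carrier R" "A \<in> carrier (quot_module R I)"
    then show "(a \<otimes>\<^bsub>R\<^esub> b) \<odot>\<^bsub>quot_module R I\<^esub> A =
        a \<odot>\<^bsub>quot_module R I\<^esub> (b \<odot>\<^bsub>quot_module R I\<^esub> A)"
      by (simp add: quot_module_def Q.m_assoc)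
  qed (simp_all add: quot_module_def Q.l_distr Q.r_distr)
qed

text \<open>The submodule \<open>(x\<^sub>1, \<dots>, x\<^sub>r) M\<close> of \<open>M\<close>.\<close>

definition seq_submodule :: "('a, 'm) module \<Rightarrow> 'a list \<Rightarrow> 'm set" where
  "seq_submodule M xs =
     {finsum M (\<lambda>i. (xs ! i) \<odot>\<^bsub>M\<^esub> v i) {..<length xs} | v.
        v \<in> {..<length xs} \<rightarrow> carrier M}"

text \<open>\<open>x\<^sub>1, \<dots>, x\<^sub>r\<close> is \<open>M\<close>-regular if each \<open>x\<^sub>i\<close> is a nonzerodivisor on
  \<open>M / (x\<^sub>1, \<dots>, x\<^sub>i\<^sub>-\<^sub>1) M\<close> and \<open>(x\<^sub>1, \<dots>, x\<^sub>r) M \<noteq> M\<close>. The statement about the quotient is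
  expressed by representatives in \<open>M\<close>.\<close>

definition regular_sequence ::
    "('a, 'b) ring_scheme \<Rightarrow> ('a, 'm) module \<Rightarrow> 'a list \<Rightarrow> bool" where
  "regular_sequence R M xs \<longleftrightarrow>
     set xs \<subseteq> carrier R \<and>
     (\<forall>i<length xs. \<forall>v\<in>carrier M.
        (xs ! i) \<odot>\<^bsub>M\<^esub> v \<in> seq_submodule M (take i xs) \<longrightarrow>
        v \<in> seq_submodule M (take i xs)) \<and>
     seq_submodule M xs \<noteq> carrier M"

text \<open>The supremum of the lengths of \<open>M\<close>-regular sequences contained in the ideal \<open>\<mm>\<close>.\<close>

definition depth ::
    "('a, 'b) ring_scheme \<Rightarrow> 'a set \<Rightarrow> ('a, 'm) module \<Rightarrow> enat" where
  "depth R \<mm> M = Sup {enat (length xs) | xs. set xs \<subseteq> \<mm> \<and> regular_sequence R M xs}"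


section \<open>Binomial edge ideals\<close>

datatype binvar = VX nat | VY nat

text \<open>A monomial is a finitely supported exponent function, a polynomial a finitely supported
  coefficient function; \<^theory>\<open>HOL-Library.Poly_Mapping\<close> provides the convolution product.\<close>

type_synonym 'k bpoly = "(binvar \<Rightarrow>\<^sub>0 nat) \<Rightarrow>\<^sub>0 'k"

definition bvar :: "binvar \<Rightarrow> 'k::field bpoly" where
  "bvar v = Poly_Mapping.single (Poly_Mapping.single v 1) 1"

definition binvars :: "nat \<Rightarrow> binvar set" where
  "binvars n = VX ` {1..n} \<union> VY ` {1..n}"

text \<open>The ring \<open>K[x\<^sub>1, \<dots>, x\<^sub>n, y\<^sub>1, \<dots>, y\<^sub>n]\<close>, as a subring of the polynomial ring in all
  variables \<open>x\<^sub>i\<close>, \<open>y\<^sub>i\<close>.\<close>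

definition bpoly_ring :: "nat \<Rightarrow> 'k::field bpoly ring" where
  "bpoly_ring n = ring_of_type_algebra
     \<lparr>carrier := {p. \<forall>m \<in> Poly_Mapping.keys p. Poly_Mapping.keys m \<subseteq> binvars n}\<rparr>"

lemma cring_bpoly_ring: "cring (bpoly_ring n :: 'k::field bpoly ring)"
proof -
  let ?C = "{p :: 'k bpoly. \<forall>m \<in> Poly_Mapping.keys p. Poly_Mapping.keys m \<subseteq> binvars n}"
  interpret A: cring "ring_of_type_algebra :: 'k bpoly ring" by (rule cring_from_type_algebra)
  have neg: "\<ominus>\<^bsub>ring_of_type_algebra\<^esub> p = - p" for p :: "'k bpoly"
    by (rule A.minus_equality) (simp_all add: ring_of_type_algebra_def)
  have "subcring ?C (ring_of_type_algebra :: 'k bpoly ring)"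
  proof (rule A.subcringI'[OF A.subringI])
    fix p q :: "'k bpoly" assume pq: "p \<in> ?C" "q \<in> ?C"
    show "p \<oplus>\<^bsub>ring_of_type_algebra\<^esub> q \<in> ?C"
    proof -
      have "Poly_Mapping.keys (p + q) \<subseteq> Poly_Mapping.keys p \<union> Poly_Mapping.keys q"
        by (rule Poly_Mapping.keys_add)
      then have "\<forall>m \<in> Poly_Mapping.keys (p + q). Poly_Mapping.keys m \<subseteq> binvars n"
        using pq by blast
      then show ?thesis by (simp add: ring_of_type_algebra_def)
    qed
    show "p \<otimes>\<^bsub>ring_of_type_algebra\<^esub> q \<in> ?C"
    proof -
      have "Poly_Mapping.keys m \<subseteq> binvars n" if m: "m \<in> Poly_Mapping.keys (p * q)" for m
      proof -
        obtain a b where ab: "m = a + b" "a \<in> Poly_Mapping.keys p" "b \<in> Poly_Mapping.keys q"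
          using m Poly_Mapping.keys_mult[of p q] by blast
        then show ?thesis
          using pq Poly_Mapping.keys_add[of a b] by blast
      qed
      then show ?thesis by (simp add: ring_of_type_algebra_def)
    qed
  next
    show "?C \<subseteq> carrier ring_of_type_algebra" by (simp add: ring_of_type_algebra_def)
    show "\<one>\<^bsub>ring_of_type_algebra\<^esub> \<in> ?C" by (simp add: ring_of_type_algebra_def)
    show "\<ominus>\<^bsub>ring_of_type_algebra\<^esub> p \<in> ?C" if "p \<in> ?C" for p
      using that by (simp add: neg)
  qed
  then show ?thesis
    unfolding bpoly_ring_def by (rule A.subcring_iff[THEN iffD1, rotated]) (simp add: ring_of_type_algebra_def)
qed

definition graded_max_ideal :: "nat \<Rightarrow> 'k::field bpoly set" where
  "graded_max_ideal n = Idl\<^bsub>bpoly_ring n\<^esub> (bvar ` binvars n)"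

text \<open>Graphs are symmetric loopfree digraphs here, so each edge \<open>{i, j}\<close> gives both arcs
  \<open>(i, j)\<close> and \<open>(j, i)\<close>.\<close>

definition binomial_edge_ideal :: "nat \<Rightarrow> nat pair_pre_digraph \<Rightarrow> 'k::field bpoly set" where
  "binomial_edge_ideal n G = Idl\<^bsub>bpoly_ring n\<^esub>
     {bvar (VX i) * bvar (VY j) - bvar (VX j) * bvar (VY i) | i j. i < j \<and> (i, j) \<in> parcs G}"

end

theory Submission
  imports Defs "HOL-Computational_Algebra.Polynomial"
begin

text \<open>Put \<open>k = d - n\<close> and let \<open>G\<close> be a clique on \<open>k + 1, \<dots>, n\<close> with leaves \<open>1, \<dots>, k\<close> attached to the
  vertex \<open>n\<close>, which is therefore adjacent to all others. Then \<open>J\<^sub>G = A \<inter> B\<close>, where \<open>A\<close> is the ideal of the complete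
  graph and \<open>B\<close> is generated by \<open>x_n, y_n\<close> and the minors of the clique on \<open>k + 1, \<dots>, n - 1\<close>; the sum
  \<open>C = A + B\<close> belongs to the complete graph on \<open>n - 1\<close> vertices.

  The quotient by a clique ideal is free over the polynomial ring in the forms \<open>y_i - x_{i+1}\<close> and the \<open>y_i\<close> of
  the isolated vertices. This gives the sequence \<open>y_i - x_{i+1}\<close> \<open>(i < n)\<close>, \<open>y_n + y_1\<close> of length \<open>n + 1\<close>, which is
  regular on \<open>S/A\<close> and \<open>S/B\<close> and regular up to the last term on \<open>S/C\<close>, hence regular on \<open>S/J\<^sub>G\<close>. It also bounds
  Hilbert functions, which replace dimension theory: along a chain of ideals \<open>I\<^sub>0 \<subseteq> \<dots> \<subseteq> I\<^sub>r\<close> with a nonzerodivisor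
  modulo \<open>I\<^sub>i\<close> in \<open>I\<^sub>i\<^sub>+\<^sub>1\<close> the order of growth drops \<open>r\<close> times. For chains of primes this bounds the Krull
  dimension. For a regular sequence it applies to annihilators, starting with that of \<open>x_n\<close>, which contains
  \<open>A\<close>, so the depth is at most \<open>n + 1\<close>. A chain of primes of length \<open>n + k\<close> is obtained from the parametrization
  of the zero set of \<open>B\<close> by setting the parameters to zero one after the other.\<close>

section \<open>Polynomials and substitutions\<close>

text \<open>The numbers fit because a clique on v vertices with k further isolated vertices leaves v
  + 1 + 2k parameters: n + 1 for A, n + k for B and n for C. So B decides the dimension of S/J_G,
  while the depth is held down by the smaller component A, since x_n A lies in J_G although x_n does
  not. The regular sequence can have one term more than S/C admits, because a step is gained in 0 ->
  S/J_G -> S/A + S/B -> S/C -> 0; its last term has to serve A and B at once. Growth drops because a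
  nonzerodivisor f modulo I that lies in I' and has degree at most e gives H_I(s + e) >= H_I(s) +
  H_I'(s + e) for the Hilbert functions; along a chain of length r this yields s choose r, of order
  s^r. The ideals of a regular sequence by themselves would only bound its length by n + k. This is
  why they are enlarged to annihilators of elements that remain nonzero locally at the
  origin.\<close>

instantiation binvar :: linorder
begin

text \<open>An arbitrary enumeration of the variables. Ordering them orders the monomials linearly,
  which provides leading monomials and makes the polynomials an integral domain.\<close>

fun binvar_code :: "binvar \<Rightarrow> nat" where
  "binvar_code (VX i) = 2 * i"
| "binvar_code (VY i) = 2 * i + 1"

definition less_eq_binvar :: "binvar \<Rightarrow> binvar \<Rightarrow> bool" where
  "less_eq_binvar a b \<longleftrightarrow> binvar_code a \<le> binvar_code b"

definition less_binvar :: "binvar \<Rightarrow> binvar \<Rightarrow> bool" where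
  "less_binvar a b \<longleftrightarrow> binvar_code a < binvar_code b"

instance
proof
  fix a b :: binvar
  show "a \<le> b \<Longrightarrow> b \<le> a \<Longrightarrow> a = b"
    unfolding less_eq_binvar_def by (cases a; cases b; simp) presburger+
qed (auto simp: less_eq_binvar_def less_binvar_def)

end

abbreviation keys where "keys \<equiv> Poly_Mapping.keys"
abbreviation lookup where "lookup \<equiv> Poly_Mapping.lookup"
abbreviation single where "single \<equiv> Poly_Mapping.single"

text \<open>A commutative ring as a module over itself: \<open>idl.subspace\<close> means ideal and
  \<open>idl.span\<close> generated ideal. In this instance \<open>scale_scale\<close> is reversed
  associativity, hence its removal from the simpset.\<close>

interpretation idl: Modules.module "(*) :: 'a::comm_ring_1 \<Rightarrow> 'a \<Rightarrow> 'a"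
  by unfold_locales (simp_all add: algebra_simps)

declare idl.scale_scale [simp del]

definition const :: "'k::field \<Rightarrow> 'k bpoly" where
  "const c = single 0 c"

lemma const_0 [simp]: "const 0 = 0" and const_1 [simp]: "const 1 = 1"
  by (simp_all add: const_def)

lemma const_add: "const (a + b) = const a + const b"
  by (simp add: const_def single_add)

lemma const_mult: "const (a * b) = const a * const b"
  by (simp add: const_def mult_single)

lemma const_minus: "const (- a) = - const a"
  by (simp add: const_def single_uminus)

interpretation vs: vector_space "\<lambda>c p. const c * p :: 'k::field bpoly"
  by unfold_locales (simp_all add: algebra_simps const_add const_mult)

lemma const_inverse: "c \<noteq> 0 \<Longrightarrow> const (inverse c) * const c = 1"
  by (simp flip: const_mult)

lemma sum_singles: "(\<Sum>m\<in>keys p. single m (lookup p m)) = p"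
  by (rule poly_mapping_eqI) (auto simp: lookup_sum lookup_single when_def not_in_keys_iff_lookup_eq_zero)

lemma monomial_induct [case_names zero add]:
  fixes m :: "'v \<Rightarrow>\<^sub>0 nat"
  assumes "P 0" and "\<And>v m. P m \<Longrightarrow> P (single v 1 + m)"
  shows "P m"
proof -
  have step: "P (single v n + m)" if "P m" for v n m
  proof (induction n)
    case (Suc n)
    have "single v (Suc n) + m = single v 1 + (single v n + m)"
      by (simp add: add.assoc[symmetric] single_add[symmetric])
    then show ?case using assms(2)[OF Suc] by simp
  qed (simp add: that)
  have "P (\<Sum>v\<in>A. single v (lookup m v))" if "finite A" for A
    using that by induction (auto simp: assms(1) step)
  from this[of "keys m"] show ?thesis by (simp add: sum_singles)
qed

lemma single_Suc_mult: "single (single v 1 + m) c = bvar v * (single m c :: 'k::field bpoly)"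
  by (simp add: bvar_def mult_single)

lemma bpoly_induct [case_names const add var]:
  fixes p :: "'k::field bpoly"
  assumes "\<And>c. P (const c)" "\<And>p q. P p \<Longrightarrow> P q \<Longrightarrow> P (p + q)" "\<And>v p. P p \<Longrightarrow> P (bvar v * p)"
  shows "P p"
proof -
  have single: "P (single m c)" for m c
    by (induction m rule: monomial_induct)
      (use assms(1,3) in \<open>simp_all add: const_def single_Suc_mult[simplified] \<close>)
  have "P (\<Sum>m\<in>A. single m (lookup p m))" if "finite A" for A
    using that assms(1)[of 0] by induction (auto intro: assms(2) single)
  from this[of "keys p"] show ?thesis by (simp add: sum_singles)
qed

section \<open>Substitution homomorphisms\<close>

definition monom_val :: "('v \<Rightarrow> 'r::comm_ring_1) \<Rightarrow> ('v \<Rightarrow>\<^sub>0 nat) \<Rightarrow> 'r" where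
  "monom_val \<phi> m = (\<Prod>v\<in>keys m. \<phi> v ^ lookup m v)"

lemma monom_val_superset:
  "finite A \<Longrightarrow> keys m \<subseteq> A \<Longrightarrow> monom_val \<phi> m = (\<Prod>v\<in>A. \<phi> v ^ lookup m v)"
  unfolding monom_val_def by (rule prod.mono_neutral_left) (auto simp: in_keys_iff)

lemma monom_val_add: "monom_val \<phi> (a + b) = monom_val \<phi> a * monom_val \<phi> b"
proof -
  let ?A = "keys a \<union> keys b"
  have "monom_val \<phi> (a + b) = (\<Prod>v\<in>?A. \<phi> v ^ lookup (a + b) v)"
    by (rule monom_val_superset) (auto simp: Poly_Mapping.keys_add)
  also have "\<dots> = (\<Prod>v\<in>?A. \<phi> v ^ lookup a v) * (\<Prod>v\<in>?A. \<phi> v ^ lookup b v)"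
    by (simp add: lookup_add power_add prod.distrib)
  also have "\<dots> = monom_val \<phi> a * monom_val \<phi> b"
    by (simp flip: monom_val_superset[of ?A])
  finally show ?thesis .
qed

text \<open>The coefficient map \<open>h\<close> is a parameter because two targets occur:
  polynomials again, and univariate polynomials over them (the model of a clique below).\<close>

definition subst :: "('k \<Rightarrow> 'r) \<Rightarrow> (binvar \<Rightarrow> 'r) \<Rightarrow> 'k::field bpoly \<Rightarrow> 'r::comm_ring_1" where
  "subst h \<phi> p = (\<Sum>m\<in>keys p. h (lookup p m) * monom_val \<phi> m)"

locale coeff_hom =
  fixes h :: "'k::field \<Rightarrow> 'r::comm_ring_1"
  assumes h_0 [simp]: "h 0 = 0" and h_1 [simp]: "h 1 = 1"
    and h_add: "h (a + b) = h a + h b" and h_mult: "h (a * b) = h a * h b"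
begin

lemma subst_superset:
  "finite A \<Longrightarrow> keys p \<subseteq> A \<Longrightarrow> subst h \<phi> p = (\<Sum>m\<in>A. h (lookup p m) * monom_val \<phi> m)"
  unfolding subst_def by (rule sum.mono_neutral_left) (auto simp: in_keys_iff)

lemma subst_0 [simp]: "subst h \<phi> 0 = 0"
  by (simp add: subst_def)

lemma subst_add [simp]: "subst h \<phi> (p + q) = subst h \<phi> p + subst h \<phi> q"
proof -
  let ?A = "keys p \<union> keys q"
  have "subst h \<phi> (p + q) = (\<Sum>m\<in>?A. h (lookup (p + q) m) * monom_val \<phi> m)"
    by (rule subst_superset) (auto simp: Poly_Mapping.keys_add)
  also have "\<dots> = (\<Sum>m\<in>?A. h (lookup p m) * monom_val \<phi> m) + (\<Sum>m\<in>?A. h (lookup q m) * monom_val \<phi> m)"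
    by (simp add: lookup_add h_add distrib_right sum.distrib)
  also have "\<dots> = subst h \<phi> p + subst h \<phi> q"
    by (simp flip: subst_superset[of ?A])
  finally show ?thesis .
qed

lemma subst_uminus [simp]: "subst h \<phi> (- p) = - subst h \<phi> p"
  by (metis add.right_inverse add_eq_0_iff subst_0 subst_add)

lemma subst_diff [simp]: "subst h \<phi> (p - q) = subst h \<phi> p - subst h \<phi> q"
  by (metis diff_conv_add_uminus subst_add subst_uminus)

lemma subst_sum: "subst h \<phi> (\<Sum>i\<in>A. f i) = (\<Sum>i\<in>A. subst h \<phi> (f i))"
  by (induction A rule: infinite_finite_induct) auto

lemma subst_single: "subst h \<phi> (single m c) = h c * monom_val \<phi> m"
  by (cases "c = 0") (simp_all add: subst_def)

lemma subst_const [simp]: "subst h \<phi> (const c) = h c"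
  by (simp add: const_def subst_single monom_val_def)

lemma subst_1 [simp]: "subst h \<phi> 1 = 1"
  using subst_const[of \<phi> 1] by simp

lemma subst_bvar [simp]: "subst h \<phi> (bvar v) = \<phi> v"
  by (simp add: bvar_def subst_single monom_val_def)

lemma subst_mult [simp]: "subst h \<phi> (p * q) = subst h \<phi> p * subst h \<phi> q"
proof -
  have "subst h \<phi> (p * q) = subst h \<phi> ((\<Sum>m\<in>keys p. single m (lookup p m)) * (\<Sum>m\<in>keys q. single m (lookup q m)))"
    by (simp add: sum_singles)
  also have "\<dots> = (\<Sum>m\<in>keys p. \<Sum>m'\<in>keys q. (h (lookup p m) * monom_val \<phi> m) * (h (lookup q m') * monom_val \<phi> m'))"
    by (simp add: sum_product mult_single subst_sum subst_single monom_val_add h_mult mult_ac)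
  also have "\<dots> = subst h \<phi> p * subst h \<phi> q"
    by (simp add: sum_product subst_def)
  finally show ?thesis .
qed

text \<open>Compared with the identity substitution, this shows that setting variables to zero
  changes a polynomial only by an element of the ideal they generate.\<close>

lemma subst_cong_ideal:
  assumes "\<And>v. v \<in> A \<Longrightarrow> \<phi> v - \<psi> v \<in> idl.span I" "\<forall>m\<in>keys p. keys m \<subseteq> A"
  shows "subst h \<phi> p - subst h \<psi> p \<in> idl.span I"
proof -
  have mult: "a * b - c * d \<in> idl.span I" if "a - c \<in> idl.span I" "b - d \<in> idl.span I" for a b c d
  proof -
    have "a * b - c * d = b * (a - c) + c * (b - d)" by (simp add: algebra_simps)
    then show ?thesis using that by (metis idl.span_add idl.span_scale)
  qed
  have pow: "a ^ n - c ^ n \<in> idl.span I" if "a - c \<in> idl.span I" for a c and n :: nat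
    using that by (induction n) (auto intro: mult idl.span_zero)
  have "monom_val \<phi> m - monom_val \<psi> m \<in> idl.span I" if "keys m \<subseteq> A" for m
  proof -
    have "(\<Prod>v\<in>B. \<phi> v ^ lookup m v) - (\<Prod>v\<in>B. \<psi> v ^ lookup m v) \<in> idl.span I"
      if "finite B" "B \<subseteq> A" for B
      using that by induction (auto intro!: mult pow assms(1) idl.span_zero)
    then show ?thesis using that by (simp add: monom_val_def)
  qed
  then have "(\<Sum>m\<in>keys p. h (lookup p m) * (monom_val \<phi> m - monom_val \<psi> m)) \<in> idl.span I"
    using assms(2) by (intro idl.span_sum idl.span_scale) auto
  then show ?thesis by (simp add: subst_def sum_subtractf right_diff_distrib)
qed

lemma subst_cong:
  assumes "\<And>v. v \<in> A \<Longrightarrow> \<phi> v = \<psi> v" "\<forall>m\<in>keys p. keys m \<subseteq> A"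
  shows "subst h \<phi> p = subst h \<psi> p"
  using subst_cong_ideal[of A \<phi> \<psi> "{}" p] assms by simp

lemma subst_ideal:
  assumes "p \<in> idl.span I" and "\<And>g. g \<in> I \<Longrightarrow> subst h \<phi> g \<in> idl.span I'"
  shows "subst h \<phi> p \<in> idl.span I'"
  using assms(1)
proof (induction rule: idl.span_induct_alt)
  case (step c x y)
  then show ?case using assms(2)[of x] by (auto intro!: idl.span_add idl.span_scale)
qed (simp add: idl.span_zero)

end

global_interpretation ch: coeff_hom "const :: 'k::field \<Rightarrow> 'k bpoly"
  by unfold_locales (simp_all add: const_add const_mult)

lemma subst_id [simp]: "subst const bvar p = p"
  by (induction p rule: bpoly_induct) auto

lemma subst_subst: "subst const \<phi> (subst const \<psi> p) = subst const (\<lambda>v. subst const \<phi> (\<psi> v)) p"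
  by (induction p rule: bpoly_induct) auto

lemma bvar_neq_0 [simp]: "bvar v \<noteq> 0"
  by (metis bvar_def keys_single keys_zero insert_not_empty zero_neq_one)

lemma bvar_inj [simp]: "bvar v = (bvar w :: 'k::field bpoly) \<longleftrightarrow> v = w"
proof
  assume "bvar v = (bvar w :: 'k bpoly)"
  then have "subst const (\<lambda>u. if u = v then 1 else 0) (bvar v :: 'k bpoly) =
    subst const (\<lambda>u. if u = v then 1 else 0) (bvar w)" by simp
  then show "v = w" by (auto split: if_splits)
qed auto

section \<open>Polynomials in given variables and the filtration by degree\<close>

definition polys :: "binvar set \<Rightarrow> 'k::field bpoly set" where
  "polys A = {p. \<forall>m\<in>keys p. keys m \<subseteq> A}"

lemma polys_0 [simp]: "0 \<in> polys A" and polys_1 [simp]: "1 \<in> polys A"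
  and polys_const [simp]: "const c \<in> polys A"
  by (auto simp: polys_def const_def split: if_splits)

lemma polys_add: "p \<in> polys A \<Longrightarrow> q \<in> polys A \<Longrightarrow> p + q \<in> polys A"
  unfolding polys_def using Poly_Mapping.keys_add[of p q] by blast

lemma polys_uminus: "p \<in> polys A \<Longrightarrow> - p \<in> polys A"
  by (auto simp: polys_def in_keys_iff)

lemma polys_diff: "p \<in> polys A \<Longrightarrow> q \<in> polys A \<Longrightarrow> p - q \<in> polys A"
  by (metis diff_conv_add_uminus polys_add polys_uminus)

lemma polys_mult:
  assumes "p \<in> polys A" "q \<in> polys A"
  shows "p * q \<in> polys A"
proof -
  have "keys m \<subseteq> A" if m: "m \<in> keys (p * q)" for m
  proof -
    obtain a b where ab: "m = a + b" "a \<in> keys p" "b \<in> keys q"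
      using m Poly_Mapping.keys_mult[of p q] by blast
    then show ?thesis
      using assms Poly_Mapping.keys_add[of a b] unfolding polys_def by blast
  qed
  then show ?thesis by (simp add: polys_def)
qed

lemma polys_sum: "(\<And>i. i \<in> B \<Longrightarrow> f i \<in> polys A) \<Longrightarrow> sum f B \<in> polys A"
  by (induction B rule: infinite_finite_induct) (auto intro: polys_add)

lemma polys_bvar [simp]: "bvar v \<in> (polys A :: 'k::field bpoly set) \<longleftrightarrow> v \<in> A"
  by (simp add: polys_def bvar_def)

lemma subst_polys: "(\<And>v. \<phi> v \<in> polys A) \<Longrightarrow> subst const \<phi> p \<in> polys A"
  by (induction p rule: bpoly_induct) (auto intro: polys_add polys_mult)

definition tdeg :: "('v \<Rightarrow>\<^sub>0 nat) \<Rightarrow> nat" where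
  "tdeg m = (\<Sum>v\<in>keys m. lookup m v)"

lemma tdeg_superset: "finite A \<Longrightarrow> keys m \<subseteq> A \<Longrightarrow> tdeg m = (\<Sum>v\<in>A. lookup m v)"
  unfolding tdeg_def by (rule sum.mono_neutral_left) (auto simp: in_keys_iff)

lemma tdeg_add: "tdeg (a + b) = tdeg a + tdeg b"
proof -
  let ?A = "keys a \<union> keys b"
  have "tdeg (a + b) = (\<Sum>v\<in>?A. lookup (a + b) v)"
    by (rule tdeg_superset) (auto simp: Poly_Mapping.keys_add)
  then show ?thesis
    by (simp add: lookup_add sum.distrib flip: tdeg_superset[of ?A])
qed

lemma tdeg_0 [simp]: "tdeg 0 = 0" and tdeg_single [simp]: "tdeg (single v n) = n"
  by (simp_all add: tdeg_def)

definition degle :: "nat \<Rightarrow> 'k::field bpoly set" where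
  "degle s = {p. \<forall>m\<in>keys p. tdeg m \<le> s}"

lemma degle_0 [simp]: "0 \<in> degle s" and degle_1 [simp]: "1 \<in> degle s"
  and degle_const [simp]: "const c \<in> degle s"
  by (auto simp: degle_def const_def split: if_splits)

lemma degle_mono: "p \<in> degle s \<Longrightarrow> s \<le> t \<Longrightarrow> p \<in> degle t"
  by (force simp: degle_def)

lemma degle_add: "p \<in> degle s \<Longrightarrow> q \<in> degle s \<Longrightarrow> p + q \<in> degle s"
  unfolding degle_def using Poly_Mapping.keys_add[of p q] by blast

lemma degle_uminus: "p \<in> degle s \<Longrightarrow> - p \<in> degle s"
  by (auto simp: degle_def in_keys_iff)

lemma degle_mult:
  assumes "p \<in> degle s" "q \<in> degle t"
  shows "p * q \<in> degle (s + t)"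
proof -
  have "tdeg m \<le> s + t" if m: "m \<in> keys (p * q)" for m
  proof -
    obtain a b where ab: "m = a + b" "a \<in> keys p" "b \<in> keys q"
      using m Poly_Mapping.keys_mult[of p q] by blast
    then show ?thesis
      using assms by (auto simp: tdeg_add degle_def intro!: add_mono)
  qed
  then show ?thesis by (simp add: degle_def)
qed

lemma degle_bvar: "s \<ge> 1 \<Longrightarrow> bvar v \<in> degle s"
  by (simp add: degle_def bvar_def)

lemma ex_degle: "\<exists>s. p \<in> degle s"
proof
  show "p \<in> degle (Max (insert 0 (tdeg ` keys p)))"
    by (auto simp: degle_def)
qed

lemma degle_induct [consumes 1, case_names const add mono var]:
  fixes p :: "'k::field bpoly"
  assumes "p \<in> degle s"
    and "\<And>c. P 0 (const c)" "\<And>s p q. P s p \<Longrightarrow> P s q \<Longrightarrow> P s (p + q)"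
    and "\<And>s t p. P s p \<Longrightarrow> s \<le> t \<Longrightarrow> P t p" "\<And>s v p. P s p \<Longrightarrow> P (Suc s) (bvar v * p)"
  shows "P s p"
proof -
  have *: "P (tdeg m) (single m c)" for m c
    by (induction m rule: monomial_induct)
      (use assms(2,5) in \<open>simp_all add: const_def single_Suc_mult[simplified] tdeg_add\<close>)
  have "P s (\<Sum>m\<in>A. single m (lookup p m))" if "finite A" "A \<subseteq> keys p" for A
    using that
  proof induction
    case empty then show ?case using assms(4)[OF assms(2)[of 0], of s] by simp
  next
    case (insert m A)
    then have "tdeg m \<le> s" using assms(1) by (auto simp: degle_def)
    then show ?case using insert assms(3) assms(4)[OF *] by auto
  qed
  from this[of "keys p"] show ?thesis by (simp add: sum_singles)
qed

section \<open>Cliques with isolated vertices\<close>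

definition minor :: "nat \<Rightarrow> nat \<Rightarrow> 'k::field bpoly" where
  "minor i j = bvar (VX i) * bvar (VY j) - bvar (VX j) * bvar (VY i)"

text \<open>All ideals live in the polynomial ring in infinitely many variables; adding the variables
  outside \<open>1, \<dots>, n\<close> to the generators replaces passing to the subring \<^term>\<open>bpoly_ring n\<close>.\<close>

definition edge_ideal_gens :: "nat \<Rightarrow> (nat \<Rightarrow> nat \<Rightarrow> bool) \<Rightarrow> 'k::field bpoly set" where
  "edge_ideal_gens n E = {minor i j | i j. E i j} \<union> bvar ` (- binvars n)"

abbreviation edge_ideal :: "nat \<Rightarrow> (nat \<Rightarrow> nat \<Rightarrow> bool) \<Rightarrow> 'k::field bpoly set" where
  "edge_ideal n E \<equiv> idl.span (edge_ideal_gens n E)"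

definition clique_edge :: "nat \<Rightarrow> nat \<Rightarrow> nat \<Rightarrow> nat \<Rightarrow> bool" where
  "clique_edge k n i j \<longleftrightarrow> k < i \<and> i < j \<and> j \<le> n"

definition param :: "nat \<Rightarrow> 'k::field bpoly" where
  "param i = bvar (VY i) - bvar (VX (Suc i))"

definition param_map :: "'k::field bpoly \<Rightarrow> 'k bpoly" where
  "param_map = subst const (\<lambda>v. case v of VX i \<Rightarrow> param i | VY j \<Rightarrow> bvar (VY j))"

lemma span_mult_right: "p \<in> idl.span I \<Longrightarrow> p * c \<in> idl.span I"
  using idl.span_scale[of p I c] by (simp add: mult.commute)

text \<open>Among the terms with nonzero coefficient one has the largest degree, and it alone
  contributes in that degree.\<close>

lemma poly_independent_of_degrees:
  fixes f :: "'i \<Rightarrow> 'a::idom"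
  assumes "finite J" "inj_on (\<lambda>j. degree (w j)) J" "\<And>j. j \<in> J \<Longrightarrow> w j \<noteq> 0"
    and sum0: "(\<Sum>j\<in>J. [:f j:] * w j) = 0" and "j \<in> J"
  shows "f j = 0"
proof (rule ccontr)
  assume "f j \<noteq> 0"
  define A where "A = {j\<in>J. f j \<noteq> 0}"
  have "finite A" "A \<noteq> {}" using assms \<open>f j \<noteq> 0\<close> by (auto simp: A_def)
  then have "Max ((\<lambda>j. degree (w j)) ` A) \<in> (\<lambda>j. degree (w j)) ` A"
    by (intro Max_in) auto
  then obtain i where i: "i \<in> A" and "degree (w i) = Max ((\<lambda>j. degree (w j)) ` A)" by auto
  then have max: "degree (w l) \<le> degree (w i)" if "l \<in> A" for l
    using that \<open>finite A\<close> by simp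
  have "f l * coeff (w l) (degree (w i)) = 0" if "l \<in> J - {i}" for l
  proof (cases "l \<in> A")
    case True
    then have "degree (w l) < degree (w i)"
      using max[of l] assms(2) that i by (auto simp: A_def inj_on_def le_less)
    then show ?thesis by (simp add: coeff_eq_0)
  qed (use that in \<open>auto simp: A_def\<close>)
  then have "(\<Sum>l\<in>J - {i}. f l * coeff (w l) (degree (w i))) = 0" by (rule sum.neutral[OF ballI])
  moreover have "i \<in> J" using i by (simp add: A_def)
  ultimately have "(\<Sum>l\<in>J. f l * coeff (w l) (degree (w i))) = f i * lead_coeff (w i)"
    by (simp add: sum.remove[of J i] assms(1))
  moreover have "coeff (\<Sum>j\<in>J. [:f j:] * w j) (degree (w i)) = (\<Sum>l\<in>J. f l * coeff (w l) (degree (w i)))"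
    by (simp add: coeff_sum)
  ultimately have "f i * lead_coeff (w i) = 0" using sum0 by simp
  then show False using i assms(3) by (auto simp: A_def)
qed

text \<open>Each exponent is at most s, so the monomials embed into a box. The crude count suffices,
  as only the order of growth in s matters.\<close>

lemma card_monomials_le:
  fixes A :: "'v set"
  assumes "finite A"
  shows "finite {m :: 'v \<Rightarrow>\<^sub>0 nat. keys m \<subseteq> A \<and> tdeg m \<le> s}"
    and "card {m :: 'v \<Rightarrow>\<^sub>0 nat. keys m \<subseteq> A \<and> tdeg m \<le> s} \<le> (s + 1) ^ card A"
proof -
  let ?M = "{m :: 'v \<Rightarrow>\<^sub>0 nat. keys m \<subseteq> A \<and> tdeg m \<le> s}"
  let ?f = "\<lambda>m :: 'v \<Rightarrow>\<^sub>0 nat. restrict (lookup m) A"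
  have "inj_on ?f ?M"
  proof (rule inj_onI)
    fix m m' assume *: "m \<in> ?M" "m' \<in> ?M" "?f m = ?f m'"
    show "m = m'"
    proof (rule poly_mapping_eqI)
      fix v
      show "lookup m v = lookup m' v"
      proof (cases "v \<in> A")
        case True
        then show ?thesis using fun_cong[OF *(3), of v] by simp
      next
        case False
        then have "v \<notin> keys m" "v \<notin> keys m'" using *(1,2) by auto
        then show ?thesis by (simp add: in_keys_iff)
      qed
    qed
  qed
  moreover have sub: "?f ` ?M \<subseteq> A \<rightarrow>\<^sub>E {..s}"
  proof (clarsimp)
    fix m v assume m: "keys m \<subseteq> A" "tdeg m \<le> s" and v: "v \<in> A"
    have "lookup m v \<le> (\<Sum>v\<in>A. lookup m v)" using assms v by (intro member_le_sum) auto
    then show "lookup m v \<le> s" using m tdeg_superset[OF assms m(1)] by simp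
  qed
  moreover have fin: "finite (A \<rightarrow>\<^sub>E {..s})" by (simp add: assms finite_PiE)
  ultimately show "finite ?M" by (meson finite_imageD finite_subset)
  have "card ?M = card (?f ` ?M)" by (simp add: card_image[OF \<open>inj_on ?f ?M\<close>])
  also have "\<dots> \<le> card (A \<rightarrow>\<^sub>E {..s})" by (rule card_mono[OF fin sub])
  also have "\<dots> = (s + 1) ^ card A" by (simp add: card_PiE[OF assms])
  finally show "card ?M \<le> (s + 1) ^ card A" .
qed

global_interpretation cp: coeff_hom "\<lambda>c :: 'k::field. [:const c :: 'k bpoly:]"
  by unfold_locales (simp_all add: const_add const_mult)

lemma subst_const_poly: "subst (\<lambda>c. [:const c:]) (\<lambda>v. [:bvar v:]) p = [:p:]"
  by (induction p rule: bpoly_induct) auto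

lemma subst_poly_subst:
  "subst (\<lambda>c. [:const c:]) \<phi> (subst const \<psi> p) = subst (\<lambda>c. [:const c:]) (\<lambda>v. subst (\<lambda>c. [:const c:]) \<phi> (\<psi> v)) p"
  by (induction p rule: bpoly_induct) auto

section \<open>A clique with isolated vertices: spanning and freeness over the parameters\<close>

locale clique_with_isolated =
  fixes k N :: nat
  assumes kN: "k < N"
begin

abbreviation Qgens :: "'k::field bpoly set" where
  "Qgens \<equiv> edge_ideal_gens N (clique_edge k N)"

abbreviation Q :: "'k::field bpoly set" where
  "Q \<equiv> idl.span Qgens"

text \<open>Names for the parameters: \<open>VX i\<close> stands for y_i - x_{i+1} and
  \<open>VY i\<close> for y_i. The range of the \<open>VX i\<close> includes both ends, since modulo
  \<open>Q\<close> the forms \<open>param 0\<close> and \<open>param N\<close> are -x_1 and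
  y_N.\<close>

definition param_vars :: "binvar set" where
  "param_vars = VX ` {..N} \<union> VY ` {1..k}"

text \<open>Index 0 stands for the basis element 1. There are N - k indices, the degree of the ideal
  of 2-minors of a generic 2 x (N - k) matrix.\<close>

definition basis_ix :: "nat set" where
  "basis_ix = insert 0 {k<..<N}"

definition basis :: "nat \<Rightarrow> 'k::field bpoly" where
  "basis j = (if j = 0 then 1 else bvar (VY j))"

lemma finite_basis_ix [simp]: "finite basis_ix"
  by (simp add: basis_ix_def)

lemma card_basis_ix: "card basis_ix \<le> N"
  using kN by (simp add: basis_ix_def card_insert_if)

lemma finite_param_vars [simp]: "finite param_vars"
  by (simp add: param_vars_def)

lemma card_param_vars: "card param_vars = N + 1 + k"
proof -
  have "card param_vars = card (VX ` {..N}) + card (VY ` {1..k})"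
    unfolding param_vars_def by (rule card_Un_disjoint) auto
  then show ?thesis by (simp add: card_image inj_on_def)
qed

lemma param_map_bvar [simp]: "param_map (bvar (VX i)) = param i" "param_map (bvar (VY i)) = bvar (VY i)"
  by (simp_all add: param_map_def)

lemma param_map_simps [simp]: "param_map (p + q) = param_map p + param_map q"
  "param_map (p - q) = param_map p - param_map q" "param_map (p * q) = param_map p * param_map q"
  "param_map (- p) = - param_map p" "param_map 1 = 1" "param_map 0 = 0" "param_map (const c) = const c"
  by (simp_all add: param_map_def)

lemma outside_in_Q: "v \<notin> binvars N \<Longrightarrow> bvar v \<in> Q"
  by (rule idl.span_base) (auto simp: edge_ideal_gens_def)

lemma minor_in_Q: "k < i \<Longrightarrow> i < j \<Longrightarrow> j \<le> N \<Longrightarrow> minor i j \<in> Q"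
  by (rule idl.span_base) (auto simp: edge_ideal_gens_def clique_edge_def)

text \<open>Modulo \<open>Q\<close>, the combinations of the basis with coefficients of degree at
  most s in the parameters. The inductive form gives the closure properties cheaply;
  \<open>combs_rep\<close> extracts the coefficients afterwards.\<close>

inductive_set combs :: "nat \<Rightarrow> 'k::field bpoly set" for s where
  base: "f \<in> polys param_vars \<Longrightarrow> f \<in> degle s \<Longrightarrow> j \<in> basis_ix \<Longrightarrow> param_map f * basis j \<in> combs s"
| ideal: "q \<in> Q \<Longrightarrow> q \<in> combs s"
| add: "p \<in> combs s \<Longrightarrow> q \<in> combs s \<Longrightarrow> p + q \<in> combs s"

lemma combs_mono: "p \<in> combs s \<Longrightarrow> s \<le> t \<Longrightarrow> p \<in> combs t"
  by (induction rule: combs.induct) (auto intro: combs.intros degle_mono)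

lemma combs_scale:
  assumes "p \<in> combs s" "g \<in> polys param_vars" "g \<in> degle t" "s + t \<le> u"
  shows "param_map g * p \<in> combs u"
  using assms(1)
proof (induction rule: combs.induct)
  case (base f j)
  then have "param_map (g * f) * basis j \<in> combs (t + s)"
    using assms by (intro combs.base polys_mult degle_mult)
  then show ?case using combs_mono assms(4) by (simp add: mult.assoc add.commute)
next
  case (ideal q)
  then show ?case by (intro combs.ideal idl.span_scale)
qed (auto simp: distrib_left intro: combs.add)

lemma combs_uminus: "p \<in> combs s \<Longrightarrow> - p \<in> combs s"
  using combs_scale[of p s "const (-1)" 0 s, OF _ polys_const degle_const] by (simp add: const_minus)

lemma combs_diff: "p \<in> combs s \<Longrightarrow> q \<in> combs s \<Longrightarrow> p - q \<in> combs s"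
  by (metis combs.add combs_uminus diff_conv_add_uminus)

lemma combs_param_mult:
  assumes "p \<in> combs s" "i \<le> N" "s + 1 \<le> u"
  shows "param i * p \<in> combs u"
  using combs_scale[OF assms(1), of "bvar (VX i)" 1 u] assms by (simp add: degle_bvar param_vars_def)

lemma combs_y_mult:
  assumes "p \<in> combs s" "1 \<le> i" "i \<le> k" "s + 1 \<le> u"
  shows "bvar (VY i) * p \<in> combs u"
  using combs_scale[OF assms(1), of "bvar (VY i)" 1 u] assms by (simp add: degle_bvar param_vars_def)

lemma last_y: "bvar (VY N) = param N + bvar (VX (Suc N))" and last_x: "bvar (VX (Suc N)) \<in> Q"
  by (auto simp: param_def binvars_def intro!: outside_in_Q)

lemma first_y: "bvar (VY 0) \<in> Q"
  by (auto simp: binvars_def intro!: outside_in_Q)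

lemma one_in_combs: "1 \<in> combs s"
  using combs.base[of 1 s 0] by (simp add: basis_ix_def basis_def)

lemma y_in_combs: "j \<le> N \<Longrightarrow> bvar (VY j) \<in> combs 1"
proof -
  assume "j \<le> N"
  then consider "j = 0" | "1 \<le> j" "j \<le> k" | "k < j" "j < N" | "j = N" by linarith
  then show ?thesis
  proof cases
    case 1
    then show ?thesis using first_y combs.ideal by blast
  next
    case 2
    then show ?thesis using combs_y_mult[OF one_in_combs[of 0], of j 1] by simp
  next
    case 3
    then show ?thesis using combs.base[of 1 1 j] by (simp add: basis_ix_def basis_def)
  next
    case 4
    then show ?thesis using combs_param_mult[OF one_in_combs[of 0], of N 1] last_y last_x
      by (metis combs.add combs.ideal mult.right_neutral add_0 order_refl)
  qed
qed

lemma y_mult_y_N: "i \<le> N \<Longrightarrow> bvar (VY i) * bvar (VY N) \<in> combs 2"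
proof -
  assume i: "i \<le> N"
  have "bvar (VY i) * bvar (VY N) = param N * bvar (VY i) + bvar (VY i) * bvar (VX (Suc N))"
    by (simp add: last_y algebra_simps)
  moreover have "param N * bvar (VY i) \<in> combs 2"
    using combs_param_mult[OF y_in_combs[OF i], of N 2] by simp
  ultimately show ?thesis
    using combs.add combs.ideal idl.span_scale last_x by metis
qed

text \<open>With x_{l+1} = y_l - \<open>param l\<close> the minor reads y_{i+1} y_j = y_i y_{j+1} up
  to parameters times single y's. The indices thus move apart until the first is at most k or the
  second is N, where that y is a parameter or zero modulo \<open>Q\<close>.\<close>

lemma y_mult_y:
  "i \<le> j \<Longrightarrow> j \<le> N \<Longrightarrow> bvar (VY i) * bvar (VY j) \<in> (combs 2 :: 'k::field bpoly set)"
proof (induction i arbitrary: j)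
  case 0
  have "bvar (VY 0) * bvar (VY j) \<in> Q" by (rule span_mult_right[OF first_y])
  then show ?case by (rule combs.ideal)
next
  case (Suc i)
  consider "Suc i \<le> k" | "j = N" | "k < Suc i" "j < N" using Suc.prems by linarith
  then show ?case
  proof cases
    case 1
    then show ?thesis using combs_y_mult[OF y_in_combs[OF Suc.prems(2)], of "Suc i" 2] by simp
  next
    case 2
    then show ?thesis using y_mult_y_N[of "Suc i"] Suc.prems by simp
  next
    case 3
    have eq: "bvar (VY (Suc i)) * bvar (VY j) =
      bvar (VY i) * bvar (VY (Suc j)) - param i * bvar (VY (Suc j)) + param j * bvar (VY (Suc i))
        - minor (Suc i) (Suc j)"
      by (simp add: minor_def param_def algebra_simps)
    have "minor (Suc i) (Suc j) \<in> Q" using 3 Suc.prems by (intro minor_in_Q) auto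
    moreover have "bvar (VY i) * bvar (VY (Suc j)) \<in> (combs 2 :: 'k bpoly set)" using 3 Suc.prems Suc.IH[of "Suc j"] by simp
    moreover have "param i * bvar (VY (Suc j)) \<in> combs 2"
      using combs_param_mult[OF y_in_combs, of "Suc j" i 2] 3 Suc.prems by simp
    moreover have "param j * bvar (VY (Suc i)) \<in> combs 2"
      using combs_param_mult[OF y_in_combs, of "Suc i" j 2] 3 Suc.prems by simp
    ultimately show ?thesis unfolding eq
      by (intro combs_diff combs.add) (auto intro: combs.ideal)
  qed
qed

lemma combs_y: 
  assumes "p \<in> combs s"
  shows "bvar (VY j) * p \<in> combs (s + 2)"
proof (cases "1 \<le> j \<and> j \<le> N")
  case False
  then have "bvar (VY j) \<in> Q" by (intro outside_in_Q) (auto simp: binvars_def)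
  then show ?thesis by (intro combs.ideal span_mult_right)
next
  case True
  show ?thesis using assms
  proof (induction rule: combs.induct)
    case (base f i)
    have "bvar (VY j) * basis i \<in> combs 2"
    proof (cases "i = 0")
      case True
      then show ?thesis using combs_mono[OF y_in_combs[of j], of 2] \<open>1 \<le> j \<and> j \<le> N\<close> by (simp add: basis_def)
    next
      case False
      then have "i \<le> N" using base by (auto simp: basis_ix_def)
      then show ?thesis using False y_mult_y[of i j] y_mult_y[of j i] True
        by (cases "i \<le> j") (auto simp: basis_def mult.commute)
    qed
    then have "param_map f * (bvar (VY j) * basis i) \<in> combs (s + 2)"
      using base by (intro combs_scale) auto
    then show ?case by (simp add: mult_ac)
  next
    case (ideal q)
    then show ?case by (intro combs.ideal idl.span_scale)
  qed (auto simp: distrib_left intro: combs.add)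
qed

lemma combs_bvar:
  assumes "p \<in> combs s"
  shows "bvar v * p \<in> combs (s + 2)"
proof (cases v)
  case (VY j)
  then show ?thesis using combs_y[OF assms] by simp
next
  case (VX j)
  show ?thesis
  proof (cases "1 \<le> j \<and> j \<le> N")
    case False
    then have "bvar (VX j) \<in> Q" by (intro outside_in_Q) (auto simp: binvars_def)
    then show ?thesis unfolding VX by (intro combs.ideal span_mult_right)
  next
    case True
    then obtain i where i: "j = Suc i" "i \<le> N" by (cases j) auto
    have "bvar v * p = bvar (VY i) * p - param i * p" by (simp add: VX i param_def algebra_simps)
    then show ?thesis using combs_y[OF assms, of i] combs_param_mult[OF assms i(2), of "s + 2"]
      by (auto intro: combs_diff)
  qed
qed

text \<open>Each variable costs at most 2, because rewriting a product of two y's may produce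
  coefficients of degree 2. The doubling does not affect the order of growth.\<close>

lemma degle_combs: "p \<in> degle s \<Longrightarrow> p \<in> combs (2 * s)"
proof (induction rule: degle_induct)
  case (const c)
  then show ?case using combs.base[of "const c" 0 0] by (simp add: basis_ix_def basis_def)
next
  case (var s v p)
  then show ?case using combs_bvar[of p "2 * s" v] by simp
qed (auto intro: combs.add combs_mono)

lemma combs_rep:
  assumes "p \<in> combs s"
  shows "\<exists>f. (\<forall>j\<in>basis_ix. f j \<in> polys param_vars \<and> f j \<in> degle s) \<and>
    p - (\<Sum>j\<in>basis_ix. param_map (f j) * basis j) \<in> Q"
  using assms
proof (induction rule: combs.induct)
  case (base f j)
  have "(\<Sum>i\<in>basis_ix. param_map (if i = j then f else 0) * basis i) =
    (\<Sum>i\<in>basis_ix. if i = j then param_map f * basis j else 0)"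
    by (rule sum.cong) auto
  also have "\<dots> = param_map f * basis j"
    using base by (simp add: sum.delta)
  finally show ?case using base
    by (intro exI[of _ "\<lambda>i. if i = j then f else 0"]) (simp add: idl.span_zero)
next
  case (ideal q)
  then show ?case by (intro exI[of _ "\<lambda>_. 0"]) simp
next
  case (add p q)
  then obtain f g where f: "\<forall>j\<in>basis_ix. f j \<in> polys param_vars \<and> f j \<in> degle s"
      "p - (\<Sum>j\<in>basis_ix. param_map (f j) * basis j) \<in> Q"
    and g: "\<forall>j\<in>basis_ix. g j \<in> polys param_vars \<and> g j \<in> degle s"
      "q - (\<Sum>j\<in>basis_ix. param_map (g j) * basis j) \<in> Q" by blast
  have "p + q - (\<Sum>j\<in>basis_ix. param_map (f j + g j) * basis j) =
    (p - (\<Sum>j\<in>basis_ix. param_map (f j) * basis j)) + (q - (\<Sum>j\<in>basis_ix. param_map (g j) * basis j))"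
    by (simp add: distrib_right sum.distrib)
  then have "p + q - (\<Sum>j\<in>basis_ix. param_map (f j + g j) * basis j) \<in> Q"
    using idl.span_add[OF f(2) g(2)] by metis
  then show ?case using f(1) g(1)
    by (intro exI[of _ "\<lambda>j. f j + g j"] conjI ballI polys_add degle_add) auto
qed

text \<open>In the model \<open>y_i = u x_i\<close> on the clique, so that \<open>u\<close> is a root of the polynomial
  \<open>model_rel\<close> of degree \<open>N - k\<close>, over the ring in the parameters.\<close>

primrec model_x :: "nat \<Rightarrow> 'k::field bpoly poly" where
  "model_x 0 = 0"
| "model_x (Suc i) = (if i = 0 then [:- bvar (VX 0):] else if i \<le> k then [:bvar (VY i) - bvar (VX i):]
     else pCons (- bvar (VX i)) (model_x i))"

text \<open>The values are forced by sending \<open>param i\<close> to \<open>VX i\<close>: x_{i+1}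
  must be y_i - \<open>VX i\<close>, with y_0 = 0 and x_{N+1} = 0. The latter makes y_N equal to
  \<open>VX N\<close>, so that y_N = u x_N becomes the relation \<open>model_rel\<close>.\<close>

definition model_y :: "nat \<Rightarrow> 'k::field bpoly poly" where
  "model_y i = (if i \<le> k then [:bvar (VY i):] else if i < N then pCons 0 (model_x i)
     else [:bvar (VX N):])"

definition model :: "'k::field bpoly \<Rightarrow> 'k bpoly poly" where
  "model = subst (\<lambda>c. [:const c:]) (\<lambda>v. if v \<notin> binvars N then 0 else
     (case v of VX i \<Rightarrow> model_x i | VY i \<Rightarrow> model_y i))"

definition model_rel :: "'k::field bpoly poly" where
  "model_rel = pCons (- bvar (VX N)) (model_x N)"

lemma degree_model_x:
  "model_x (Suc k + t) \<noteq> (0 :: 'k::field bpoly poly) \<and> degree (model_x (Suc k + t) :: 'k bpoly poly) = t"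
  by (induction t) (auto simp: degree_pCons_eq)

lemma degree_model_rel: "model_rel \<noteq> (0 :: 'k::field bpoly poly)"
  "degree (model_rel :: 'k::field bpoly poly) = N - k"
proof -
  have "N = Suc k + (N - Suc k)" using kN by simp
  then have *: "model_x N \<noteq> (0 :: 'k bpoly poly) \<and> degree (model_x N :: 'k bpoly poly) = N - Suc k"
    using degree_model_x[of "N - Suc k"] by metis
  then show "model_rel \<noteq> (0 :: 'k::field bpoly poly)"
    "degree (model_rel :: 'k::field bpoly poly) = N - k" 
    using kN by (auto simp: model_rel_def degree_pCons_eq)
qed

lemma model_Q: 
  fixes q :: "'k::field bpoly"
  assumes "q \<in> Q"
  shows "model_rel dvd model q"
proof -
  have "model q \<in> idl.span {model_rel}"
    unfolding model_def
  proof (rule cp.subst_ideal[OF assms])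
    fix g :: "'k bpoly" assume "g \<in> Qgens"
    then consider v where "g = bvar v" "v \<notin> binvars N"
      | i j where "g = minor i j" "k < i" "i < j" "j \<le> N"
      by (auto simp: edge_ideal_gens_def clique_edge_def)
    then show "subst (\<lambda>c. [:const c:]) (\<lambda>v. if v \<notin> binvars N then 0 else
        (case v of VX i \<Rightarrow> model_x i | VY i \<Rightarrow> model_y i)) g \<in> idl.span {model_rel}"
    proof cases
      case 1
      then show ?thesis by (simp add: idl.span_zero)
    next
      case 2
      have in_vars: "VX l \<in> binvars N" "VY l \<in> binvars N" if "k < l" "l \<le> N" for l
        using that by (auto simp: binvars_def)
      have u: "p * [:c:] - q * pCons 0 p = - p * pCons (- c) q" for c and p q :: "'k bpoly poly"
      proof -
        have "pCons 0 p = [:0, 1:] * p" "pCons (- c) q = [:0, 1:] * q - [:c:]" by simp_all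
        then show ?thesis by (simp only: algebra_simps) simp
      qed
      show ?thesis
      proof (cases "j = N")
        case True
        have "model_x i * [:bvar (VX N) :: 'k bpoly:] - model_x N * pCons 0 (model_x i) = - model_x i * model_rel"
          unfolding model_rel_def by (rule u)
        then show ?thesis using 2 True in_vars[of i] in_vars[of j]
          by (simp add: minor_def model_y_def idl.span_base idl.span_scale idl.span_neg)
      next
        case False
        then show ?thesis using 2 in_vars[of i] in_vars[of j]
          by (simp add: minor_def model_y_def idl.span_zero mult.commute)
      qed
    qed
  qed
  then show ?thesis by (auto simp: idl.span_singleton)
qed

lemma model_param:
  fixes f :: "'k::field bpoly"
  assumes "f \<in> polys param_vars"
  shows "model (param_map f) = [:f:]"
proof -
  have "model (param_map f) = subst (\<lambda>c. [:const c:]) (\<lambda>v. model (case v of VX i \<Rightarrow> param i | VY j \<Rightarrow> bvar (VY j))) f"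
    unfolding model_def param_map_def by (rule subst_poly_subst)
  also have "\<dots> = subst (\<lambda>c. [:const c:]) (\<lambda>v. [:bvar v:]) f"
  proof (rule cp.subst_cong)
    show "\<forall>m\<in>keys f. keys m \<subseteq> param_vars" using assms by (simp add: polys_def)
    fix v assume "v \<in> param_vars"
    then consider i where "v = VX i" "i \<le> N" | i where "v = VY i" "1 \<le> i" "i \<le> k"
      by (auto simp: param_vars_def)
    then show "model (case v of VX i \<Rightarrow> param i | VY j \<Rightarrow> bvar (VY j)) = [:bvar v :: 'k bpoly:]"
    proof cases
      case 1
      then show ?thesis using kN
        by (cases "i = 0"; cases "i = N") (auto simp: model_def param_def binvars_def model_y_def)
    next
      case 2
      then show ?thesis using kN by (auto simp: model_def binvars_def model_y_def)
    qed
  qed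
  finally show ?thesis by (simp add: subst_const_poly)
qed

text \<open>In the model the basis elements have the distinct degrees 0, 1, ..., N - k - 1 in u, all
  below that of \<open>model_rel\<close>. A combination divisible by \<open>model_rel\<close> is
  therefore zero, and then so are its coefficients.\<close>

lemma combs_unique:
  fixes f :: "nat \<Rightarrow> 'k::field bpoly"
  assumes f: "\<And>j. j \<in> basis_ix \<Longrightarrow> f j \<in> polys param_vars"
    and Q: "(\<Sum>j\<in>basis_ix. param_map (f j) * basis j) \<in> Q" and "j \<in> basis_ix"
  shows "f j = 0"
proof -
  let ?w = "\<lambda>j. model (basis j :: 'k bpoly)"
  have model_simps: "model (p * q) = model p * model q" "model (sum g A) = (\<Sum>i\<in>A. model (g i))"
    for p q :: "'k bpoly" and g A
    by (simp_all add: model_def cp.subst_sum)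
  have w0: "?w 0 = 1" by (simp add: model_def basis_def)
  have wj: "?w j = pCons 0 (model_x j)" if "k < j" "j < N" for j
    using that by (auto simp: model_def basis_def binvars_def model_y_def)
  have deg: "?w j \<noteq> 0 \<and> degree (?w j) = (if j = 0 then 0 else j - k)" if "j \<in> basis_ix" for j
  proof (cases "j = 0")
    case False
    then have j: "k < j" "j < N" using that by (auto simp: basis_ix_def)
    then have "Suc k + (j - Suc k) = j" by simp
    then show ?thesis using degree_model_x[of "j - Suc k", where 'k='k] j wj[OF j]
      by (auto simp: degree_pCons_eq)
  qed (simp add: w0)
  let ?S = "\<Sum>j\<in>basis_ix. [:f j:] * ?w j"
  have "?S = model (\<Sum>j\<in>basis_ix. param_map (f j) * basis j)"
    using f by (simp add: model_simps model_param)
  then have dvd: "model_rel dvd ?S" using model_Q[OF Q] by simp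
  have "degree ([:f j:] * ?w j) \<le> N - k - 1" if "j \<in> basis_ix" for j
  proof -
    have "degree ([:f j:] * ?w j) \<le> degree (?w j)"
      by (metis degree_mult_le degree_pCons_0 add_0)
    also have "\<dots> \<le> N - k - 1" using deg[OF that] that kN by (auto simp: basis_ix_def)
    finally show ?thesis .
  qed
  then have "degree ?S \<le> N - k - 1" by (intro degree_sum_le) auto
  then have "degree ?S < degree (model_rel :: 'k bpoly poly)" using kN by (simp add: degree_model_rel)
  then have "?S = 0" using dvd_imp_degree_le[OF dvd] by linarith
  moreover have "inj_on (\<lambda>j. degree (?w j)) basis_ix"
    using deg by (intro inj_onI) (auto simp: basis_ix_def split: if_splits)
  ultimately show ?thesis
    using deg assms(3) by (intro poly_independent_of_degrees[of basis_ix ?w f j]) auto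
qed

section \<open>Consequences of freeness: regular sequences and Hilbert functions\<close>

text \<open>As the quotient is free over the parameters, these form a regular sequence in any order.
  Comparing coefficients reduces this to a polynomial ring, where the variable v is a nonzerodivisor
  modulo the variables in \<open>Z\<close>.\<close>

lemma param_regular:
  fixes p :: "'k::field bpoly"
  assumes v: "v \<in> param_vars" "v \<notin> Z" and Z: "Z \<subseteq> param_vars"
    and vp: "param_map (bvar v) * p \<in> idl.span (Qgens \<union> param_map ` bvar ` Z)"
  shows "p \<in> idl.span (Qgens \<union> param_map ` bvar ` Z)"
proof -
  define \<tau> :: "'k bpoly \<Rightarrow> 'k bpoly" where "\<tau> = subst const (\<lambda>v. if v \<in> Z then 0 else bvar v)"
  obtain s where "p \<in> degle s" using ex_degle by blast
  then obtain f where f: "\<And>j. j \<in> basis_ix \<Longrightarrow> f j \<in> polys param_vars"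
    and pf: "p - (\<Sum>j\<in>basis_ix. param_map (f j) * basis j) \<in> Q"
    using combs_rep[OF degle_combs] by blast
  obtain q r where qr: "param_map (bvar v) * p = q + r" "q \<in> Q" "r \<in> idl.span (param_map ` bvar ` Z)"
    using vp unfolding idl.span_Un by blast
  \<comment> \<open>An element of the ideal of \<open>Z\<close> has an expansion whose coefficients
    vanish once the variables in \<open>Z\<close> are set to zero.\<close>
  have "\<exists>g. (\<forall>j\<in>basis_ix. g j \<in> polys param_vars \<and> \<tau> (g j) = 0) \<and>
      r - (\<Sum>j\<in>basis_ix. param_map (g j) * basis j) \<in> Q"
    using qr(3)
  proof (induction rule: idl.span_induct_alt)
    case base
    then show ?case by (intro exI[of _ "\<lambda>_. 0"]) (simp add: \<tau>_def idl.span_zero)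
  next
    case (step c x y)
    then obtain z where z: "z \<in> Z" "x = param_map (bvar z)" by auto
    obtain s where "c \<in> degle s" using ex_degle by blast
    then obtain h where h: "\<And>j. j \<in> basis_ix \<Longrightarrow> h j \<in> polys param_vars"
      and ch: "c - (\<Sum>j\<in>basis_ix. param_map (h j) * basis j) \<in> Q"
      using combs_rep[OF degle_combs] by blast
    obtain g where g: "\<forall>j\<in>basis_ix. g j \<in> polys param_vars \<and> \<tau> (g j) = 0"
      "y - (\<Sum>j\<in>basis_ix. param_map (g j) * basis j) \<in> Q" using step by blast
    have "c * x + y - (\<Sum>j\<in>basis_ix. param_map (bvar z * h j + g j) * basis j) =
      x * (c - (\<Sum>j\<in>basis_ix. param_map (h j) * basis j)) + (y - (\<Sum>j\<in>basis_ix. param_map (g j) * basis j))"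
      by (simp add: z(2) algebra_simps sum.distrib sum_distrib_left)
    also have "\<dots> \<in> Q" by (intro idl.span_add idl.span_scale ch g)
    finally show ?case using g h z Z
      by (intro exI[of _ "\<lambda>j. bvar z * h j + g j"]) (auto simp: \<tau>_def intro!: polys_add polys_mult)
  qed
  then obtain g where g: "\<And>j. j \<in> basis_ix \<Longrightarrow> g j \<in> polys param_vars" "\<And>j. j \<in> basis_ix \<Longrightarrow> \<tau> (g j) = 0"
      and rg: "r - (\<Sum>j\<in>basis_ix. param_map (g j) * basis j) \<in> Q" by blast
  have "(\<Sum>j\<in>basis_ix. param_map (bvar v * f j - g j) * basis j) =
     (r - (\<Sum>j\<in>basis_ix. param_map (g j) * basis j)) + q -
     param_map (bvar v) * (p - (\<Sum>j\<in>basis_ix. param_map (f j) * basis j))"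
    using qr(1) by (simp add: algebra_simps sum_subtractf sum_distrib_left)
  also have "\<dots> \<in> Q" using qr by (intro idl.span_diff idl.span_add idl.span_scale rg pf)
  finally have "bvar v * f j - g j = 0" if "j \<in> basis_ix" for j
    using that f g v by (intro combs_unique[of "\<lambda>j. bvar v * f j - g j"]) (auto intro!: polys_diff polys_mult)
  then have "\<tau> (bvar v * f j) = 0" if "j \<in> basis_ix" for j using g(2) that by force
  then have \<tau>f: "\<tau> (f j) = 0" if "j \<in> basis_ix" for j
    using that v(2) by (auto simp: \<tau>_def)
  have "param_map (f j) \<in> idl.span (param_map ` bvar ` Z)" if "j \<in> basis_ix" for j
  proof -
    have "subst const bvar (f j) - \<tau> (f j) \<in> idl.span (bvar ` Z)"
      unfolding \<tau>_def by (rule ch.subst_cong_ideal[of UNIV]) (auto intro: idl.span_base idl.span_zero)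
    then have "f j \<in> idl.span (bvar ` Z)" using \<tau>f[OF that] by simp
    then show ?thesis unfolding param_map_def by (rule ch.subst_ideal) (auto intro: idl.span_base)
  qed
  then have "(\<Sum>j\<in>basis_ix. param_map (f j) * basis j) \<in> idl.span (param_map ` bvar ` Z)"
    by (intro idl.span_sum span_mult_right)
  moreover have "p = (p - (\<Sum>j\<in>basis_ix. param_map (f j) * basis j)) + (\<Sum>j\<in>basis_ix. param_map (f j) * basis j)"
    by simp
  ultimately show ?thesis unfolding idl.span_Un using pf by blast
qed

text \<open>The spanning set consists of basis elements times parameter monomials of degree at most
  2s; the exponent N + 1 + k is the number of parameters.\<close>

lemma finite_spanning:
  "\<exists>B :: 'k::field bpoly set. finite B \<and> card B \<le> N * (2 * s + 1) ^ (N + 1 + k) \<and>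
     (\<forall>p\<in>degle s. \<exists>b\<in>vs.span B. p - b \<in> Q)"
proof -
  define M where "M = {m. keys m \<subseteq> param_vars \<and> tdeg m \<le> 2 * s}"
  define B :: "'k bpoly set" where "B = (\<lambda>(m, j). param_map (single m 1) * basis j) ` (M \<times> basis_ix)"
  have M: "finite M" "card M \<le> (2 * s + 1) ^ (N + 1 + k)"
    using card_monomials_le[OF finite_param_vars, of "2 * s"] by (simp_all add: M_def card_param_vars)
  have "card B \<le> card (M \<times> basis_ix)" unfolding B_def by (rule card_image_le) (simp add: M)
  also have "\<dots> \<le> (2 * s + 1) ^ (N + 1 + k) * N"
    unfolding card_cartesian_product using M card_basis_ix by (intro mult_mono) auto
  finally have card: "card B \<le> N * (2 * s + 1) ^ (N + 1 + k)" by (simp add: mult.commute)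
  have "\<exists>b\<in>vs.span B. p - b \<in> Q" if p: "p \<in> degle s" for p
  proof -
    obtain f where f: "\<And>j. j \<in> basis_ix \<Longrightarrow> f j \<in> polys param_vars \<and> f j \<in> degle (2 * s)"
      and pf: "p - (\<Sum>j\<in>basis_ix. param_map (f j) * basis j) \<in> Q"
      using combs_rep[OF degle_combs[OF p]] by blast
    have "param_map (f j) * basis j \<in> vs.span B" if j: "j \<in> basis_ix" for j
    proof -
      have eq: "f j = (\<Sum>m\<in>keys (f j). const (lookup (f j) m) * single m 1)"
        by (simp add: const_def mult_single sum_singles)
      have "param_map (f j) * basis j =
        (\<Sum>m\<in>keys (f j). const (lookup (f j) m) * (param_map (single m 1) * basis j))"
        by (subst eq) (simp add: param_map_def ch.subst_sum sum_distrib_right mult.assoc)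
      also have "\<dots> \<in> vs.span B"
      proof (intro vs.span_sum vs.span_scale vs.span_base)
        fix m assume "m \<in> keys (f j)"
        then have "m \<in> M" using f[OF j] by (auto simp: M_def polys_def degle_def)
        then show "param_map (single m 1) * basis j \<in> B" using j by (auto simp: B_def)
      qed
      finally show ?thesis .
    qed
    then show ?thesis using pf by (intro bexI[of _ "\<Sum>j\<in>basis_ix. param_map (f j) * basis j"] vs.span_sum)
  qed
  then show ?thesis using card M by (intro exI[of _ B]) (auto simp: B_def)
qed

end

section \<open>Growth of quotients\<close>

definition indep_mod :: "'k::field bpoly set \<Rightarrow> nat \<Rightarrow> (nat \<Rightarrow> 'k bpoly) \<Rightarrow> bool" where
  "indep_mod I D b \<longleftrightarrow> (\<forall>c. (\<Sum>i<D. const (c i) * b i) \<in> I \<longrightarrow> (\<forall>i<D. c i = 0))"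

text \<open>A lower bound for the Hilbert function: the image of \<open>degle s\<close> modulo
  \<open>I\<close> has dimension at least \<open>D\<close> over the field.\<close>

definition large_mod :: "'k::field bpoly set \<Rightarrow> nat \<Rightarrow> nat \<Rightarrow> bool" where
  "large_mod I s D \<longleftrightarrow> (\<exists>b. (\<forall>i<D. b i \<in> degle s) \<and> indep_mod I D b)"

text \<open>The Hilbert function of the quotient by \<open>I\<close> is in \<open>O(s\<^sup>d)\<close>.\<close>

definition growth_le :: "'k::field bpoly set \<Rightarrow> nat \<Rightarrow> bool" where
  "growth_le I d \<longleftrightarrow> (\<exists>A. \<forall>s. \<exists>B. finite B \<and> card B \<le> A * (2 * s + 1) ^ d \<and>
     (\<forall>p\<in>degle s. \<exists>b\<in>vs.span B. p - b \<in> I))"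

lemma sum_lessThan_add:
  fixes f :: "nat \<Rightarrow> 'a::comm_monoid_add"
  shows "(\<Sum>i<a + c. f i) = (\<Sum>i<a. f i) + (\<Sum>i<c. f (a + i))"
  by (induction c) (simp_all add: add.assoc)

lemma large_mod_0 [simp]: "large_mod I s 0"
  by (simp add: large_mod_def indep_mod_def)

lemma large_mod_mono: "large_mod I s D \<Longrightarrow> s \<le> t \<Longrightarrow> large_mod I t D"
  unfolding large_mod_def using degle_mono by blast

lemma large_mod_1:
  assumes "idl.subspace I" "1 \<notin> I"
  shows "large_mod I s 1"
proof -
  have "c = 0" if "const c \<in> I" for c
  proof (rule ccontr)
    assume "c \<noteq> 0"
    then have "const (inverse c) * const c \<in> I" using idl.subspace_scale[OF assms(1) that] by blast
    then show False using \<open>c \<noteq> 0\<close> assms(2) by (simp add: const_inverse)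
  qed
  then show ?thesis unfolding large_mod_def indep_mod_def by (intro exI[of _ "\<lambda>_. 1"]) auto
qed

text \<open>The f b_i are joined to the elements that are independent modulo \<open>I'\<close>.
  Modulo \<open>I'\<close> the former vanish, which kills the coefficients of the latter; then f
  cancels modulo \<open>I\<close>.\<close>

lemma large_mod_step:
  fixes f :: "'k::field bpoly"
  assumes f: "f \<in> degle e" "f \<in> I'" "\<And>v. f * v \<in> I \<Longrightarrow> v \<in> I"
    and I: "I \<subseteq> I'" "idl.subspace I'" and a: "large_mod I s a" and c: "large_mod I' (s + e) c"
  shows "large_mod I (s + e) (a + c)"
proof -
  obtain b where b: "\<And>i. i < a \<Longrightarrow> b i \<in> degle s" "indep_mod I a b"
    using a by (auto simp: large_mod_def)
  obtain b' where b': "\<And>i. i < c \<Longrightarrow> b' i \<in> degle (s + e)" "indep_mod I' c b'"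
    using c by (auto simp: large_mod_def)
  define h where "h i = (if i < a then f * b i else b' (i - a))" for i
  have "indep_mod I (a + c) h"
    unfolding indep_mod_def
  proof (intro allI impI)
    fix w :: "nat \<Rightarrow> 'k" and i
    assume w: "(\<Sum>i<a + c. const (w i) * h i) \<in> I" and i: "i < a + c"
    have eq: "(\<Sum>i<a + c. const (w i) * h i) =
      f * (\<Sum>i<a. const (w i) * b i) + (\<Sum>i<c. const (w (a + i)) * b' i)"
      by (simp add: sum_lessThan_add h_def sum_distrib_left mult_ac)
    have "f * (\<Sum>i<a. const (w i) * b i) \<in> I'"
      using idl.subspace_scale[OF I(2) f(2)] by (metis mult.commute)
    then have "(\<Sum>i<a + c. const (w i) * h i) - f * (\<Sum>i<a. const (w i) * b i) \<in> I'"
      using w I by (intro idl.subspace_diff) auto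
    then have "(\<Sum>i<c. const (w (a + i)) * b' i) \<in> I'" by (simp add: eq)
    then have 2: "\<forall>i<c. w (a + i) = 0"
      using b'(2) unfolding indep_mod_def by (auto dest: spec[of _ "\<lambda>i. w (a + i)"])
    then have "f * (\<Sum>i<a. const (w i) * b i) \<in> I" using w by (simp add: eq)
    then have "(\<Sum>i<a. const (w i) * b i) \<in> I" by (rule f(3))
    then have 1: "\<forall>i<a. w i = 0" using b(2) by (simp add: indep_mod_def)
    show "w i = 0"
    proof (cases "i < a")
      case False
      then have "i - a < c" "i = a + (i - a)" using i by auto
      then show ?thesis using 2 by metis
    qed (use 1 in auto)
  qed
  moreover have "h i \<in> degle (s + e)" if "i < a + c" for i
    using that b(1) b'(1) degle_mult[OF f(1), of "b i" s] by (auto simp: h_def add.commute)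
  ultimately show ?thesis unfolding large_mod_def by blast
qed

text \<open>The induction starts at the top of the chain, where 1 alone is independent. Repeating
  the step within each ideal adds up binomial coefficients by Pascal's rule.\<close>

lemma large_mod_chain:
  assumes I: "\<And>i. i \<le> r \<Longrightarrow> idl.subspace (I i)" "\<And>i. i < r \<Longrightarrow> I i \<subseteq> I (Suc i)" "1 \<notin> I r"
    and f: "\<And>i. i < r \<Longrightarrow> f i \<in> degle e" "\<And>i. i < r \<Longrightarrow> f i \<in> I (Suc i)"
      "\<And>i v. i < r \<Longrightarrow> f i * v \<in> I i \<Longrightarrow> v \<in> I i"
  shows "j \<le> r \<Longrightarrow> large_mod (I (r - j)) (e * s) (s choose j)"
proof (induction j arbitrary: s)
  case 0
  then show ?case using large_mod_1[of "I r"] I by simp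
next
  case (Suc j)
  define i where "i = r - Suc j"
  have i: "i < r" "r - j = Suc i" using Suc.prems by (auto simp: i_def)
  have IH: "large_mod (I (Suc i)) (e * s) (s choose j)" for s using Suc i by auto
  have "large_mod (I i) (e * s) (s choose Suc j)" for s
  proof (induction s)
    case (Suc s)
    have "large_mod (I i) (e * s + e) ((s choose Suc j) + (s choose j))"
      using f i I by (intro large_mod_step[OF _ _ _ _ _ Suc, of "f i" e "I (Suc i)"]) (auto intro: large_mod_mono[OF IH])
    then show ?case by (simp add: add.commute)
  qed simp
  then show ?case by (simp add: i_def)
qed

lemma large_mod_le_card:
  fixes I :: "'k::field bpoly set"
  assumes B: "finite B" "\<And>p. p \<in> degle s \<Longrightarrow> \<exists>b\<in>vs.span B. p - b \<in> I"
    and I: "idl.subspace I" and "large_mod I s D"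
  shows "D \<le> card B"
proof -
  obtain b where b: "\<And>i. i < D \<Longrightarrow> b i \<in> degle s" and ind: "indep_mod I D b"
    using assms(4) by (auto simp: large_mod_def)
  have "\<forall>i\<in>{..<D}. \<exists>e. e \<in> vs.span B \<and> b i - e \<in> I" using b B(2) by blast
  then obtain e where e: "\<And>i. i < D \<Longrightarrow> e i \<in> vs.span B" "\<And>i. i < D \<Longrightarrow> b i - e i \<in> I"
    by (metis lessThan_iff)
  have key: "\<forall>i<D. c i = 0" if "(\<Sum>i<D. const (c i) * e i) = 0" for c
  proof -
    have "(\<Sum>i<D. const (c i) * b i) = (\<Sum>i<D. const (c i) * (b i - e i))"
      using that by (simp add: right_diff_distrib sum_subtractf)
    also have "\<dots> \<in> I" using e I by (intro idl.subspace_sum idl.subspace_scale) auto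
    finally show ?thesis using ind by (simp add: indep_mod_def)
  qed
  \<comment> \<open>Repetitions must be excluded separately, since \<open>vs.independent\<close>
    speaks of the set of representatives.\<close>
  have inj: "inj_on e {..<D}"
  proof (rule inj_onI, rule ccontr)
    fix i j assume ij: "i \<in> {..<D}" "j \<in> {..<D}" "e i = e j" "i \<noteq> j"
    define c :: "nat \<Rightarrow> 'k" where "c l = (if l = i then 1 else if l = j then - 1 else 0)" for l
    have "(\<Sum>l<D. const (c l) * e l) = (\<Sum>l\<in>{i, j}. const (c l) * e l)"
      using ij by (intro sum.mono_neutral_right) (auto simp: c_def)
    also have "\<dots> = 0" using ij by (simp add: c_def const_minus)
    finally show False using key[of c] ij by (auto simp: c_def)
  qed
  have "vs.independent (e ` {..<D})"
  proof (rule vs.independent_if_scalars_zero)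
    fix g x assume g: "(\<Sum>x\<in>e ` {..<D}. const (g x) * x) = 0" "x \<in> e ` {..<D}"
    then have "(\<Sum>i<D. const (g (e i)) * e i) = 0" using inj by (simp add: sum.reindex)
    then show "g x = 0" using key[of "\<lambda>i. g (e i)"] g(2) by auto
  qed simp
  moreover have "e ` {..<D} \<subseteq> vs.span B" using e by auto
  ultimately have "card (e ` {..<D}) \<le> card B" using vs.independent_span_bound[OF B(1)] by blast
  then show ?thesis by (simp add: card_image inj)
qed

lemma binomial_growth:
  assumes "\<And>s :: nat. s choose r \<le> A * (E * s + 1) ^ d"
  shows "r \<le> d"
proof (rule ccontr)
  assume "\<not> r \<le> d"
  \<comment> \<open>At s = r t the binomial coefficient is at least t^r, while the right side is at
    most C t^d. For r > d this fails at t = C + 1.\<close>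
  define C where "C = A * (E * r + 1) ^ d"
  define t where "t = C + 1"
  have "r \<le> r * t" by (simp add: t_def)
  have "(real (r * t) / real r) ^ r \<le> real (r * t choose r)"
    using binomial_ge_n_over_k_pow_k[OF \<open>r \<le> r * t\<close>, where ?'a = real] by simp
  then have "real (t ^ r) \<le> real (r * t choose r)" using \<open>\<not> r \<le> d\<close> by simp
  then have "t ^ r \<le> (r * t choose r)" by (simp only: of_nat_le_iff)
  also have "\<dots> \<le> A * (E * (r * t) + 1) ^ d" by (rule assms)
  also have "\<dots> \<le> A * ((E * r + 1) * t) ^ d"
    by (intro mult_left_mono power_mono) (auto simp: t_def algebra_simps)
  also have "\<dots> = C * t ^ d" by (simp only: C_def power_mult_distrib mult.assoc)
  finally have "t ^ r \<le> C * t ^ d" .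
  moreover have "t * t ^ d \<le> t ^ r"
    using \<open>\<not> r \<le> d\<close> power_increasing[of "Suc d" r t] by (simp add: t_def)
  ultimately have "t * t ^ d \<le> C * t ^ d" by linarith
  then show False by (simp add: t_def)
qed

text \<open>The tool behind both upper bounds. The degrees of the \<open>f i\<close> enter only
  through a common bound e, which rescales s.\<close>

lemma chain_length_le_growth:
  fixes I :: "nat \<Rightarrow> 'k::field bpoly set"
  assumes I: "\<And>i. i \<le> r \<Longrightarrow> idl.subspace (I i)" "\<And>i. i < r \<Longrightarrow> I i \<subseteq> I (Suc i)" "1 \<notin> I r"
    and f: "\<And>i. i < r \<Longrightarrow> f i \<in> I (Suc i)" "\<And>i v. i < r \<Longrightarrow> f i * v \<in> I i \<Longrightarrow> v \<in> I i"
    and J: "J \<subseteq> I 0" "growth_le J d"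
  shows "r \<le> d"
proof -
  have "\<forall>i. \<exists>s. f i \<in> degle s" using ex_degle by blast
  then obtain g where g: "\<And>i. f i \<in> degle (g i)" by metis
  define e where "e = Max (insert 0 (g ` {..<r}))"
  have "g i \<le> e" if "i < r" for i using that by (simp add: e_def)
  then have fe: "f i \<in> degle e" if "i < r" for i using that g degle_mono by blast
  obtain A where A: "\<And>s. \<exists>B. finite B \<and> card B \<le> A * (2 * s + 1) ^ d \<and>
     (\<forall>p\<in>degle s. \<exists>b\<in>vs.span B. p - b \<in> J)" using J(2) by (auto simp: growth_le_def)
  have "s choose r \<le> A * (2 * e * s + 1) ^ d" for s
  proof -
    obtain B where B: "finite B" "card B \<le> A * (2 * (e * s) + 1) ^ d"
       "\<And>p. p \<in> degle (e * s) \<Longrightarrow> \<exists>b\<in>vs.span B. p - b \<in> J" using A[of "e * s"] by blast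
    have "large_mod (I 0) (e * s) (s choose r)"
      using large_mod_chain[OF I fe f, of r s] by simp
    moreover have "\<exists>b\<in>vs.span B. p - b \<in> I 0" if "p \<in> degle (e * s)" for p
      using B(3)[OF that] J(1) by blast
    ultimately have "s choose r \<le> card B"
      using large_mod_le_card[OF B(1)] I(1)[of 0] by blast
    then show ?thesis using B(2) by (simp add: mult.assoc)
  qed
  then show ?thesis by (rule binomial_growth)
qed

section \<open>The ascending chain condition\<close>

lemma nat_incseq_subseq:
  fixes f :: "nat \<Rightarrow> nat"
  obtains g where "strict_mono g" "incseq (\<lambda>i. f (g i))"
proof -
  obtain g where g: "strict_mono g" "monoseq (\<lambda>n. f (g n))" using seq_monosub[of f] by blast
  show ?thesis
  proof (cases "incseq (\<lambda>n. f (g n))")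
    case False
    then have dec: "decseq (\<lambda>n. f (g n))" using g(2) by (simp add: monoseq_iff)
    \<comment> \<open>A decreasing sequence of naturals is constant from its minimum on, hence also
      increasing there.\<close>
    obtain n where n: "\<And>m. f (g n) \<le> f (g m)"
      using ex_has_least_nat[of "\<lambda>_. True" 0 "\<lambda>n. f (g n)"] by blast
    have "f (g (n + i)) = f (g n)" for i using n[of "n + i"] decseqD[OF dec, of n "n + i"] by simp
    then have "incseq (\<lambda>i. f (g (n + i)))" by (simp add: incseq_def)
    moreover have "strict_mono (\<lambda>i. g (n + i))" using g(1) by (simp add: strict_mono_def)
    ultimately show ?thesis by (rule that[rotated])
  qed (use g that in blast)
qed

lemma dickson_subseq:
  fixes m :: "nat \<Rightarrow> ('v \<Rightarrow>\<^sub>0 nat)"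
  assumes "finite V"
  shows "\<exists>g. strict_mono g \<and> (\<forall>v\<in>V. incseq (\<lambda>i. lookup (m (g i)) v))"
  using assms
proof induction
  case empty
  then show ?case by (intro exI[of _ id]) (auto simp: strict_mono_def)
next
  case (insert v V)
  then obtain g where g: "strict_mono g" "\<forall>v\<in>V. incseq (\<lambda>i. lookup (m (g i)) v)" by blast
  obtain h where h: "strict_mono h" "incseq (\<lambda>i. lookup (m (g (h i))) v)"
    using nat_incseq_subseq[of "\<lambda>i. lookup (m (g i)) v"] by blast
  have "incseq (\<lambda>i. lookup (m (g (h i))) w)" if "w \<in> V" for w
    using g(2) that h(1) by (auto simp: incseq_def strict_mono_less_eq)
  then show ?case using h(2) strict_mono_o[OF g(1) h(1)] by (intro exI[of _ "\<lambda>i. g (h i)"]) (auto simp: comp_def)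
qed

lemma dickson:
  fixes m :: "nat \<Rightarrow> ('v \<Rightarrow>\<^sub>0 nat)"
  assumes "finite V" "\<And>i. keys (m i) \<subseteq> V"
  obtains i j d where "i < j" "m j = d + m i"
proof -
  obtain g where g: "strict_mono g" "\<forall>v\<in>V. incseq (\<lambda>i. lookup (m (g i)) v)"
    using dickson_subseq[OF assms(1)] by blast
  have "lookup (m (g 0)) v \<le> lookup (m (g 1)) v" for v
  proof (cases "v \<in> V")
    case True
    then show ?thesis using g(2) by (auto simp: incseq_def)
  next
    case False
    then have "v \<notin> keys (m (g 0))" using assms(2) by blast
    then show ?thesis by (simp add: in_keys_iff)
  qed
  then have "m (g 1) = (m (g 1) - m (g 0)) + m (g 0)"
    by (intro poly_mapping_eqI) (simp add: lookup_add lookup_minus)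
  moreover have "g 0 < g 1" using g(1) by (simp add: strict_mono_def)
  ultimately show ?thesis using that by blast
qed

section \<open>Leading monomials and the Hilbert basis theorem\<close>

lemma lookup_single_mult: "lookup (single m c * p) (m + a) = c * lookup (p :: 'k::field bpoly) a"
proof -
  have "single m c * p = (\<Sum>a'\<in>keys p. single (m + a') (c * lookup p a'))"
    using arg_cong[OF sum_singles[of p], of "\<lambda>p. single m c * p"]
    by (simp add: sum_distrib_left mult_single)
  then have "lookup (single m c * p) (m + a) = (\<Sum>a'\<in>keys p. if a' = a then c * lookup p a' else 0)"
    by (simp add: lookup_sum lookup_single when_def cong: if_cong)
  also have "\<dots> = c * lookup p a" by (simp add: sum.delta in_keys_iff)
  finally show ?thesis .
qed

definition lead_monom :: "'k::field bpoly \<Rightarrow> binvar \<Rightarrow>\<^sub>0 nat" where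
  "lead_monom p = Max (keys p)"

lemma lead_monom_in_keys: "p \<noteq> 0 \<Longrightarrow> lead_monom p \<in> keys p"
  unfolding lead_monom_def by (rule Max_in) auto

lemma le_lead_monom: "m \<in> keys p \<Longrightarrow> m \<le> lead_monom p"
  unfolding lead_monom_def by simp

lemma monom_le_add: "a \<le> d + (a :: binvar \<Rightarrow>\<^sub>0 nat)"
proof -
  have "\<not> d < 0" by transfer (simp add: less_fun_def)
  then have "0 \<le> d" by (simp add: not_less)
  then show ?thesis using add_right_mono[of 0 d a] by simp
qed

text \<open>In an infinite descending sequence, Dickson's lemma finds a monomial dividing a later
  one, which is then not smaller. Restricting to finitely many variables is essential, since in the
  lexicographic order the variables themselves form a descending sequence.\<close>

lemma wf_monomials:
  assumes "finite V"
  shows "wf {(a, b :: binvar \<Rightarrow>\<^sub>0 nat). a < b \<and> keys a \<subseteq> V \<and> keys b \<subseteq> V}"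
  unfolding wf_iff_no_infinite_down_chain
proof
  assume "\<exists>f. \<forall>i. (f (Suc i), f i) \<in> {(a, b :: binvar \<Rightarrow>\<^sub>0 nat). a < b \<and> keys a \<subseteq> V \<and> keys b \<subseteq> V}"
  then obtain f :: "nat \<Rightarrow> (binvar \<Rightarrow>\<^sub>0 nat)" where f: "\<And>i. f (Suc i) < f i" "\<And>i. keys (f i) \<subseteq> V" by auto
  obtain i j d where ij: "i < j" "f j = d + f i" using dickson[of V f] assms f(2) by blast
  have "f (i + Suc l) < f i" for l
  proof (induction l)
    case (Suc l)
    then show ?case using f(1)[of "i + Suc l"] by (simp add: less_trans)
  qed (simp add: f(1))
  moreover obtain l where "j = i + Suc l" using less_imp_Suc_add[OF ij(1)] by auto
  ultimately have "f j < f i" by simp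
  then show False using monom_le_add[of "f i" d] ij(2) by simp
qed

definition retract :: "nat \<Rightarrow> 'k::field bpoly \<Rightarrow> 'k bpoly" where
  "retract n = subst const (\<lambda>v. if v \<in> binvars n then bvar v else 0)"

lemma retract_diff: "p - retract n p \<in> idl.span (bvar ` (- binvars n))"
proof -
  have "subst const bvar p - retract n p \<in> idl.span (bvar ` (- binvars n))"
    unfolding retract_def
    by (rule ch.subst_cong_ideal[of UNIV]) (auto intro: idl.span_base idl.span_zero)
  then show ?thesis by simp
qed

lemma retract_polys: "retract n p \<in> polys (binvars n)"
  unfolding retract_def by (rule subst_polys) auto

lemma retract_id: "p \<in> polys (binvars n) \<Longrightarrow> retract n p = p"
  using ch.subst_cong[of "binvars n" "\<lambda>v. if v \<in> binvars n then bvar v else 0" bvar p]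
  by (simp add: polys_def retract_def)

lemma finite_binvars [simp]: "finite (binvars n)"
  by (simp add: binvars_def)

text \<open>In a strictly increasing chain, f_k is chosen in \<open>N (Suc k)\<close> outside
  \<open>N k\<close> with least leading monomial. By Dickson's lemma that of some f_i divides that
  of a later f_j; cancelling it leaves an element of the same kind with a smaller leading monomial.
  Since all outside variables lie in every ideal, f_k can be taken in finitely many
  variables.\<close>

lemma ascending_chain_stationary:
  fixes N :: "nat \<Rightarrow> 'k::field bpoly set"
  assumes N: "\<And>k. idl.subspace (N k)" "\<And>k. N k \<subseteq> N (Suc k)" "bvar ` (- binvars n) \<subseteq> N 0"
  shows "\<exists>k. N k = N (Suc k)"
proof (rule ccontr)
  assume "\<nexists>k. N k = N (Suc k)"
  define V where "V = binvars n"
  have mono: "N i \<subseteq> N j" if "i \<le> j" for i j using that lift_Suc_mono_le[of N, OF N(2)] by blast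
  have out: "idl.span (bvar ` (- binvars n)) \<subseteq> N k" for k
    using N(1,3) mono[of 0 k] by (intro idl.span_minimal) auto
  define F where "F k = N (Suc k) \<inter> polys V - N k" for k
  have "F k \<noteq> {}" for k
  proof -
    obtain p where p: "p \<in> N (Suc k)" "p \<notin> N k" using N(2) \<open>\<nexists>k. N k = N (Suc k)\<close> by blast
    have d: "p - retract n p \<in> N k" "p - retract n p \<in> N (Suc k)" using retract_diff out by blast+
    have "p - (p - retract n p) \<in> N (Suc k)" by (rule idl.subspace_diff[OF N(1) p(1) d(2)])
    moreover have "retract n p \<notin> N k" using idl.subspace_add[OF N(1) d(1), of "retract n p"] p(2) by auto
    ultimately show ?thesis using retract_polys by (auto simp: F_def V_def)
  qed
  have ex: "\<exists>f. f \<in> F k \<and> (\<forall>g\<in>F k. \<not> lead_monom g < lead_monom f)" for k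
  proof -
    obtain x where x: "x \<in> lead_monom ` F k" using \<open>F k \<noteq> {}\<close> by blast
    have "wf {(a, b :: binvar \<Rightarrow>\<^sub>0 nat). a < b \<and> keys a \<subseteq> V \<and> keys b \<subseteq> V}" by (rule wf_monomials) (simp add: V_def)
    from wfE_min[OF this x] obtain m where m: "m \<in> lead_monom ` F k"
      and min: "\<And>y. (y, m) \<in> {(a, b). a < b \<and> keys a \<subseteq> V \<and> keys b \<subseteq> V} \<Longrightarrow> y \<notin> lead_monom ` F k"
      by blast
    have keys: "keys (lead_monom g) \<subseteq> V" if "g \<in> F k" for g
    proof -
      have "g \<noteq> 0" using that idl.subspace_0[OF N(1)] by (auto simp: F_def)
      then show ?thesis using lead_monom_in_keys[of g] that by (auto simp: F_def polys_def)
    qed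
    show ?thesis using m min keys by fast
  qed
  then obtain f where f: "\<And>k. f k \<in> F k" and fmin: "\<And>k g. g \<in> F k \<Longrightarrow> \<not> lead_monom g < lead_monom (f k)"
    by metis
  have f0: "f k \<noteq> 0" for k using f[of k] idl.subspace_0[OF N(1)] by (auto simp: F_def)
  have "keys (lead_monom (f k)) \<subseteq> V" for k
    using lead_monom_in_keys[OF f0] f[of k] by (auto simp: F_def polys_def)
  moreover have "finite V" by (simp add: V_def)
  ultimately obtain i j d where ij: "i < j" "lead_monom (f j) = d + lead_monom (f i)"
    using dickson[of V "\<lambda>k. lead_monom (f k)"] by blast
  let ?a = "lookup (f i) (lead_monom (f i))" and ?b = "lookup (f j) (lead_monom (f j))"
  have a0: "?a \<noteq> 0" using lead_monom_in_keys[OF f0] by (simp add: in_keys_iff)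
  define h where "h = single d (?b / ?a) * f i"
  define g where "g = f j - h"
  have "keys d \<subseteq> V"
  proof -
    have "keys d \<subseteq> keys (lead_monom (f j))" by (auto simp: ij(2) in_keys_iff lookup_add)
    then show ?thesis using \<open>\<And>k. keys (lead_monom (f k)) \<subseteq> V\<close> by blast
  qed
  then have "single d (?b / ?a) \<in> polys V" by (simp add: polys_def)
  then have hV: "h \<in> polys V" using f[of i] by (auto simp: h_def F_def intro: polys_mult)
  have "f i \<in> N (Suc i)" using f by (auto simp: F_def)
  then have hN: "h \<in> N j" unfolding h_def using mono[of "Suc i" j] ij(1)
    by (intro idl.subspace_scale[OF N(1)]) auto
  have "g \<in> N (Suc j)" unfolding g_def using f[of j] hN N(2) by (intro idl.subspace_diff[OF N(1)]) (auto simp: F_def)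
  moreover have "g \<notin> N j"
    using idl.subspace_add[OF N(1) _ hN, of g] f[of j] by (auto simp: g_def F_def)
  moreover have "g \<in> polys V" unfolding g_def using f[of j] hV by (intro polys_diff) (auto simp: F_def)
  ultimately have gF: "g \<in> F j" by (simp add: F_def)
  then have "g \<noteq> 0" using idl.subspace_0[OF N(1)] by (auto simp: F_def)
  have "lookup h (lead_monom (f j)) = ?b" using a0 by (simp add: h_def ij(2) lookup_single_mult)
  then have ne: "lead_monom (f j) \<notin> keys g" by (simp add: g_def in_keys_iff lookup_minus)
  have "m \<le> lead_monom (f j)" if "m \<in> keys g" for m
  proof -
    have "m \<in> keys (f j) \<or> m \<in> keys h" using that by (auto simp: g_def in_keys_iff lookup_minus)
    then show ?thesis
    proof
      assume "m \<in> keys h"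
      then obtain a where "m = d + a" "a \<in> keys (f i)"
        unfolding h_def using Poly_Mapping.keys_mult[of "single d (?b / ?a)" "f i"] by (auto split: if_splits)
      then show ?thesis using le_lead_monom[of a "f i"] ij(2) by (simp add: add_left_mono)
    qed (rule le_lead_monom)
  qed
  then have "lead_monom g < lead_monom (f j)"
    using lead_monom_in_keys[OF \<open>g \<noteq> 0\<close>] ne by (metis order_le_less)
  then show False using fmin[OF gF] by blast
qed

section \<open>An upper bound for the depth\<close>

text \<open>The value at the origin; a nonzero value means a unit in the local ring there. So if s z
  in I always forces \<open>const_part s = 0\<close>, then z is nonzero modulo I locally.\<close>

definition const_part :: "'k::field bpoly \<Rightarrow> 'k bpoly" where
  "const_part = subst const (\<lambda>_. 0)"

lemma const_part_simps [simp]: "const_part (p + q) = const_part p + const_part q"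
  "const_part (p - q) = const_part p - const_part q" "const_part (p * q) = const_part p * const_part q"
  "const_part 1 = 1" "const_part 0 = 0" "const_part (bvar v) = 0"
  by (simp_all add: const_part_def)

lemma power_regular:
  fixes x :: "'a::comm_ring_1"
  assumes "\<And>v. x * v \<in> I \<Longrightarrow> v \<in> I"
  shows "x ^ k * v \<in> I \<Longrightarrow> v \<in> I"
  by (induction k) (auto simp: mult.assoc intro: assms)

text \<open>Passing from \<open>z\<close> to \<open>w\<close> with \<open>t z = x\<^sup>k w\<close> modulo \<open>I\<close>, \<open>t\<close> a unit locally and \<open>k\<close> maximal, keeps the
  annihilator large and makes \<open>w\<close> nonzero modulo \<open>x\<close>, locally at the origin.\<close>

lemma annihilator_step:
  fixes I :: "'k::field bpoly set"
  assumes I: "idl.subspace I" "bvar ` (- binvars n) \<subseteq> I"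
    and x: "const_part x = 0" "\<And>v. x * v \<in> I \<Longrightarrow> v \<in> I"
    and z: "\<And>s. s * z \<in> I \<Longrightarrow> const_part s = 0"
  shows "\<exists>w. (\<forall>s. s * z \<in> I \<longrightarrow> s * w \<in> I) \<and> (\<forall>s. s * w \<in> idl.span (insert x I) \<longrightarrow> const_part s = 0)"
proof -
  have span: "idl.span I = I" using I(1) by simp
  define K where "K j \<longleftrightarrow> (\<exists>t w. const_part t \<noteq> 0 \<and> t * z - x ^ j * w \<in> I)" for j
  \<comment> \<open>The ideals (I + (z)) : x^j increase with j. Where they become stationary, local
    divisibility of z by powers of x must stop.\<close>
  define N where "N j = {w. x ^ j * w \<in> idl.span (insert z I)}" for j
  have "\<exists>k. N k = N (Suc k)"
  proof (rule ascending_chain_stationary[where n = n])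
    show "idl.subspace (N k)" for k
      unfolding N_def by (rule idl.subspaceI)
        (auto simp: distrib_left idl.span_zero mult.left_commute intro: idl.span_add idl.span_scale)
    show "N k \<subseteq> N (Suc k)" for k by (auto simp: N_def mult.assoc intro: idl.span_scale)
    show "bvar ` (- binvars n) \<subseteq> N 0" using I(2) by (auto simp: N_def intro: idl.span_base)
  qed
  then obtain k where k: "N k = N (Suc k)" by blast
  \<comment> \<open>If z were locally divisible by x^(k+1) with cofactor w, then w would lie in N
    (k+1) = N k, so x^k w = s z modulo I and (t - x s) z = 0 modulo I, where t - x s is a local
    unit.\<close>
  have "\<not> K (Suc k)"
  proof
    assume "K (Suc k)"
    then obtain t w where tw: "const_part t \<noteq> 0" "t * z - x ^ Suc k * w \<in> I" by (auto simp: K_def)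
    have "t * z - (t * z - x ^ Suc k * w) \<in> idl.span (insert z I)"
      using tw(2) by (intro idl.span_diff idl.span_scale idl.span_base) auto
    then have "w \<in> N k" by (simp add: k) (simp add: N_def)
    then obtain s where s: "x ^ k * w - s * z \<in> I" by (auto simp: N_def idl.span_insert span)
    have "(t - x * s) * z = (t * z - x ^ Suc k * w) + x * (x ^ k * w - s * z)"
      by (simp add: algebra_simps)
    also have "\<dots> \<in> I" using tw s I(1) by (intro idl.subspace_add idl.subspace_scale)
    finally have "const_part (t - x * s) = 0" by (rule z)
    then show False using tw(1) x(1) by simp
  qed
  moreover have "K 0" unfolding K_def by (intro exI[of _ 1] exI[of _ z]) (simp add: idl.subspace_0[OF I(1)])
  ultimately obtain j where j: "K j" "\<not> K (Suc j)" by (metis nat_induct)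
  then obtain t w where tw: "const_part t \<noteq> 0" "t * z - x ^ j * w \<in> I" by (auto simp: K_def)
  show ?thesis
  proof (intro exI[of _ w] conjI allI impI)
    fix s assume s: "s * z \<in> I"
    have "x ^ j * (s * w) = t * (s * z) - s * (t * z - x ^ j * w)" by (simp add: algebra_simps)
    also have "\<dots> \<in> I" by (rule idl.subspace_diff[OF I(1) idl.subspace_scale[OF I(1) s] idl.subspace_scale[OF I(1) tw(2)]])
    finally show "s * w \<in> I" using power_regular[of x I j "s * w"] x(2) by blast
  next
    fix s assume "s * w \<in> idl.span (insert x I)"
    then obtain c where c: "s * w - c * x \<in> I" by (auto simp: idl.span_insert span)
    have "(s * t) * z - x ^ Suc j * c = s * (t * z - x ^ j * w) + x ^ j * (s * w - c * x)"
      by (simp add: algebra_simps)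
    also have "\<dots> \<in> I" using c tw I(1) by (intro idl.subspace_add idl.subspace_scale)
    finally have "const_part (s * t) = 0" using j(2) unfolding K_def by blast
    then show "const_part s = 0" using tw(1) by simp
  qed
qed

text \<open>A form of the bound of the depth by the dimension of an associated prime. The elements
  produced by \<open>annihilator_step\<close> have growing annihilators modulo the ideals of the
  initial segments; \<open>xs ! i\<close> is a nonzerodivisor modulo the i-th annihilator and lies
  in the next one.\<close>

lemma regular_length_le:
  fixes J :: "'k::field bpoly set"
  assumes J: "bvar ` (- binvars n) \<subseteq> J"
    and xs: "\<And>x. x \<in> set xs \<Longrightarrow> const_part x = 0"
      "\<And>i v. i < length xs \<Longrightarrow> xs ! i * v \<in> idl.span (J \<union> set (take i xs)) \<Longrightarrow> v \<in> idl.span (J \<union> set (take i xs))"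
    and z: "\<And>s. s * z \<in> idl.span J \<Longrightarrow> const_part s = 0"
    and P: "\<And>p. p \<in> P \<Longrightarrow> p * z \<in> idl.span J" "growth_le P d"
  shows "length xs \<le> d"
proof -
  let ?r = "length xs"
  define I where "I i = idl.span (J \<union> set (take i xs))" for i
  have I_Suc: "I (Suc i) = idl.span (insert (xs ! i) (I i))" if "i < ?r" for i
  proof -
    have "idl.span (J \<union> set (take (Suc i) xs)) = idl.span (insert (xs ! i) (J \<union> set (take i xs)))"
      using that by (simp add: take_Suc_conv_app_nth)
    also have "\<dots> = idl.span (insert (xs ! i) (I i))"
      unfolding I_def idl.span_insert idl.span_span ..
    finally show ?thesis by (simp add: I_def)
  qed
  have "\<exists>z. \<forall>i. (i \<le> ?r \<longrightarrow> (\<forall>s. s * z i \<in> I i \<longrightarrow> const_part s = 0) \<and> (i = 0 \<longrightarrow> (\<forall>p\<in>P. p * z i \<in> I i))) \<and>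
      (i < ?r \<longrightarrow> (\<forall>s. s * z i \<in> I i \<longrightarrow> s * z (Suc i) \<in> I i))"
  proof (rule dependent_nat_choice)
    show "\<exists>z. 0 \<le> ?r \<longrightarrow> (\<forall>s. s * z \<in> I 0 \<longrightarrow> const_part s = 0) \<and> (0 = 0 \<longrightarrow> (\<forall>p\<in>P. p * z \<in> I 0))"
      using z P(1) by (intro exI[of _ z]) (simp add: I_def)
  next
    fix z i assume h: "i \<le> ?r \<longrightarrow> (\<forall>s. s * z \<in> I i \<longrightarrow> const_part s = 0) \<and> (i = 0 \<longrightarrow> (\<forall>p\<in>P. p * z \<in> I i))"
    show "\<exists>w. (Suc i \<le> ?r \<longrightarrow> (\<forall>s. s * w \<in> I (Suc i) \<longrightarrow> const_part s = 0) \<and> (Suc i = 0 \<longrightarrow> (\<forall>p\<in>P. p * w \<in> I (Suc i)))) \<and>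
      (i < ?r \<longrightarrow> (\<forall>s. s * z \<in> I i \<longrightarrow> s * w \<in> I i))"
    proof (cases "i < ?r")
      case True
      have "\<exists>w. (\<forall>s. s * z \<in> I i \<longrightarrow> s * w \<in> I i) \<and>
          (\<forall>s. s * w \<in> idl.span (insert (xs ! i) (I i)) \<longrightarrow> const_part s = 0)"
      proof (rule annihilator_step)
        show "bvar ` (- binvars n) \<subseteq> I i" using J by (auto simp: I_def intro: idl.span_base)
        show "v \<in> I i" if "xs ! i * v \<in> I i" for v using xs(2)[OF True, of v] that by (simp add: I_def)
      qed (use h True xs(1) in \<open>auto simp: I_def\<close>)
      then show ?thesis using True by (simp add: I_Suc conj_commute)
    qed simp
  qed
  then obtain z where z0: "\<And>p. p \<in> P \<Longrightarrow> p * z 0 \<in> I 0"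
    and zann: "\<And>i s. i \<le> ?r \<Longrightarrow> s * z i \<in> I i \<Longrightarrow> const_part s = 0"
    and zstep: "\<And>i s. i < ?r \<Longrightarrow> s * z i \<in> I i \<Longrightarrow> s * z (Suc i) \<in> I i" by (metis zero_le)
  define A where "A i = {s. s * z i \<in> I i}" for i
  have I_mono: "I i \<subseteq> I (Suc i)" for i
    unfolding I_def by (intro idl.span_mono) (use set_take_subset_set_take[of i "Suc i" xs] in auto)
  show ?thesis
  proof (rule chain_length_le_growth[of ?r A "\<lambda>i. xs ! i" P])
    show "idl.subspace (A i)" for i
      unfolding A_def I_def by (rule idl.subspaceI)
        (auto simp: distrib_right idl.span_zero mult.assoc intro: idl.span_add idl.span_scale)
    show "A i \<subseteq> A (Suc i)" if "i < ?r" for i using zstep[OF that] I_mono by (auto simp: A_def)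
    show "1 \<notin> A ?r" using zann[of ?r 1] by (auto simp: A_def)
    show "xs ! i \<in> A (Suc i)" if "i < ?r" for i
      unfolding A_def I_Suc[OF that] using span_mult_right[OF idl.span_base[OF insertI1]] by blast
    show "v \<in> A i" if "i < ?r" "xs ! i * v \<in> A i" for i v
      using xs(2)[of i "v * z i"] that by (simp add: A_def I_def mult.assoc)
    show "P \<subseteq> A 0" using z0 by (auto simp: A_def)
  qed (rule P(2))
qed

section \<open>The ideal of a clique with leaves attached to one vertex\<close>

definition regular_on :: "'a::comm_ring_1 set \<Rightarrow> (nat \<Rightarrow> 'a) \<Rightarrow> nat \<Rightarrow> bool" where
  "regular_on I a r \<longleftrightarrow>
     (\<forall>i<r. \<forall>v. a i * v \<in> idl.span (I \<union> a ` {..<i}) \<longrightarrow> v \<in> idl.span (I \<union> a ` {..<i}))"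

lemma span_Un_cong: "idl.span I = idl.span I' \<Longrightarrow> idl.span (I \<union> Y) = idl.span (I' \<union> Y)"
  by (simp add: idl.span_Un)

lemma regular_on_cong: "idl.span I = idl.span I' \<Longrightarrow> regular_on I a r = regular_on I' a r"
  unfolding regular_on_def using span_Un_cong[of I I'] by simp

text \<open>Regularity on the sum keeps the map from R/(I \<inter> I') to R/I \<oplus> R/I'
  injective after dividing by the sequence.\<close>

lemma regular_on_Inter_aux:
  fixes I I' :: "'a::comm_ring_1 set"
  assumes I: "idl.subspace I" "idl.subspace I'"
  shows "regular_on (I \<union> I') a i \<Longrightarrow> w \<in> idl.span (I \<union> a ` {..<i}) \<Longrightarrow> w \<in> idl.span (I' \<union> a ` {..<i})
     \<Longrightarrow> w \<in> idl.span (I \<inter> I' \<union> a ` {..<i})"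
proof (induction i arbitrary: w)
  case 0
  have "w \<in> idl.span I \<inter> idl.span I'" using 0 by simp
  moreover have "idl.span I = I" "idl.span I' = I'" using I by (simp_all only: idl.span_eq_iff)
  ultimately have "w \<in> I \<inter> I'" by (metis (lifting))
  then show ?case by (simp add: idl.span_base)
next
  case (Suc i)
  let ?Y = "a ` {..<i}"
  have ins: "V \<union> a ` {..<Suc i} = insert (a i) (V \<union> ?Y)" for V
    by (auto simp: lessThan_Suc)
  obtain c where c: "w - c * a i \<in> idl.span (I \<union> ?Y)"
    using Suc.prems(2) unfolding ins idl.span_insert by blast
  obtain c' where c': "w - c' * a i \<in> idl.span (I' \<union> ?Y)"
    using Suc.prems(3) unfolding ins idl.span_insert by blast
  have "w - c * a i \<in> idl.span (I \<union> I' \<union> ?Y)" "w - c' * a i \<in> idl.span (I \<union> I' \<union> ?Y)"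
    by (rule subsetD[OF idl.span_mono c], blast) (rule subsetD[OF idl.span_mono c'], blast)
  then have "(w - c' * a i) - (w - c * a i) \<in> idl.span (I \<union> I' \<union> ?Y)"
    using idl.span_diff by blast
  \<comment> \<open>The coefficients c and c' of \<open>a i\<close> differ by an element of the sum,
    that is by b + b'; then c - b = c' + b' serves both ideals at once.\<close>
  then have "a i * (c - c') \<in> idl.span (I \<union> I' \<union> ?Y)" by (simp add: algebra_simps)
  then have "c - c' \<in> idl.span (I \<union> I' \<union> ?Y)"
    using Suc.prems(1) by (simp add: regular_on_def)
  also have "I \<union> I' \<union> ?Y = (I \<union> ?Y) \<union> I'" by blast
  finally obtain b b' where b: "c - c' = b + b'" "b \<in> idl.span (I \<union> ?Y)" "b' \<in> idl.span I'"
    unfolding idl.span_Un[of "I \<union> ?Y" I'] by blast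
  have b': "b' \<in> idl.span (I' \<union> ?Y)" by (rule subsetD[OF idl.span_mono b(3)]) blast
  have "w - (c - b) * a i = (w - c * a i) + a i * b" by (simp add: algebra_simps)
  also have "\<dots> \<in> idl.span (I \<union> ?Y)" by (intro idl.span_add idl.span_scale c b)
  finally have 1: "w - (c - b) * a i \<in> idl.span (I \<union> ?Y)" .
  have "c - b = c' + b'" using b(1) by (simp add: algebra_simps)
  then have "w - (c - b) * a i = (w - c' * a i) - a i * b'" by (simp add: algebra_simps)
  also have "\<dots> \<in> idl.span (I' \<union> ?Y)" by (intro idl.span_diff idl.span_scale c' b')
  finally have 2: "w - (c - b) * a i \<in> idl.span (I' \<union> ?Y)" .
  have "regular_on (I \<union> I') a i" using Suc.prems(1) by (simp add: regular_on_def)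
  from Suc.IH[OF this 1 2] show ?case unfolding ins idl.span_insert by blast
qed

text \<open>The depth inequality for \<open>0 \<rightarrow> R/(I \<inter> I') \<rightarrow> R/I \<oplus> R/I' \<rightarrow> R/(I + I') \<rightarrow> 0\<close>.\<close>

lemma regular_on_Inter:
  fixes I I' :: "'a::comm_ring_1 set"
  assumes I: "idl.subspace I" "idl.subspace I'"
    and reg: "regular_on I a (Suc r)" "regular_on I' a (Suc r)" "regular_on (I \<union> I') a r"
  shows "regular_on (I \<inter> I') a (Suc r)"
  unfolding regular_on_def
proof (intro allI impI)
  fix i v assume i: "i < Suc r" and v: "a i * v \<in> idl.span (I \<inter> I' \<union> a ` {..<i})"
  have "a i * v \<in> idl.span (I \<union> a ` {..<i})" "a i * v \<in> idl.span (I' \<union> a ` {..<i})"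
    by (rule subsetD[OF idl.span_mono v], blast)+
  then have "v \<in> idl.span (I \<union> a ` {..<i})" "v \<in> idl.span (I' \<union> a ` {..<i})"
    using reg(1,2) i by (auto simp: regular_on_def)
  moreover have "regular_on (I \<union> I') a i" using reg(3) i by (auto simp: regular_on_def)
  ultimately show "v \<in> idl.span (I \<inter> I' \<union> a ` {..<i})"
    using regular_on_Inter_aux[OF I] by blast
qed

lemma vs_span_image:
  fixes L :: "'k::field bpoly \<Rightarrow> 'k bpoly"
  assumes "\<And>p q. L (p + q) = L p + L q" "\<And>c p. L (const c * p) = const c * L p"
    and "e \<in> vs.span B"
  shows "L e \<in> vs.span (L ` B)"
  using assms(3)
proof (induction rule: vs.span_induct_alt)
  case base
  have "L 0 = 0" using assms(2)[of 0 0] by simp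
  then show ?case by (simp add: vs.span_zero)
next
  case (step c x y)
  then show ?case
    using vs.span_add[OF vs.span_scale[OF vs.span_base[OF imageI[OF step(1)]]] step(2)]
    by (simp add: assms(1,2))
qed

section \<open>The decomposition of the ideal\<close>

definition cone_edge :: "nat \<Rightarrow> nat \<Rightarrow> nat \<Rightarrow> nat \<Rightarrow> bool" where
  "cone_edge k n i j \<longleftrightarrow> 1 \<le> i \<and> i < j \<and> j \<le> n \<and> (j = n \<or> k < i)"

lemma edge_ideal_gensE:
  assumes "g \<in> edge_ideal_gens n E"
  obtains (outside) v where "g = bvar v" "v \<notin> binvars n" | (minor) i j where "g = minor i j" "E i j"
  using assms by (auto simp: edge_ideal_gens_def)

text \<open>\<open>m\<close> is n - 1, kept as a parameter to avoid subtraction. The hypotheses ask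
  for at least one leaf and at least two vertices in the clique.\<close>

locale leafy_clique =
  fixes k m n :: nat
  assumes k: "1 \<le> k" "k < m" and n: "Suc m = n"
begin

lemma le_n_iff: "j \<le> n \<longleftrightarrow> j \<le> m \<or> j = n" and m_less_n: "m < n"
  using n by auto

sublocale A: clique_with_isolated 0 n
  using k n by unfold_locales simp

text \<open>x_n and y_n belong to \<open>B.Q\<close> and \<open>C.Q\<close> because the variables
  outside 1, ..., m are among the generators.\<close>

sublocale B: clique_with_isolated k m
  using k n by unfold_locales simp

sublocale C: clique_with_isolated 0 m
  using k n by unfold_locales simp

abbreviation Jgens :: "'k::field bpoly set" where "Jgens \<equiv> edge_ideal_gens n (cone_edge k n)"
abbreviation J :: "'k::field bpoly set" where "J \<equiv> idl.span Jgens"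

lemma minor_in_J: "cone_edge k n i j \<Longrightarrow> minor i j \<in> J"
  by (rule idl.span_base) (auto simp: edge_ideal_gens_def)

lemma outside_in_J: "v \<notin> binvars n \<Longrightarrow> bvar v \<in> J"
  by (rule idl.span_base) (auto simp: edge_ideal_gens_def)

lemma apex_in_span: "bvar (VX n) \<in> B.Q" "bvar (VY n) \<in> B.Q" "bvar (VX n) \<in> C.Q" "bvar (VY n) \<in> C.Q"
  using n by (auto intro!: B.outside_in_Q C.outside_in_Q simp: binvars_def)

lemma not_in_binvars_pred: "v \<notin> binvars n \<Longrightarrow> v \<notin> binvars m"
  using n by (auto simp: binvars_def)

lemma J_subset_A: "J \<subseteq> (A.Q :: 'k::field bpoly set)"
proof (rule idl.span_minimal)
  show "(Jgens :: 'k bpoly set) \<subseteq> A.Q"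
    by (auto elim!: edge_ideal_gensE simp: cone_edge_def intro: A.minor_in_Q A.outside_in_Q)
qed simp

lemma J_subset_B: "J \<subseteq> (B.Q :: 'k::field bpoly set)"
proof (rule idl.span_minimal)
  show "Jgens \<subseteq> (B.Q :: 'k bpoly set)"
  proof
    fix g :: "'k bpoly" assume "g \<in> Jgens"
    then consider v where "g = bvar v" "v \<notin> binvars n" | i where "g = minor i n"
      | i j where "g = minor i j" "k < i" "i < j" "j \<le> m"
      by (auto elim!: edge_ideal_gensE simp: cone_edge_def le_n_iff)
    then show "g \<in> B.Q"
    proof cases
      case 1
      then show ?thesis using B.outside_in_Q not_in_binvars_pred by blast
    next
      case 2
      then show ?thesis unfolding minor_def 2
        by (intro idl.span_diff idl.span_scale[OF apex_in_span(2)] span_mult_right[OF apex_in_span(1)])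
    qed (auto intro: B.minor_in_Q)
  qed
qed simp

lemma C_eq: "(C.Q :: 'k::field bpoly set) = idl.span (A.Q \<union> B.Q)"
proof
  show "(C.Q :: 'k bpoly set) \<subseteq> idl.span (A.Q \<union> B.Q)"
  proof (rule idl.span_minimal)
    show "(C.Qgens :: 'k bpoly set) \<subseteq> idl.span (A.Q \<union> B.Q)"
    proof
      fix g :: "'k bpoly" assume "g \<in> C.Qgens"
      then consider v where "g = bvar v" "v \<notin> binvars m"
        | i j where "g = minor i j" "0 < i" "i < j" "j \<le> m"
        by (auto elim!: edge_ideal_gensE simp: clique_edge_def)
      then have "g \<in> A.Q \<union> B.Q"
        using m_less_n by cases (auto intro: A.minor_in_Q B.outside_in_Q)
      then show "g \<in> idl.span (A.Q \<union> B.Q)" by (rule idl.span_base)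
    qed
  qed simp
  have "(A.Qgens :: 'k bpoly set) \<subseteq> C.Q"
  proof
    fix g :: "'k bpoly" assume "g \<in> A.Qgens"
    then consider v where "g = bvar v" "v \<notin> binvars n" | i where "g = minor i n"
      | i j where "g = minor i j" "0 < i" "i < j" "j \<le> m"
      by (auto elim!: edge_ideal_gensE simp: clique_edge_def le_n_iff)
    then show "g \<in> C.Q"
    proof cases
      case 1
      then show ?thesis using C.outside_in_Q not_in_binvars_pred by blast
    next
      case 2
      then show ?thesis unfolding minor_def 2
        by (intro idl.span_diff idl.span_scale[OF apex_in_span(4)] span_mult_right[OF apex_in_span(3)])
    qed (auto intro: C.minor_in_Q)
  qed
  then have "(A.Q :: 'k bpoly set) \<subseteq> C.Q" by (intro idl.span_minimal) auto
  moreover have "(B.Qgens :: 'k bpoly set) \<subseteq> C.Q"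
    by (auto elim!: edge_ideal_gensE simp: clique_edge_def intro: C.minor_in_Q C.outside_in_Q)
  then have "(B.Q :: 'k bpoly set) \<subseteq> C.Q" by (intro idl.span_minimal) auto
  ultimately show "idl.span (A.Q \<union> B.Q) \<subseteq> (C.Q :: 'k bpoly set)"
    by (intro idl.span_minimal) auto
qed

definition drop_apex :: "'k::field bpoly \<Rightarrow> 'k bpoly" where
  "drop_apex = subst const (\<lambda>v. if v = VX n \<or> v = VY n then 0 else bvar v)"

lemma drop_apex_simps [simp]: "drop_apex (p + q) = drop_apex p + drop_apex q"
  "drop_apex (p - q) = drop_apex p - drop_apex q" "drop_apex (p * q) = drop_apex p * drop_apex q"
  "drop_apex 0 = 0" "drop_apex (const c) = const c"
  "drop_apex (bvar v) = (if v = VX n \<or> v = VY n then 0 else bvar v)"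
  by (simp_all add: drop_apex_def)

text \<open>Expansion of a 3 x 3 determinant with a repeated row: x_n or y_n times any minor is a
  combination of minors at edges to n.\<close>

lemma apex_mult_minor:
  assumes "0 < i" "i < j" "j \<le> n"
  shows "bvar (VX n) * minor i j \<in> (J :: 'k::field bpoly set)"
    and "bvar (VY n) * minor i j \<in> (J :: 'k bpoly set)"
proof -
  have m: "minor l n \<in> (J :: 'k bpoly set)" if "0 < l" "l \<le> n" for l
  proof (cases "l = n")
    case True
    then show ?thesis by (simp add: minor_def idl.span_zero)
  next
    case False
    then show ?thesis using that by (intro minor_in_J) (auto simp: cone_edge_def)
  qed
  have "bvar (VX n) * minor i j = bvar (VX j) * minor i n - bvar (VX i) * (minor j n :: 'k bpoly)"
    and "bvar (VY n) * minor i j = bvar (VY j) * minor i n - bvar (VY i) * (minor j n :: 'k bpoly)"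
    by (simp_all add: minor_def algebra_simps)
  moreover have "bvar v * minor i n - bvar w * minor j n \<in> (J :: 'k bpoly set)" for v w
    using assms by (intro idl.span_diff idl.span_scale m) auto
  ultimately show "bvar (VX n) * minor i j \<in> (J :: 'k bpoly set)" "bvar (VY n) * minor i j \<in> (J :: 'k bpoly set)"
    by simp_all
qed

lemma apex_mult_A:
  assumes "p \<in> A.Q"
  shows "bvar (VX n) * p \<in> J" "bvar (VY n) * p \<in> J"
proof -
  have "bvar (VX n) * p \<in> J \<and> bvar (VY n) * p \<in> J"
    using assms
  proof (induction rule: idl.span_induct_alt)
    case base
    then show ?case by (simp add: idl.span_zero)
  next
    case (step c x y)
    have "bvar (VX n) * x \<in> J \<and> bvar (VY n) * x \<in> J"
      using step(1) by (auto elim!: edge_ideal_gensE simp: clique_edge_def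
          intro: apex_mult_minor idl.span_scale outside_in_J)
    then show ?case using step(2)
      by (auto simp: distrib_left mult.left_commute[of _ c] intro!: idl.span_add idl.span_scale)
  qed
  then show "bvar (VX n) * p \<in> J" "bvar (VY n) * p \<in> J" by auto
qed

lemma drop_apex_B:
  assumes "(p :: 'k::field bpoly) \<in> B.Q"
  shows "drop_apex p \<in> J"
  unfolding drop_apex_def
proof (rule ch.subst_ideal[OF assms])
  fix g :: "'k bpoly" assume "g \<in> B.Qgens"
  then consider v where "g = bvar v" "v \<notin> binvars n" | "g = bvar (VX n) \<or> g = bvar (VY n)"
    | i j where "g = minor i j" "k < i" "i < j" "j \<le> m"
  proof (cases rule: edge_ideal_gensE)
    case (outside v)
    have "v \<notin> binvars n \<or> v = VX n \<or> v = VY n"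
      using outside(2) le_n_iff by (cases v) (auto simp: binvars_def image_iff)
    then show ?thesis using outside(1) that by blast
  next
    case (minor i j)
    then show ?thesis using that by (auto simp: clique_edge_def)
  qed
  then have "drop_apex g \<in> J"
  proof cases
    case 1
    then show ?thesis using k m_less_n by (auto simp: binvars_def idl.span_zero intro: outside_in_J)
  next
    case 3
    then have "drop_apex g = minor i j" using k m_less_n by (auto simp: minor_def)
    then show ?thesis using 3 k m_less_n by (auto intro!: minor_in_J simp: cone_edge_def)
  qed (auto simp: idl.span_zero)
  then show "subst const (\<lambda>v. if v = VX n \<or> v = VY n then 0 else bvar v) g \<in> J"
    by (simp add: drop_apex_def)
qed

text \<open>The point is the degree bound on the cofactors of x_n and y_n, which the growth estimate
  for \<open>J\<close> needs.\<close>

lemma drop_apex_diff: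
  assumes "p \<in> degle s"
  shows "p \<in> degle s \<and> drop_apex p \<in> degle s \<and>
    (\<exists>a\<in>degle s. \<exists>b\<in>degle s. p - drop_apex p = bvar (VX n) * a + bvar (VY n) * b)"
  using assms
proof (induction rule: degle_induct)
  case (const c)
  then show ?case by (auto intro!: bexI[of _ 0])
next
  case (add s p q)
  then obtain a b a' b' where ab: "a \<in> degle s" "b \<in> degle s" "a' \<in> degle s" "b' \<in> degle s"
    "p - drop_apex p = bvar (VX n) * a + bvar (VY n) * b"
    "q - drop_apex q = bvar (VX n) * a' + bvar (VY n) * b'" by blast
  have "p + q - drop_apex (p + q) = (p - drop_apex p) + (q - drop_apex q)" by simp
  also have "\<dots> = bvar (VX n) * (a + a') + bvar (VY n) * (b + b')"
    unfolding ab by (simp add: algebra_simps)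
  finally have "p + q - drop_apex (p + q) = bvar (VX n) * (a + a') + bvar (VY n) * (b + b')" .
  moreover have "a + a' \<in> degle s" "b + b' \<in> degle s" using ab by (auto simp: degle_add)
  ultimately have "\<exists>a\<in>degle s. \<exists>b\<in>degle s. p + q - drop_apex (p + q) = bvar (VX n) * a + bvar (VY n) * b"
    by blast
  then show ?case using add by (auto simp: degle_add)
next
  case (mono s t p)
  then show ?case by (blast intro: degle_mono)
next
  case (var s v p)
  have vd: "bvar v * q \<in> degle (Suc s)" if "q \<in> degle s" for q
    using degle_mult[OF degle_bvar[of 1 v] that] by simp
  have pd: "p \<in> degle (Suc s)" using var degle_mono[of p s "Suc s"] by auto
  show ?case
  proof (cases "v = VX n \<or> v = VY n")
    case True
    then show ?thesis using vd var pd
      by (auto intro: bexI[of _ p] bexI[of _ 0])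
  next
    case False
    obtain a b where ab: "a \<in> degle s" "b \<in> degle s" "p - drop_apex p = bvar (VX n) * a + bvar (VY n) * b"
      using var by blast
    have "bvar v * p - drop_apex (bvar v * p) = bvar v * (p - drop_apex p)"
      using False by (simp add: right_diff_distrib)
    also have "\<dots> = bvar (VX n) * (bvar v * a) + bvar (VY n) * (bvar v * b)"
      unfolding ab(3) by (simp add: algebra_simps)
    finally show ?thesis using ab(1,2) vd var False by auto
  qed
qed

text \<open>If \<open>drop_apex\<close> fixes a generator x, then (c - \<open>drop_apex c\<close>) x
  lies in (x_n, y_n) A, which \<open>J\<close> contains. Otherwise x is a minor at an edge to n,
  which lies in \<open>J\<close> and becomes zero.\<close>

lemma drop_apex_A:
  assumes "(p :: 'k::field bpoly) \<in> A.Q"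
  shows "p - drop_apex p \<in> J"
  using assms
proof (induction rule: idl.span_induct_alt)
  case base
  then show ?case by (simp add: idl.span_zero)
next
  case (step c x y)
  have "c * x - drop_apex (c * x) \<in> J"
  proof (cases "drop_apex x = x")
    case True
    obtain s where "c \<in> degle s" using ex_degle by blast
    then obtain a b where ab: "c - drop_apex c = bvar (VX n) * a + bvar (VY n) * b"
      using drop_apex_diff by blast
    have x: "x \<in> A.Q" using step(1) by (rule idl.span_base)
    have "c * x - drop_apex (c * x) = (c - drop_apex c) * x"
      by (simp add: True left_diff_distrib)
    also have "\<dots> = a * (bvar (VX n) * x) + b * (bvar (VY n) * x)"
      unfolding ab by (simp add: algebra_simps)
    also have "\<dots> \<in> J" by (intro idl.span_add idl.span_scale apex_mult_A x)
    finally show ?thesis .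
  next
    case False
    have "\<exists>i. x = minor i n \<and> 0 < i \<and> i < n"
    proof -
      consider v where "x = bvar v" "v \<notin> binvars n" | i j where "x = minor i j" "0 < i" "i < j" "j \<le> n"
        using step(1) by (auto elim!: edge_ideal_gensE simp: clique_edge_def)
      then show ?thesis
      proof cases
        case 1
        then show ?thesis using False n by (auto simp: binvars_def image_iff split: if_splits)
      next
        case 2
        then show ?thesis using False by (cases "j = n") (auto simp: minor_def)
      qed
    qed
    then obtain i where i: "x = minor i n" "0 < i" "i < n" by blast
    have "drop_apex x = 0" using i by (simp add: minor_def)
    then have "c * x - drop_apex (c * x) = c * x" by simp
    also have "\<dots> \<in> J" unfolding i(1) using i by (intro idl.span_scale minor_in_J) (auto simp: cone_edge_def)
    finally show ?thesis .
  qed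
  then have "(c * x - drop_apex (c * x)) + (y - drop_apex y) \<in> J"
    using step(2) by (rule idl.span_add)
  then show ?case by (simp add: algebra_simps)
qed

lemma A_Int_B: "A.Q \<inter> B.Q = (J :: 'k::field bpoly set)"
proof
  show "A.Q \<inter> B.Q \<subseteq> (J :: 'k bpoly set)"
  proof
    fix p :: "'k bpoly" assume p: "p \<in> A.Q \<inter> B.Q"
    then have "(p - drop_apex p) + drop_apex p \<in> J"
      by (intro idl.span_add drop_apex_A drop_apex_B) auto
    then show "p \<in> J" by simp
  qed
qed (use J_subset_A J_subset_B in auto)

section \<open>The regular sequence\<close>

text \<open>The last term must be regular on both components. On A the form y_n is the one remaining
  parameter, and adding y_1 does no harm because y_1^2 lies in the ideal of the earlier terms. On B
  the form y_n is zero, while y_1 is a parameter because vertex 1 is isolated there.\<close>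

definition reg_seq :: "nat \<Rightarrow> 'k::field bpoly" where
  "reg_seq i = (if i < n then param i else bvar (VY n) + bvar (VY 1))"

lemma reg_seq_image: "i \<le> n \<Longrightarrow> reg_seq ` {..<i} = param_map ` bvar ` VX ` {..<i}"
  using k m_less_n by (auto simp: reg_seq_def image_image image_iff)

lemma regular_A: "regular_on (A.Qgens :: 'k::field bpoly set) reg_seq (Suc n)"
  unfolding regular_on_def
proof (intro allI impI)
  fix i and v :: "'k bpoly" assume i: "i < Suc n"
  let ?R = "\<lambda>i. idl.span (A.Qgens \<union> reg_seq ` {..<i}) :: 'k bpoly set"
  assume v: "reg_seq i * v \<in> ?R i"
  have reg: "u \<in> ?R i" if "param i * u \<in> ?R i" for u
    using A.param_regular[of "VX i" "VX ` {..<i}" u] that i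
    by (simp add: A.param_vars_def reg_seq_image image_subset_iff image_iff)
  show "v \<in> ?R i"
  proof (cases "i < n")
    case True
    then show ?thesis using v reg by (simp add: reg_seq_def)
  next
    case False
    then have i: "i = n" using i by simp
    have AR: "q \<in> A.Q \<Longrightarrow> q \<in> ?R n" for q using idl.span_mono[of A.Qgens "A.Qgens \<union> reg_seq ` {..<n}"] by blast
    have par: "param l \<in> ?R n" if "l < n" for l
      using that by (intro idl.span_base) (auto simp: reg_seq_def image_iff)
    let ?y = "bvar (VY n) :: 'k bpoly" and ?y1 = "bvar (VY 1) :: 'k bpoly"
    have y0: "bvar (VY 0) \<in> ?R n" and xn: "bvar (VX (Suc n)) \<in> ?R n"
      by (auto intro!: AR A.outside_in_Q simp: binvars_def)
    have mi: "minor 1 2 \<in> ?R n" using k m_less_n by (intro AR A.minor_in_Q) auto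
    \<comment> \<open>The minor of the edge {1, 2} with x_1 = y_0 - \<open>param 0\<close> and x_2 =
      y_1 - \<open>param 1\<close>; modulo the earlier terms it says y_1^2 = 0.\<close>
    have "?y1 * ?y1 = bvar (VY 2) * bvar (VY 0) - bvar (VY 2) * param 0 + ?y1 * param 1 - minor 1 2"
      by (simp add: minor_def param_def algebra_simps numeral_2_eq_2)
    also have "\<dots> \<in> ?R n" using k m_less_n
      by (intro idl.span_add idl.span_diff idl.span_scale par y0 mi) auto
    finally have y11: "?y1 * ?y1 \<in> ?R n" .
    have y: "u \<in> ?R n" if "?y * u \<in> ?R n" for u
    proof -
      have "param n * u = ?y * u - u * bvar (VX (Suc n))" by (simp add: param_def algebra_simps)
      also have "\<dots> \<in> ?R n" by (intro idl.span_diff idl.span_scale that xn)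
      finally show ?thesis using reg by (simp add: i)
    qed
    have "(?y + ?y1) * v \<in> ?R n" using v by (simp add: reg_seq_def i)
    \<comment> \<open>(y_n - y_1)(y_n + y_1) + y_1^2 = y_n^2, and y_n can be cancelled
      twice.\<close>
    then have "(?y - ?y1) * ((?y + ?y1) * v) + v * (?y1 * ?y1) \<in> ?R n"
      by (rule idl.span_add[OF idl.span_scale idl.span_scale[OF y11]])
    then have "?y * (?y * v) \<in> ?R n" by (simp add: algebra_simps)
    then show ?thesis using y i by blast
  qed
qed

lemma regular_B: "regular_on (B.Qgens :: 'k::field bpoly set) reg_seq (Suc n)"
  unfolding regular_on_def
proof (intro allI impI)
  fix i and v :: "'k bpoly" assume i: "i < Suc n"
  let ?R = "\<lambda>i. idl.span (B.Qgens \<union> reg_seq ` {..<i}) :: 'k bpoly set"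
  assume v: "reg_seq i * v \<in> ?R i"
  show "v \<in> ?R i"
  proof (cases "i < n")
    case True
    then have "param i * v \<in> ?R i" using v by (simp add: reg_seq_def)
    then show ?thesis using B.param_regular[of "VX i" "VX ` {..<i}" v] True n
      by (simp add: B.param_vars_def reg_seq_image image_subset_iff image_iff)
  next
    case False
    then have i: "i = n" using i by simp
    have "bvar (VY n) \<in> ?R n"
      using apex_in_span(2) idl.span_mono[of B.Qgens "B.Qgens \<union> reg_seq ` {..<n}"] by blast
    from idl.span_diff[OF v[unfolded i] idl.span_scale[OF this]]
    have "reg_seq n * v - v * bvar (VY n) \<in> ?R n" .
    moreover have "reg_seq n * v - v * bvar (VY n) = param_map (bvar (VY 1)) * v"
      by (simp add: reg_seq_def algebra_simps)
    ultimately have "param_map (bvar (VY 1)) * v \<in> ?R n" by metis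
    then show ?thesis using B.param_regular[of "VY 1" "VX ` {..<n}" v] k i n
      by (simp add: B.param_vars_def reg_seq_image image_subset_iff image_iff less_Suc_eq_le)
  qed
qed

lemma regular_C: "regular_on (C.Qgens :: 'k::field bpoly set) reg_seq n"
  unfolding regular_on_def
proof (intro allI impI)
  fix i and v :: "'k bpoly" assume i: "i < n"
    and v: "reg_seq i * v \<in> idl.span (C.Qgens \<union> reg_seq ` {..<i})"
  then have "param i * v \<in> idl.span (C.Qgens \<union> reg_seq ` {..<i})" by (simp add: reg_seq_def)
  then show "v \<in> idl.span (C.Qgens \<union> reg_seq ` {..<i})"
    using C.param_regular[of "VX i" "VX ` {..<i}" v] i n
    by (simp add: C.param_vars_def reg_seq_image image_subset_iff image_iff)
qed

lemma regular_J: "regular_on (Jgens :: 'k::field bpoly set) reg_seq (Suc n)"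
proof -
  have "regular_on (A.Q \<inter> B.Q :: 'k bpoly set) reg_seq (Suc n)"
  proof (rule regular_on_Inter)
    show "regular_on (A.Q :: 'k bpoly set) reg_seq (Suc n)" "regular_on (B.Q :: 'k bpoly set) reg_seq (Suc n)"
      using regular_A regular_B regular_on_cong[OF idl.span_span] by blast+
    have "idl.span (C.Qgens :: 'k bpoly set) = idl.span (A.Q \<union> B.Q)" by (rule C_eq)
    then show "regular_on (A.Q \<union> B.Q :: 'k bpoly set) reg_seq n"
      using regular_C regular_on_cong by blast
  qed auto
  then show ?thesis unfolding A_Int_B using regular_on_cong[OF idl.span_span] by blast
qed

section \<open>The annihilator of x_n and growth modulo the ideal\<close>

text \<open>Setting every variable except x_n to zero kills \<open>J\<close>, since each term of a
  minor has a factor y. The image of s then vanishes because K[x_n] is a domain.\<close>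

lemma apex_annihilator:
  assumes "s * bvar (VX n) \<in> (J :: 'k::field bpoly set)"
  shows "const_part s = 0"
proof -
  define \<phi> :: "binvar \<Rightarrow> 'k bpoly" where "\<phi> v = (if v = VX n then bvar v else 0)" for v
  have "subst const \<phi> (s * bvar (VX n)) \<in> idl.span {}"
  proof (rule ch.subst_ideal[OF assms])
    fix g :: "'k bpoly" assume "g \<in> Jgens"
    then consider v where "g = bvar v" "v \<notin> binvars n" | i j where "g = minor i j" "i < j" "j \<le> n"
      by (auto elim!: edge_ideal_gensE simp: cone_edge_def)
    then show "subst const \<phi> g \<in> idl.span {}"
      using k m_less_n by cases (auto simp: \<phi>_def minor_def binvars_def)
  qed
  then have "subst const \<phi> s = 0" by (simp add: \<phi>_def)
  then have "subst const (\<lambda>_. 0) (subst const \<phi> s) = (0 :: 'k bpoly)" by simp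
  moreover have "(\<lambda>v. subst const (\<lambda>_. 0) (\<phi> v)) = (\<lambda>_. 0 :: 'k bpoly)" by (auto simp: \<phi>_def)
  ultimately show ?thesis by (simp add: const_part_def subst_subst)
qed

lemma growth_A: "growth_le (A.Q :: 'k::field bpoly set) (n + 1)"
  unfolding growth_le_def using A.finite_spanning by (intro exI[of _ n]) auto

text \<open>Writing p = \<open>drop_apex p\<close> + x_n a + y_n b, a spanning set modulo
  \<open>J\<close> is obtained from \<open>drop_apex\<close> of one modulo \<open>B.Q\<close> and
  from x_n and y_n times one modulo \<open>A.Q\<close>. The exponents are m + 1 + k = n + k and n +
  1, and n + 1 is at most n + k as there is a leaf.\<close>

lemma growth_J: "growth_le (J :: 'k::field bpoly set) (n + k)"
  unfolding growth_le_def
\<comment> \<open>The factor 3 counts one spanning set modulo \<open>B.Q\<close> and two copies of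
  one modulo \<open>A.Q\<close>, each of size at most n times the power.\<close>
proof (intro exI[of _ "3 * n"] allI)
  fix s :: nat
  let ?T = "(2 * s + 1) ^ (n + k)"
  obtain B where B: "finite B" "card B \<le> m * (2 * s + 1) ^ (m + 1 + k)"
     "\<And>p. p \<in> degle s \<Longrightarrow> \<exists>b\<in>vs.span B. p - b \<in> (B.Q :: 'k bpoly set)"
    using B.finite_spanning[where 'k='k, of s] by blast
  obtain A where A: "finite A" "card A \<le> n * (2 * s + 1) ^ (n + 1 + 0)"
     "\<And>p. p \<in> degle s \<Longrightarrow> \<exists>b\<in>vs.span A. p - b \<in> (A.Q :: 'k bpoly set)"
    using A.finite_spanning[where 'k='k, of s] by blast
  have "card B \<le> m * ?T" using B(2) n by simp
  also have "\<dots> \<le> n * ?T" using n by (intro mult_right_mono) auto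
  finally have cB: "card B \<le> n * ?T" .
  have "card A \<le> n * (2 * s + 1) ^ (n + 1)" using A(2) by simp
  also have "\<dots> \<le> n * ?T" using k m_less_n by (intro mult_left_mono power_increasing) auto
  finally have cA: "card A \<le> n * ?T" .
  define D where "D = drop_apex ` B \<union> ((*) (bvar (VX n)) ` A \<union> (*) (bvar (VY n)) ` A)"
  have "card D \<le> card (drop_apex ` B) + (card ((*) (bvar (VX n)) ` A) + card ((*) (bvar (VY n)) ` A))"
    unfolding D_def by (intro order_trans[OF card_Un_le] add_left_mono card_Un_le)
  also have "\<dots> \<le> card B + (card A + card A)"
    by (intro add_mono card_image_le A B)
  also have "\<dots> \<le> 3 * n * ?T" using cA cB by linarith
  finally have "card D \<le> 3 * n * ?T" .
  moreover have "\<exists>b\<in>vs.span D. p - b \<in> J" if p: "p \<in> degle s" for p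
  proof -
    obtain a b where ab: "drop_apex p \<in> degle s" "a \<in> degle s" "b \<in> degle s"
      "p - drop_apex p = bvar (VX n) * a + bvar (VY n) * b"
      using drop_apex_diff[OF p] by blast
    obtain e where e: "e \<in> vs.span B" "drop_apex p - e \<in> B.Q" using B(3)[OF ab(1)] by blast
    obtain a' where a': "a' \<in> vs.span A" "a - a' \<in> A.Q" using A(3)[OF ab(2)] by blast
    obtain b' where b': "b' \<in> vs.span A" "b - b' \<in> A.Q" using A(3)[OF ab(3)] by blast
    let ?e = "drop_apex e + (bvar (VX n) * a' + bvar (VY n) * b')"
    have dd: "drop_apex (drop_apex p) = drop_apex p"
      unfolding drop_apex_def subst_subst
      by (rule arg_cong[where f = "\<lambda>\<phi>. subst const \<phi> p"]) auto
    have "p - ?e = drop_apex (drop_apex p - e) + (bvar (VX n) * (a - a') + bvar (VY n) * (b - b'))"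
      using ab(4) by (simp add: dd algebra_simps)
    also have "\<dots> \<in> J" by (intro idl.span_add drop_apex_B apex_mult_A e a' b')
    finally have "p - ?e \<in> J" .
    moreover have "?e \<in> vs.span D"
    proof (intro vs.span_add)
      have "drop_apex e \<in> vs.span (drop_apex ` B)" by (rule vs_span_image[OF _ _ e(1)]) auto
      then show "drop_apex e \<in> vs.span D" using vs.span_mono[of "drop_apex ` B" D] by (auto simp: D_def)
      have "bvar (VX n) * a' \<in> vs.span ((*) (bvar (VX n)) ` A)"
        by (rule vs_span_image[OF _ _ a'(1)]) (auto simp: algebra_simps)
      then show "bvar (VX n) * a' \<in> vs.span D"
        using vs.span_mono[of "(*) (bvar (VX n)) ` A" D] by (auto simp: D_def)
      have "bvar (VY n) * b' \<in> vs.span ((*) (bvar (VY n)) ` A)"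
        by (rule vs_span_image[OF _ _ b'(1)]) (auto simp: algebra_simps)
      then show "bvar (VY n) * b' \<in> vs.span D"
        using vs.span_mono[of "(*) (bvar (VY n)) ` A" D] by (auto simp: D_def)
    qed
    ultimately show ?thesis by blast
  qed
  moreover have "finite D" using A(1) B(1) by (simp add: D_def)
  ultimately show "\<exists>B. finite B \<and> card B \<le> 3 * n * ?T \<and>
      (\<forall>p\<in>degle s. \<exists>b\<in>vs.span B. p - b \<in> (J :: 'k bpoly set))"
    by blast
qed

text \<open>The parametrization \<open>x_j = s_j a\<close>, \<open>y_j = s_j\<close> on the clique, with \<open>s_j\<close> encoded as \<open>VY j\<close> and
  \<open>a\<close> as \<open>VX 0\<close>, and the parameters in \<open>Z\<close> set to zero.\<close>

definition kill :: "binvar set \<Rightarrow> binvar \<Rightarrow> 'k::field bpoly" where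
  "kill Z v = (if v \<in> Z then 0 else bvar v)"

definition spec_map :: "binvar set \<Rightarrow> binvar \<Rightarrow> 'k::field bpoly" where
  "spec_map Z v = (case v of
       VX j \<Rightarrow> if 1 \<le> j \<and> j \<le> k then kill Z (VX j) else if k < j \<and> j < n then kill Z (VY j) * kill Z (VX 0) else 0
     | VY j \<Rightarrow> if 1 \<le> j \<and> j < n then kill Z (VY j) else 0)"

definition spec :: "binvar set \<Rightarrow> 'k::field bpoly \<Rightarrow> 'k bpoly" where
  "spec Z = subst const (spec_map Z)"

lemma spec_simps [simp]: "spec Z (p + q) = spec Z p + spec Z q" "spec Z (p - q) = spec Z p - spec Z q"
  "spec Z (p * q) = spec Z p * spec Z q" "spec Z 1 = 1" "spec Z 0 = 0"
  "spec Z (bvar v) = spec_map Z v"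
  by (simp_all add: spec_def)

lemma spec_J:
  assumes "p \<in> (J :: 'k::field bpoly set)"
  shows "spec Z p = 0"
proof -
  have "spec Z p \<in> idl.span {}"
    unfolding spec_def
  proof (rule ch.subst_ideal[OF assms])
    fix g :: "'k bpoly" assume "g \<in> Jgens"
    then consider v where "g = bvar v" "v \<notin> binvars n" | i where "g = minor i n"
      | i j where "g = minor i j" "k < i" "i < j" "j < n"
      by (auto elim!: edge_ideal_gensE simp: cone_edge_def order_le_less)
    then have "spec Z g = 0"
    proof cases
      case (1 v)
      then show ?thesis using k m_less_n by (cases v) (auto simp: spec_map_def binvars_def image_iff)
    next
      case 2
      then show ?thesis using k m_less_n by (simp add: spec_map_def minor_def)
    next
      case 3
      then show ?thesis using k m_less_n by (simp add: spec_map_def minor_def)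
    qed
    then show "subst const (spec_map Z) g \<in> idl.span {}" by (simp add: spec_def)
  qed
  then show ?thesis by simp
qed

lemma spec_mono:
  fixes p :: "'k::field bpoly"
  assumes "Z \<subseteq> Z'" "spec Z p = 0"
  shows "spec Z' p = 0"
proof -
  let ?\<tau> = "subst const (kill Z') :: 'k bpoly \<Rightarrow> 'k bpoly"
  have kill: "?\<tau> (kill Z v) = kill Z' v" for v using assms(1) by (auto simp: kill_def)
  have "spec Z' p = ?\<tau> (spec Z p)"
    unfolding spec_def subst_subst
    by (rule arg_cong[where f = "\<lambda>\<phi>. subst const \<phi> p"])
      (auto simp: spec_map_def fun_eq_iff kill split: binvar.splits)
  then show ?thesis using assms(2) by simp
qed

text \<open>The parameter a = \<open>VX 0\<close> occurs only in products s_j a, so it has to go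
  while some s_j is still alive; otherwise its vanishing would change nothing. Hence
  \<open>VY (Suc k)\<close> comes last.\<close>

definition spec_order :: "binvar list" where
  "spec_order = map VX [1..<Suc k] @ map VY [1..<Suc k] @ map VY [k + 2..<n] @ [VX 0, VY (Suc k)]"

lemma length_spec_order: "length spec_order = n + k"
  using k m_less_n by (simp add: spec_order_def)

lemma distinct_spec_order: "distinct spec_order"
  by (auto simp: spec_order_def distinct_map inj_on_def)

lemma spec_strict:
  assumes i: "i < n + k"
  shows "\<exists>w\<in>binvars n. spec (set (take i spec_order)) (bvar w) \<noteq> (0 :: 'k::field bpoly) \<and>
    spec (set (take (Suc i) spec_order)) (bvar w) = (0 :: 'k bpoly)"
proof -
  let ?v = "spec_order ! i"
  have il: "i < length spec_order" using i by (simp add: length_spec_order)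
  have new: "?v \<notin> set (take i spec_order)"
    using distinct_spec_order il by (metis distinct_take id_take_nth_drop not_distinct_conv_prefix
        distinct_append append_Cons list.set_intros(1) disjoint_iff take_Suc_conv_app_nth)
  have old: "?v \<in> set (take (Suc i) spec_order)" using il by (simp add: take_Suc_conv_app_nth)
  have vset: "?v \<in> set spec_order" using il by simp
  show ?thesis
  proof (cases "?v = VX 0")
    \<comment> \<open>The witness is x_{k+1} = s_{k+1} a, where s_{k+1} has not been set to zero
      yet.\<close>
    case True
    let ?pre = "map VX [1..<Suc k] @ map VY [1..<Suc k] @ map VY [k + 2..<n]"
    have so: "spec_order = ?pre @ [VX 0, VY (Suc k)]" by (simp add: spec_order_def)
    have len: "length ?pre = n + k - 2" using k m_less_n by simp
    have "spec_order ! (n + k - 2) = VX 0" unfolding so len[symmetric] by (rule nth_append_length)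
    then have "i = n + k - 2"
      using True nth_eq_iff_index_eq[OF distinct_spec_order il, of "n + k - 2"] length_spec_order k n
      by simp
    then have "take i spec_order = ?pre" unfolding so using len by simp
    then have "VY (Suc k) \<notin> set (take i spec_order)" by auto
    then show ?thesis using new old True k m_less_n
      by (intro bexI[of _ "VX (Suc k)"]) (auto simp: spec_map_def kill_def binvars_def image_iff)
  next
    case False
    then consider j where "?v = VX j" "1 \<le> j" "j \<le> k" | j where "?v = VY j" "1 \<le> j" "j < n"
      using vset k m_less_n unfolding spec_order_def set_append set_map by fastforce
    then show ?thesis
      using new old k m_less_n by cases (auto simp: spec_map_def kill_def binvars_def image_iff intro!: bexI[of _ ?v])
  qed
qed

end

section \<open>Quotients of the polynomial ring in finitely many variables\<close>

lemma bpoly_ring_simps [simp]: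
  "carrier (bpoly_ring n :: 'k::field bpoly ring) = polys (binvars n)"
  "p \<otimes>\<^bsub>bpoly_ring n\<^esub> q = p * q" "p \<oplus>\<^bsub>bpoly_ring n\<^esub> q = p + (q :: 'k bpoly)"
  "\<one>\<^bsub>bpoly_ring n\<^esub> = (1 :: 'k bpoly)" "\<zero>\<^bsub>bpoly_ring n\<^esub> = (0 :: 'k bpoly)"
  by (simp_all add: bpoly_ring_def ring_of_type_algebra_def polys_def)

lemma bpoly_ring_a_inv [simp]:
  fixes p :: "'k::field bpoly"
  assumes "p \<in> polys (binvars n)"
  shows "\<ominus>\<^bsub>bpoly_ring n\<^esub> p = - p"
proof -
  interpret S: cring "bpoly_ring n :: 'k bpoly ring" by (rule cring_bpoly_ring)
  show ?thesis by (rule S.minus_equality) (use assms polys_uminus in auto)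
qed

lemma ideal_Int_polys:
  fixes I :: "'k::field bpoly set"
  assumes "idl.subspace I"
  shows "ideal (I \<inter> polys (binvars n)) (bpoly_ring n)"
proof (rule idealI)
  interpret S: cring "bpoly_ring n :: 'k bpoly ring" by (rule cring_bpoly_ring)
  show "Ring.ring (bpoly_ring n :: 'k bpoly ring)" by (rule S.ring_axioms)
  show "subgroup (I \<inter> polys (binvars n)) (add_monoid (bpoly_ring n))"
  proof (rule subgroup.intro)
    fix p assume "p \<in> I \<inter> polys (binvars n)"
    then show "inv\<^bsub>add_monoid (bpoly_ring n)\<^esub> p \<in> I \<inter> polys (binvars n)"
      using idl.subspace_neg[OF assms] unfolding a_inv_def[symmetric] by (simp add: polys_uminus)
  qed (use assms in \<open>auto intro: idl.subspace_0 idl.subspace_add polys_add\<close>)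
  fix a x :: "'k bpoly" assume "a \<in> I \<inter> polys (binvars n)" "x \<in> carrier (bpoly_ring n)"
  then show "x \<otimes>\<^bsub>bpoly_ring n\<^esub> a \<in> I \<inter> polys (binvars n)" "a \<otimes>\<^bsub>bpoly_ring n\<^esub> x \<in> I \<inter> polys (binvars n)"
    using idl.subspace_scale[OF assms, of a x] by (auto simp: mult.commute intro: polys_mult)
qed

text \<open>\<open>retract\<close> is a ring homomorphism onto the subring and fixes it, so it
  carries a representation in the large ring to one inside \<open>bpoly_ring n\<close>.\<close>

lemma Idl_bpoly_ring:
  fixes G :: "'k::field bpoly set"
  assumes G: "G \<subseteq> polys (binvars n)"
  shows "Idl\<^bsub>bpoly_ring n\<^esub> G = idl.span (G \<union> bvar ` (- binvars n)) \<inter> polys (binvars n)"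
proof
  interpret S: cring "bpoly_ring n :: 'k bpoly ring" by (rule cring_bpoly_ring)
  let ?I = "Idl\<^bsub>bpoly_ring n\<^esub> G"
  show "?I \<subseteq> idl.span (G \<union> bvar ` (- binvars n)) \<inter> polys (binvars n)"
    by (rule S.genideal_minimal[OF ideal_Int_polys]) (use G idl.span_superset in blast)+
  have I: "ideal ?I (bpoly_ring n)" by (rule S.genideal_ideal) (use G in simp)
  have GI: "G \<subseteq> ?I" by (rule S.genideal_self) (use G in simp)
  interpret I: ideal ?I "bpoly_ring n" by (rule I)
  have "retract n p \<in> ?I" if "p \<in> idl.span (G \<union> bvar ` (- binvars n))" for p
    using that
  proof (induction rule: idl.span_induct_alt)
    case base
    then show ?case using I.zero_closed by (simp add: retract_def)
  next
    case (step c x y)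
    have "retract n x \<in> ?I"
    proof (cases "x \<in> G")
      case True
      then show ?thesis using GI G retract_id by fastforce
    next
      case False
      then have "retract n x = 0" using step(1) by (auto simp: retract_def)
      then show ?thesis using I.zero_closed by simp
    qed
    then have "retract n c * retract n x \<in> ?I"
      using I.I_l_closed[of "retract n x" "retract n c"] by (simp add: retract_polys)
    then have "retract n c * retract n x + retract n y \<in> ?I"
      using I.a_closed[of "retract n c * retract n x" "retract n y"] step(2) by simp
    then show ?case by (simp add: retract_def)
  qed
  then show "idl.span (G \<union> bvar ` (- binvars n)) \<inter> polys (binvars n) \<subseteq> ?I"
    using retract_id by fastforce
qed

text \<open>This has the shape of \<open>seq_submodule\<close>, where elements are sums over the
  positions of the list.\<close>

lemma span_set_list:
  fixes v :: "'a::comm_ring_1"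
  shows "v \<in> idl.span (I \<union> set ys) \<longleftrightarrow> (\<exists>u. v - (\<Sum>i<length ys. ys ! i * u i) \<in> idl.span I)"
proof (induction ys arbitrary: v rule: rev_induct)
  case Nil
  then show ?case by simp
next
  case (snoc y ys)
  have nth: "(\<Sum>i<length (ys @ [y]). (ys @ [y]) ! i * u i) = (\<Sum>i<length ys. ys ! i * u i) + y * u (length ys)" for u
  proof -
    have "(\<Sum>i<length ys. (ys @ [y]) ! i * u i) = (\<Sum>i<length ys. ys ! i * u i)"
      by (rule sum.cong) (auto simp: nth_append)
    then show ?thesis by simp
  qed
  have "v \<in> idl.span (I \<union> set (ys @ [y])) \<longleftrightarrow> (\<exists>k. v - k * y \<in> idl.span (I \<union> set ys))"
    by (simp add: idl.span_insert)
  also have "\<dots> \<longleftrightarrow> (\<exists>k u. v - k * y - (\<Sum>i<length ys. ys ! i * u i) \<in> idl.span I)"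
    by (simp add: snoc)
  also have "\<dots> \<longleftrightarrow> (\<exists>u. v - (\<Sum>i<length (ys @ [y]). (ys @ [y]) ! i * u i) \<in> idl.span I)"
  proof
    assume "\<exists>k u. v - k * y - (\<Sum>i<length ys. ys ! i * u i) \<in> idl.span I"
    then obtain k u where ku: "v - k * y - (\<Sum>i<length ys. ys ! i * u i) \<in> idl.span I" by blast
    let ?u = "u(length ys := k)"
    have "(\<Sum>i<length ys. ys ! i * ?u i) = (\<Sum>i<length ys. ys ! i * u i)" by (rule sum.cong) auto
    then show "\<exists>u. v - (\<Sum>i<length (ys @ [y]). (ys @ [y]) ! i * u i) \<in> idl.span I"
      using ku unfolding nth by (intro exI[of _ ?u]) (simp add: algebra_simps)
  next
    assume "\<exists>u. v - (\<Sum>i<length (ys @ [y]). (ys @ [y]) ! i * u i) \<in> idl.span I"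
    then obtain u where "v - (\<Sum>i<length (ys @ [y]). (ys @ [y]) ! i * u i) \<in> idl.span I" by blast
    then show "\<exists>k u. v - k * y - (\<Sum>i<length ys. ys ! i * u i) \<in> idl.span I"
      unfolding nth by (intro exI[of _ "u (length ys)"] exI[of _ u]) (simp add: algebra_simps)
  qed
  finally show ?case .
qed

lemma span_cong_mod:
  assumes "\<And>i. i \<in> A \<Longrightarrow> f i - g i \<in> idl.span I"
  shows "idl.span (I \<union> f ` A) = idl.span (I \<union> g ` A)"
proof -
  have *: "idl.span (I \<union> f ` A) \<subseteq> idl.span (I \<union> g ` A)"
    if fg: "\<And>i. i \<in> A \<Longrightarrow> f i - g i \<in> idl.span I" for f g
  proof (rule idl.span_minimal)
    have "f i \<in> idl.span (I \<union> g ` A)" if "i \<in> A" for i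
    proof -
      have "f i - g i \<in> idl.span (I \<union> g ` A)" by (rule subsetD[OF idl.span_mono fg[OF that]]) blast
      moreover have "g i \<in> idl.span (I \<union> g ` A)" using that by (intro idl.span_base) auto
      ultimately have "(f i - g i) + g i \<in> idl.span (I \<union> g ` A)" by (rule idl.span_add)
      then show ?thesis by simp
    qed
    then show "I \<union> f ` A \<subseteq> idl.span (I \<union> g ` A)" by (auto intro: idl.span_base)
  qed simp
  have "g i - f i \<in> idl.span I" if "i \<in> A" for i
    using idl.span_neg[OF assms[OF that]] by simp
  then show ?thesis using *[of f g] *[of g f] assms by blast
qed

section \<open>Regular sequences in the quotient\<close>

text \<open>A dictionary between the quotient of \<open>bpoly_ring n\<close> and ideals of the large
  ring; the two quotients agree because \<open>Jg\<close> contains the outside variables.\<close>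

locale bpoly_quotient =
  fixes n :: nat and Jg :: "'k::field bpoly set"
  assumes outside: "bvar ` (- binvars n) \<subseteq> Jg"
begin

abbreviation S :: "'k bpoly ring" where "S \<equiv> bpoly_ring n"
abbreviation JS :: "'k bpoly set" where "JS \<equiv> idl.span Jg \<inter> polys (binvars n)"
abbreviation coset :: "'k bpoly \<Rightarrow> 'k bpoly set" where "coset p \<equiv> JS +>\<^bsub>S\<^esub> p"
abbreviation M where "M \<equiv> quot_module S JS"

lemma ideal_JS: "ideal JS S"
  by (rule ideal_Int_polys) simp

sublocale S: cring S by (rule cring_bpoly_ring)
sublocale JS: ideal JS S by (rule ideal_JS)
sublocale Q: cring "S Quot JS" by (rule JS.quotient_is_cring[OF S.is_cring])
sublocale h: ring_hom_ring S "S Quot JS" "\<lambda>p. coset p" by (rule JS.rcos_ring_hom_ring)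
sublocale M: Module.module S M by (rule quot_module_is_module[OF S.is_cring ideal_JS])

lemma retract_span: "p - retract n p \<in> idl.span Jg"
  using retract_diff idl.span_mono[OF outside] by blast

lemma retract_in_span_iff: "Jg \<subseteq> I \<Longrightarrow> retract n p \<in> idl.span I \<longleftrightarrow> p \<in> idl.span I"
proof -
  assume "Jg \<subseteq> I"
  then have d: "p - retract n p \<in> idl.span I" using retract_span idl.span_mono by blast
  show ?thesis
    using idl.span_add[OF d, of "retract n p"] idl.span_diff[OF _ d, of p] by auto
qed

lemma retract_simps [simp]: "retract n (p + q) = retract n p + retract n q"
  "retract n (p - q) = retract n p - retract n q" "retract n (p * q) = retract n p * retract n q"
  "retract n 1 = 1" "retract n 0 = 0"
  by (simp_all add: retract_def)

lemma coset_eq_iff: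
  assumes "p \<in> polys (binvars n)" "q \<in> polys (binvars n)"
  shows "coset p = coset q \<longleftrightarrow> p - q \<in> idl.span Jg"
proof -
  have "p \<ominus>\<^bsub>S\<^esub> q = p - q" using assms by (simp add: a_minus_def)
  then show ?thesis
    using S.quotient_eq_iff_same_a_r_cos[OF ideal_JS, of p q] assms by (simp add: polys_diff)
qed

lemma carrier_Q: "carrier (S Quot JS) = coset ` polys (binvars n)"
  by (auto simp: FactRing_def A_RCOSETS_def' )

lemma coset_in_Q [simp]: "p \<in> polys (binvars n) \<Longrightarrow> coset p \<in> carrier (S Quot JS)"
  by (simp add: carrier_Q)

lemma coset_hom:
  assumes "p \<in> polys (binvars n)" "q \<in> polys (binvars n)"
  shows "coset p \<otimes>\<^bsub>S Quot JS\<^esub> coset q = coset (p * q)" "coset p \<oplus>\<^bsub>S Quot JS\<^esub> coset q = coset (p + q)"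
  using h.hom_mult[of p q] h.hom_add[of p q] assms by simp_all

lemma coset_zero_one: "\<zero>\<^bsub>S Quot JS\<^esub> = coset 0" "\<one>\<^bsub>S Quot JS\<^esub> = coset 1"
  using h.hom_zero h.hom_one by simp_all

lemma M_simps: "carrier M = coset ` polys (binvars n)"
  "A \<oplus>\<^bsub>M\<^esub> B = A \<oplus>\<^bsub>S Quot JS\<^esub> B" "\<zero>\<^bsub>M\<^esub> = coset 0"
  "r \<odot>\<^bsub>M\<^esub> A = coset r \<otimes>\<^bsub>S Quot JS\<^esub> A"
  by (simp_all add: quot_module_def carrier_Q coset_zero_one)

lemma finsum_coset:
  fixes l :: nat
  shows "(\<And>i. i < l \<Longrightarrow> u i \<in> polys (binvars n)) \<Longrightarrow>
    finsum M (\<lambda>i. coset (u i)) {..<l} = coset (\<Sum>i<l. u i)"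
proof (induction l)
  case 0
  then show ?case by (simp add: M_simps)
next
  case (Suc l)
  have s: "(\<Sum>i<l. u i) \<in> polys (binvars n)" using Suc.prems by (intro polys_sum) auto
  have "finsum M (\<lambda>i. coset (u i)) {..<Suc l} = coset (u l) \<oplus>\<^bsub>M\<^esub> finsum M (\<lambda>i. coset (u i)) {..<l}"
    unfolding lessThan_Suc using Suc.prems by (intro M.finsum_insert) (auto simp: M_simps)
  also have "\<dots> = coset (u l + (\<Sum>i<l. u i))"
    using Suc s by (simp add: M_simps coset_hom)
  finally show ?case by (simp add: add.commute)
qed

lemma coset_in_seq_submodule_iff:
  assumes ys: "set ys \<subseteq> polys (binvars n)" and v: "v \<in> polys (binvars n)"
  shows "coset v \<in> seq_submodule M ys \<longleftrightarrow> v \<in> idl.span (Jg \<union> set ys)"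
proof -
  have smult: "(ys ! i) \<odot>\<^bsub>M\<^esub> coset p = coset (ys ! i * p)" and pol: "ys ! i * p \<in> polys (binvars n)"
    if "i < length ys" "p \<in> polys (binvars n)" for i p
  proof -
    have "ys ! i \<in> polys (binvars n)" using that(1) ys by auto
    then show "(ys ! i) \<odot>\<^bsub>M\<^esub> coset p = coset (ys ! i * p)" "ys ! i * p \<in> polys (binvars n)"
      using that(2) by (simp_all add: M_simps coset_hom polys_mult)
  qed
  have fs: "finsum M (\<lambda>i. (ys ! i) \<odot>\<^bsub>M\<^esub> coset (u i)) {..<length ys} = coset (\<Sum>i<length ys. ys ! i * u i)"
    if "\<And>i. i < length ys \<Longrightarrow> u i \<in> polys (binvars n)" for u
  proof -
    have "finsum M (\<lambda>i. (ys ! i) \<odot>\<^bsub>M\<^esub> coset (u i)) {..<length ys} =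
      finsum M (\<lambda>i. coset (ys ! i * u i)) {..<length ys}"
      using that by (intro M.finsum_cong') (auto simp: smult pol M_simps(1))
    then show ?thesis using that by (subst (asm) finsum_coset) (auto simp: pol)
  qed
  show ?thesis
  proof
    assume "coset v \<in> seq_submodule M ys"
    then obtain w where w: "w \<in> {..<length ys} \<rightarrow> carrier M"
      and eq: "coset v = finsum M (\<lambda>i. (ys ! i) \<odot>\<^bsub>M\<^esub> w i) {..<length ys}"
      by (auto simp: seq_submodule_def)
    have "\<forall>i. \<exists>p. i < length ys \<longrightarrow> p \<in> polys (binvars n) \<and> w i = coset p"
      using w unfolding M_simps by fastforce
    then obtain u where u: "\<And>i. i < length ys \<Longrightarrow> u i \<in> polys (binvars n) \<and> w i = coset (u i)" by metis
    have "finsum M (\<lambda>i. (ys ! i) \<odot>\<^bsub>M\<^esub> w i) {..<length ys} = finsum M (\<lambda>i. (ys ! i) \<odot>\<^bsub>M\<^esub> coset (u i)) {..<length ys}"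
      using u by (intro M.finsum_cong') (auto simp: smult pol M_simps(1))
    then have "coset v = coset (\<Sum>i<length ys. ys ! i * u i)" using eq fs u by simp
    moreover have "(\<Sum>i<length ys. ys ! i * u i) \<in> polys (binvars n)" using u pol by (intro polys_sum) auto
    ultimately have "v - (\<Sum>i<length ys. ys ! i * u i) \<in> idl.span Jg" using v by (simp add: coset_eq_iff)
    then show "v \<in> idl.span (Jg \<union> set ys)" unfolding span_set_list by blast
  next
    assume "v \<in> idl.span (Jg \<union> set ys)"
    then obtain u where u: "v - (\<Sum>i<length ys. ys ! i * u i) \<in> idl.span Jg" unfolding span_set_list by blast
    let ?u = "\<lambda>i. retract n (u i)"
    have "retract n (v - (\<Sum>i<length ys. ys ! i * u i)) \<in> idl.span Jg"
      using u retract_in_span_iff by blast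
    also have "retract n (v - (\<Sum>i<length ys. ys ! i * u i)) = v - (\<Sum>i<length ys. ys ! i * ?u i)"
    proof -
      have "retract n (\<Sum>i<length ys. ys ! i * u i) = (\<Sum>i<length ys. retract n (ys ! i * u i))"
        by (simp add: retract_def ch.subst_sum)
      also have "\<dots> = (\<Sum>i<length ys. ys ! i * ?u i)"
        using ys by (intro sum.cong) (auto simp: retract_id subset_iff)
      finally show ?thesis using v by (simp add: retract_id)
    qed
    finally have "coset v = coset (\<Sum>i<length ys. ys ! i * ?u i)"
      using v pol by (subst coset_eq_iff) (auto intro!: polys_sum simp: retract_polys)
    also have "\<dots> = finsum M (\<lambda>i. (ys ! i) \<odot>\<^bsub>M\<^esub> coset (?u i)) {..<length ys}"
      by (rule fs[symmetric]) (rule retract_polys)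
    finally show "coset v \<in> seq_submodule M ys"
      unfolding seq_submodule_def by (auto simp: M_simps retract_polys)
  qed
qed

lemma seq_submodule_subset: "set ys \<subseteq> polys (binvars n) \<Longrightarrow> seq_submodule M ys \<subseteq> carrier M"
  unfolding seq_submodule_def by (auto intro!: M.finsum_closed M.smult_closed simp: subset_iff)

text \<open>The multiplier v may range over all polynomials, because v and
  \<open>retract n v\<close> agree modulo \<open>Jg\<close>.\<close>

lemma regular_sequence_iff:
  "regular_sequence S M xs \<longleftrightarrow> set xs \<subseteq> polys (binvars n) \<and>
     (\<forall>i<length xs. \<forall>v. xs ! i * v \<in> idl.span (Jg \<union> set (take i xs)) \<longrightarrow> v \<in> idl.span (Jg \<union> set (take i xs))) \<and>
     1 \<notin> idl.span (Jg \<union> set xs)"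
proof (cases "set xs \<subseteq> polys (binvars n)")
  case True
  have tk: "set (take i xs) \<subseteq> polys (binvars n)" for i
    using True set_take_subset by fastforce
  have "(\<forall>v\<in>carrier M. (xs ! i) \<odot>\<^bsub>M\<^esub> v \<in> seq_submodule M (take i xs) \<longrightarrow> v \<in> seq_submodule M (take i xs)) \<longleftrightarrow>
    (\<forall>v. xs ! i * v \<in> idl.span (Jg \<union> set (take i xs)) \<longrightarrow> v \<in> idl.span (Jg \<union> set (take i xs)))"
    (is "?L \<longleftrightarrow> ?R") if "i < length xs" for i
  proof -
    have xi: "xs ! i \<in> polys (binvars n)" using True that by auto
    have "?L \<longleftrightarrow> (\<forall>v\<in>polys (binvars n). xs ! i * v \<in> idl.span (Jg \<union> set (take i xs)) \<longrightarrow>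
        v \<in> idl.span (Jg \<union> set (take i xs)))"
      using xi by (simp add: M_simps coset_hom coset_in_seq_submodule_iff[OF tk] polys_mult)
    also have "\<dots> \<longleftrightarrow> ?R"
    proof (intro iffI allI impI ballI)
      fix v assume h: "\<forall>v\<in>polys (binvars n). xs ! i * v \<in> idl.span (Jg \<union> set (take i xs)) \<longrightarrow>
        v \<in> idl.span (Jg \<union> set (take i xs))" and v: "xs ! i * v \<in> idl.span (Jg \<union> set (take i xs))"
      have "retract n (xs ! i * v) \<in> idl.span (Jg \<union> set (take i xs))"
        using v by (subst retract_in_span_iff) auto
      then have "xs ! i * retract n v \<in> idl.span (Jg \<union> set (take i xs))" using xi by (simp add: retract_id)
      then have "retract n v \<in> idl.span (Jg \<union> set (take i xs))" using h retract_polys by blast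
      then show "v \<in> idl.span (Jg \<union> set (take i xs))" by (subst (asm) retract_in_span_iff) auto
    qed auto
    finally show ?thesis .
  qed
  moreover have "seq_submodule M xs \<noteq> carrier M \<longleftrightarrow> 1 \<notin> idl.span (Jg \<union> set xs)"
  proof
    assume ne: "seq_submodule M xs \<noteq> carrier M"
    show "1 \<notin> idl.span (Jg \<union> set xs)"
    proof
      assume "1 \<in> idl.span (Jg \<union> set xs)"
      then have "p \<in> idl.span (Jg \<union> set xs)" for p using idl.span_scale[of 1 _ p] by simp
      then have "carrier M \<subseteq> seq_submodule M xs"
        by (auto simp: M_simps coset_in_seq_submodule_iff[OF True])
      then show False using ne seq_submodule_subset[OF True] by blast
    qed
  next
    assume "1 \<notin> idl.span (Jg \<union> set xs)"
    then have "coset 1 \<notin> seq_submodule M xs" by (simp add: coset_in_seq_submodule_iff[OF True])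
    moreover have "coset 1 \<in> carrier M" by (simp add: M_simps)
    ultimately show "seq_submodule M xs \<noteq> carrier M" by blast
  qed
  ultimately show ?thesis using True by (simp add: regular_sequence_def)
qed (simp add: regular_sequence_def)

section \<open>Krull dimension of the quotient and its primes\<close>

text \<open>An element of \<open>P (Suc i)\<close> outside \<open>P i\<close> is a nonzerodivisor
  modulo the prime \<open>P i\<close>. Pulled back to the large ring, the primes form a chain to
  which \<open>chain_length_le_growth\<close> applies.\<close>

lemma krull_dim_le:
  assumes "growth_le (idl.span Jg) d"
  shows "krull_dim (S Quot JS) \<le> enat d"
  unfolding krull_dim_def
proof (rule Sup_least, clarsimp)
  fix r and P :: "nat \<Rightarrow> 'k bpoly set set"
  assume P: "\<forall>i\<le>r. primeideal (P i) (S Quot JS)" and strict: "\<forall>i<r. P i \<subset> P (Suc i)"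
  define A where "A i = {p. coset (retract n p) \<in> P i}" for i
  have pr: "retract n p \<in> polys (binvars n)" for p :: "'k bpoly" by (rule retract_polys)
  have idl: "ideal (P i) (S Quot JS)" if "i \<le> r" for i using P that by (simp add: primeideal.axioms(1))
  have add: "additive_subgroup (P i) (S Quot JS)" if "i \<le> r" for i using idl[OF that] by (rule ideal.axioms(1))
  have "\<forall>i. \<exists>p. i < r \<longrightarrow> p \<in> polys (binvars n) \<and> coset p \<in> P (Suc i) \<and> coset p \<notin> P i"
  proof
    fix i
    show "\<exists>p. i < r \<longrightarrow> p \<in> polys (binvars n) \<and> coset p \<in> P (Suc i) \<and> coset p \<notin> P i"
    proof (cases "i < r")
      case True
      then obtain C where "C \<in> P (Suc i)" "C \<notin> P i" using strict by blast
      moreover have "P (Suc i) \<subseteq> carrier (S Quot JS)"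
        using add[of "Suc i"] True by (simp add: additive_subgroup.a_subset)
      ultimately show ?thesis unfolding carrier_Q by blast
    qed simp
  qed
  then obtain f where f: "\<And>i. i < r \<Longrightarrow> f i \<in> polys (binvars n) \<and> coset (f i) \<in> P (Suc i) \<and> coset (f i) \<notin> P i"
    by metis
  show "r \<le> d"
  proof (rule chain_length_le_growth[of r A f "idl.span Jg" d])
    show "idl.subspace (A i)" if "i \<le> r" for i
    proof (rule idl.subspaceI)
      show "0 \<in> A i"
        using additive_subgroup.zero_closed[OF add[OF that]] by (simp add: A_def coset_zero_one)
      show "p + q \<in> A i" if "p \<in> A i" "q \<in> A i" for p q
        using additive_subgroup.a_closed[OF add[OF \<open>i \<le> r\<close>], of "coset (retract n p)" "coset (retract n q)"] that pr
        by (simp add: A_def coset_hom)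
      show "c * p \<in> A i" if "p \<in> A i" for c p
        using ideal.I_l_closed[OF idl[OF \<open>i \<le> r\<close>], of "coset (retract n p)" "coset (retract n c)"] that pr
        by (simp add: A_def coset_hom)
    qed
    show "A i \<subseteq> A (Suc i)" if "i < r" for i using strict that by (auto simp: A_def)
    show "1 \<notin> A r"
    proof
      assume "1 \<in> A r"
      then have "\<one>\<^bsub>S Quot JS\<^esub> \<in> P r" by (simp add: A_def coset_zero_one)
      then have "P r = carrier (S Quot JS)" using ideal.one_imp_carrier[OF idl[of r]] by simp
      then show False using primeideal.I_notcarr[of "P r" "S Quot JS"] P by auto
    qed
    show "f i \<in> A (Suc i)" if "i < r" for i using f[OF that] by (simp add: A_def retract_id)
    show "v \<in> A i" if i: "i < r" and v: "f i * v \<in> A i" for i v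
    proof -
      have "coset (f i) \<otimes>\<^bsub>S Quot JS\<^esub> coset (retract n v) \<in> P i"
        using v f[OF i] pr by (simp add: A_def coset_hom retract_id)
      moreover have "primeideal (P i) (S Quot JS)" using P i by simp
      ultimately have "coset (f i) \<in> P i \<or> coset (retract n v) \<in> P i"
        using primeideal.I_prime[of "P i" "S Quot JS" "coset (f i)" "coset (retract n v)"]
          coset_in_Q[of "f i"] coset_in_Q[OF pr[of v]] f[OF i] by blast
      then show ?thesis using f[OF i] by (simp add: A_def)
    qed
    show "idl.span Jg \<subseteq> A 0"
    proof
      fix p assume "p \<in> idl.span Jg"
      then have "retract n p \<in> idl.span Jg" by (subst retract_in_span_iff) auto
      then have "coset (retract n p) = coset 0" using pr[of p] by (subst coset_eq_iff) auto
      then show "p \<in> A 0" using additive_subgroup.zero_closed[OF add[of 0]] by (simp add: A_def coset_zero_one)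
    qed
  qed (rule assms)
qed

definition kernel_ideal :: "('k bpoly \<Rightarrow> 'k bpoly) \<Rightarrow> 'k bpoly set set" where
  "kernel_ideal \<phi> = {coset p | p. p \<in> polys (binvars n) \<and> \<phi> p = 0}"

text \<open>\<open>\<phi>\<close> factors through the quotient, and its values lie in a domain, so
  the kernel of the induced map is prime.\<close>

lemma kernel_ideal:
  assumes \<phi>: "\<And>p q. \<phi> (p + q) = \<phi> p + \<phi> q" "\<And>p q. \<phi> (p * q) = \<phi> p * \<phi> q" "\<phi> 1 = 1"
    and J: "\<And>p. p \<in> idl.span Jg \<Longrightarrow> \<phi> p = 0"
  shows coset_in_kernel_ideal: "p \<in> polys (binvars n) \<Longrightarrow> coset p \<in> kernel_ideal \<phi> \<longleftrightarrow> \<phi> p = 0"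
    and primeideal_kernel_ideal: "primeideal (kernel_ideal \<phi>) (S Quot JS)"
proof -
  have \<phi>0: "\<phi> 0 = 0" using J idl.span_zero by blast
  show mem: "coset p \<in> kernel_ideal \<phi> \<longleftrightarrow> \<phi> p = 0" if p: "p \<in> polys (binvars n)" for p
  proof
    assume "coset p \<in> kernel_ideal \<phi>"
    then obtain q where q: "q \<in> polys (binvars n)" "\<phi> q = 0" "coset p = coset q" by (auto simp: kernel_ideal_def)
    then have "\<phi> (p - q) = 0" using p by (intro J) (simp add: coset_eq_iff)
    then have "\<phi> ((p - q) + q) = 0" unfolding \<phi>(1) q(2) by simp
    then show "\<phi> p = 0" by simp
  qed (use p in \<open>auto simp: kernel_ideal_def\<close>)
  have rep: "\<exists>p. p \<in> polys (binvars n) \<and> C = coset p" if "C \<in> carrier (S Quot JS)" for C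
    using that unfolding carrier_Q by blast
  have sub: "kernel_ideal \<phi> \<subseteq> carrier (S Quot JS)" by (auto simp: kernel_ideal_def)
  show "primeideal (kernel_ideal \<phi>) (S Quot JS)"
  proof (rule primeidealI)
    show "ideal (kernel_ideal \<phi>) (S Quot JS)"
    proof (rule idealI)
      show "subgroup (kernel_ideal \<phi>) (add_monoid (S Quot JS))"
      proof (rule subgroup.intro)
        show "kernel_ideal \<phi> \<subseteq> carrier (add_monoid (S Quot JS))" using sub by simp
        show "\<one>\<^bsub>add_monoid (S Quot JS)\<^esub> \<in> kernel_ideal \<phi>" using mem[of 0] \<phi>0 by (simp add: coset_zero_one)
      next
        fix C D assume CD: "C \<in> kernel_ideal \<phi>" "D \<in> kernel_ideal \<phi>"
        then obtain p q where "p \<in> polys (binvars n)" "C = coset p" "q \<in> polys (binvars n)" "D = coset q"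
          using rep sub by blast
        then show "C \<otimes>\<^bsub>add_monoid (S Quot JS)\<^esub> D \<in> kernel_ideal \<phi>"
          using CD by (simp add: coset_hom mem polys_add \<phi>)
      next
        fix C assume C: "C \<in> kernel_ideal \<phi>"
        then obtain p where p: "p \<in> polys (binvars n)" "C = coset p" using rep sub by blast
        have "\<ominus>\<^bsub>S Quot JS\<^esub> C = coset (- p)"
          using h.hom_a_inv[of p] p by simp
        moreover have "\<phi> (- p) = 0"
        proof -
          have "\<phi> (p + - p) = \<phi> p + \<phi> (- p)" by (rule \<phi>(1))
          moreover have "\<phi> p = 0" using C p mem by simp
          ultimately show ?thesis using \<phi>0 by simp
        qed
        ultimately show "inv\<^bsub>add_monoid (S Quot JS)\<^esub> C \<in> kernel_ideal \<phi>"
          unfolding a_inv_def[symmetric] using p(1) mem[OF polys_uminus] by simp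
      qed
    next
      fix C D assume CD: "C \<in> kernel_ideal \<phi>" "D \<in> carrier (S Quot JS)"
      then obtain p q where "p \<in> polys (binvars n)" "C = coset p" "q \<in> polys (binvars n)" "D = coset q"
        using rep sub by blast
      then show "D \<otimes>\<^bsub>S Quot JS\<^esub> C \<in> kernel_ideal \<phi>" "C \<otimes>\<^bsub>S Quot JS\<^esub> D \<in> kernel_ideal \<phi>"
        using CD by (simp_all add: coset_hom mem polys_mult \<phi>)
    qed (rule Q.ring_axioms)
    have "coset 1 \<notin> kernel_ideal \<phi>" using mem[of 1] \<phi>(3) by simp
    moreover have "coset 1 \<in> carrier (S Quot JS)" by simp
    ultimately show "carrier (S Quot JS) \<noteq> kernel_ideal \<phi>" by metis
    fix C D assume CD: "C \<in> carrier (S Quot JS)" "D \<in> carrier (S Quot JS)" "C \<otimes>\<^bsub>S Quot JS\<^esub> D \<in> kernel_ideal \<phi>"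
    then obtain p q where "p \<in> polys (binvars n)" "C = coset p" "q \<in> polys (binvars n)" "D = coset q"
      using rep by blast
    then show "C \<in> kernel_ideal \<phi> \<or> D \<in> kernel_ideal \<phi>"
      using CD(3) by (simp add: coset_hom mem polys_mult \<phi>)
  qed (rule Q.is_cring)
qed

end

lemma graded_max_ideal_eq:
  "(graded_max_ideal n :: 'k::field bpoly set) = idl.span (range bvar) \<inter> polys (binvars n)"
proof -
  have "bvar ` binvars n \<union> bvar ` (- binvars n) = (range bvar :: 'k bpoly set)" by blast
  moreover have "bvar ` binvars n \<subseteq> (polys (binvars n) :: 'k bpoly set)" by auto
  ultimately show ?thesis unfolding graded_max_ideal_def using Idl_bpoly_ring by metis
qed

lemma const_part_span_vars:
  assumes "p \<in> idl.span (range bvar)"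
  shows "const_part p = 0"
proof -
  have "const_part p \<in> idl.span {}"
    unfolding const_part_def by (rule ch.subst_ideal[OF assms]) auto
  then show ?thesis by simp
qed

section \<open>Depth and dimension\<close>

context leafy_clique
begin

sublocale QJ: bpoly_quotient n "Jgens :: 'k::field bpoly set"
  by unfold_locales (auto simp: edge_ideal_gens_def)

lemma J_subset_vars: "(J :: 'k::field bpoly set) \<subseteq> idl.span (range bvar)"
proof (rule idl.span_minimal)
  show "(Jgens :: 'k bpoly set) \<subseteq> idl.span (range bvar)"
  proof
    fix g :: "'k bpoly" assume "g \<in> Jgens"
    then show "g \<in> idl.span (range bvar)"
      by (cases rule: edge_ideal_gensE) (simp_all add: minor_def idl.span_diff idl.span_scale idl.span_base)
  qed
qed simp

lemma reg_seq_in_vars: "(reg_seq i :: 'k::field bpoly) \<in> idl.span (range bvar)"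
  by (simp add: reg_seq_def param_def idl.span_diff idl.span_add idl.span_base)

lemma depth_J: "depth (bpoly_ring n) (graded_max_ideal n)
    (quot_module (bpoly_ring n) (J \<inter> polys (binvars n) :: 'k::field bpoly set)) = enat (n + 1)"
  unfolding depth_def
proof (rule antisym)
  show "Sup {enat (length xs) |xs. set xs \<subseteq> graded_max_ideal n \<and>
      regular_sequence (bpoly_ring n) (quot_module (bpoly_ring n) (J \<inter> polys (binvars n) :: 'k bpoly set)) xs} \<le> enat (n + 1)"
  proof (rule Sup_least, clarsimp)
    fix xs :: "'k bpoly list"
    assume xs: "set xs \<subseteq> graded_max_ideal n"
      and "regular_sequence (bpoly_ring n) (quot_module (bpoly_ring n) (J \<inter> polys (binvars n))) xs"
    then have reg: "\<forall>i<length xs. \<forall>v. xs ! i * v \<in> idl.span (Jgens \<union> set (take i xs)) \<longrightarrow> v \<in> idl.span (Jgens \<union> set (take i xs))"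
      unfolding QJ.regular_sequence_iff by blast
    have "length xs \<le> n + 1"
    proof (rule regular_length_le[where J = Jgens and z = "bvar (VX n)" and P = A.Q])
      show "bvar ` (- binvars n) \<subseteq> (Jgens :: 'k bpoly set)" by (auto simp: edge_ideal_gens_def)
      show "const_part x = 0" if "x \<in> set xs" for x
        using that xs by (intro const_part_span_vars) (auto simp: graded_max_ideal_eq)
      show "p * bvar (VX n) \<in> J" if "p \<in> A.Q" for p :: "'k bpoly"
        using apex_mult_A(1)[OF that] by (simp add: mult.commute)
    qed (use reg apex_annihilator growth_A in auto)
    then show "length xs \<le> Suc n" by simp
  qed
  \<comment> \<open>\<open>reg_seq 0\<close> is y_0 - x_1, and y_0 is not a variable of the ring;
    \<open>retract\<close> removes it and changes nothing modulo \<open>J\<close>.\<close>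
  define xs :: "'k bpoly list" where "xs = map (\<lambda>i. retract n (reg_seq i)) [0..<Suc n]"
  have d: "retract n p - p \<in> J" for p :: "'k bpoly"
    using idl.span_neg[OF QJ.retract_span[of p]] by simp
  have takes: "idl.span (Jgens \<union> set (take i xs)) = idl.span (Jgens \<union> reg_seq ` {..<i})" if "i \<le> Suc n" for i
  proof -
    have "set (take i xs) = (\<lambda>i. retract n (reg_seq i)) ` {..<i}"
      using that by (auto simp: xs_def take_map simp del: upt_Suc)
    then show ?thesis by (simp only:) (rule span_cong_mod, rule d)
  qed
  have rv: "retract n (reg_seq i) \<in> idl.span (range bvar :: 'k bpoly set)" for i
  proof -
    have "(retract n (reg_seq i) - reg_seq i) + reg_seq i \<in> idl.span (range bvar :: 'k bpoly set)"
      using d J_subset_vars reg_seq_in_vars by (intro idl.span_add) auto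
    then show ?thesis by simp
  qed
  have "1 \<notin> idl.span (Jgens \<union> set xs)"
  proof
    assume "1 \<in> idl.span (Jgens \<union> set xs)"
    moreover have "idl.span (Jgens \<union> set xs) \<subseteq> idl.span (range bvar)"
      using rv J_subset_vars idl.span_superset[of Jgens] by (intro idl.span_minimal) (auto simp: xs_def)
    ultimately have "const_part (1 :: 'k bpoly) = 0" by (intro const_part_span_vars) blast
    then show False by simp
  qed
  moreover have "v \<in> idl.span (Jgens \<union> set (take i xs))"
    if "i < length xs" "xs ! i * v \<in> idl.span (Jgens \<union> set (take i xs))" for i v
  proof -
    have i: "i < Suc n" using that(1) by (simp add: xs_def)
    have "xs ! i = retract n (reg_seq i)" using i by (simp add: xs_def del: upt_Suc)
    then have "reg_seq i * v = xs ! i * v - v * (retract n (reg_seq i) - reg_seq i)"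
      by (simp add: algebra_simps)
    moreover have "v * (retract n (reg_seq i) - reg_seq i) \<in> idl.span (Jgens \<union> set (take i xs))"
      by (intro idl.span_scale subsetD[OF idl.span_mono d]) blast
    ultimately have "reg_seq i * v \<in> idl.span (Jgens \<union> reg_seq ` {..<i})"
      using idl.span_diff[OF that(2)] takes[of i] i by simp
    then show ?thesis using regular_J[where 'k='k] takes[of i] i by (simp add: regular_on_def)
  qed
  moreover have "set xs \<subseteq> polys (binvars n)" by (auto simp: xs_def retract_polys)
  moreover have "set xs \<subseteq> graded_max_ideal n" using rv by (auto simp: xs_def graded_max_ideal_eq retract_polys)
  ultimately have "set xs \<subseteq> graded_max_ideal n \<and>
      regular_sequence (bpoly_ring n) (quot_module (bpoly_ring n) (J \<inter> polys (binvars n))) xs"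
    unfolding QJ.regular_sequence_iff by blast
  moreover have "length xs = n + 1" by (simp add: xs_def)
  ultimately show "enat (n + 1) \<le> Sup {enat (length xs) |xs. set xs \<subseteq> graded_max_ideal n \<and>
      regular_sequence (bpoly_ring n) (quot_module (bpoly_ring n) (J \<inter> polys (binvars n) :: 'k bpoly set)) xs}"
    by (intro Sup_upper) (metis (mono_tags, lifting) mem_Collect_eq)
qed

lemma krull_dim_J: "krull_dim (bpoly_ring n Quot (J \<inter> polys (binvars n) :: 'k::field bpoly set)) = enat (n + k)"
proof (rule antisym)
  show "krull_dim (bpoly_ring n Quot (J \<inter> polys (binvars n) :: 'k bpoly set)) \<le> enat (n + k)"
    by (rule QJ.krull_dim_le[OF growth_J])
  define \<phi> :: "nat \<Rightarrow> 'k bpoly \<Rightarrow> 'k bpoly" where "\<phi> i = spec (set (take i spec_order))" for i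
  have ker: "primeideal (QJ.kernel_ideal (\<phi> i)) (bpoly_ring n Quot (J \<inter> polys (binvars n)))"
    and mem: "p \<in> polys (binvars n) \<Longrightarrow> QJ.coset p \<in> QJ.kernel_ideal (\<phi> i) \<longleftrightarrow> \<phi> i p = 0" for i p
    by (rule QJ.kernel_ideal; simp add: \<phi>_def spec_J)+
  have "QJ.kernel_ideal (\<phi> i) \<subset> QJ.kernel_ideal (\<phi> (Suc i))" if i: "i < n + k" for i
  proof
    have "set (take i spec_order) \<subseteq> set (take (Suc i) spec_order)" by (rule set_take_subset_set_take) simp
    then show "QJ.kernel_ideal (\<phi> i) \<subseteq> QJ.kernel_ideal (\<phi> (Suc i))"
      unfolding QJ.kernel_ideal_def \<phi>_def using spec_mono by blast
    obtain w where w: "w \<in> binvars n" "\<phi> i (bvar w) \<noteq> 0" "\<phi> (Suc i) (bvar w) = 0"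
      using spec_strict[OF i, where 'k='k] by (auto simp: \<phi>_def)
    then show "QJ.kernel_ideal (\<phi> i) \<noteq> QJ.kernel_ideal (\<phi> (Suc i))"
      using mem[of "bvar w" i] mem[of "bvar w" "Suc i"] by auto
  qed
  then show "enat (n + k) \<le> krull_dim (bpoly_ring n Quot (J \<inter> polys (binvars n) :: 'k bpoly set))"
    unfolding krull_dim_def using ker
    by (intro Sup_upper CollectI exI[of _ "n + k"] conjI exI[of _ "\<lambda>i. QJ.kernel_ideal (\<phi> i)"]) auto
qed

section \<open>The graph\<close>

definition leafy_graph :: "nat pair_pre_digraph" where
  "leafy_graph = \<lparr>pverts = {1..n}, parcs = {(i, j). i \<in> {1..n} \<and> j \<in> {1..n} \<and> i \<noteq> j \<and>
     (i = n \<or> j = n \<or> k < i \<and> k < j)}\<rparr>"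

lemma pverts_leafy_graph: "pverts leafy_graph = {1..n}"
  by (simp add: leafy_graph_def)

lemma pair_graph_leafy_graph: "pair_graph leafy_graph"
proof
  have "parcs leafy_graph \<subseteq> {1..n} \<times> {1..n}" by (auto simp: leafy_graph_def)
  then show "finite (parcs leafy_graph)" by (rule finite_subset) simp
  show "symmetric (with_proj leafy_graph)"
    by (auto simp: symmetric_def leafy_graph_def intro!: symI)
qed (auto simp: leafy_graph_def)

lemma connected_leafy_graph: "Digraph_Component.connected (with_proj leafy_graph)"
proof -
  let ?H = "mk_symmetric (with_proj leafy_graph)"
  have adj: "(i, n) \<in> parcs ?H" "(n, i) \<in> parcs ?H" if "i \<in> {1..n}" "i \<noteq> n" for i
    using that by (auto simp: mk_symmetric_def leafy_graph_def)
  have verts: "pverts ?H = {1..n}" by (simp add: mk_symmetric_def leafy_graph_def)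
  have n1: "n \<in> {1..n}" using m_less_n by simp
  have "(u, v) \<in> rtrancl_on {1..n} (parcs ?H)" if "u \<in> {1..n}" "v \<in> {1..n}" for u v
  proof -
    have "(u, n) \<in> rtrancl_on {1..n} (parcs ?H)"
      using that(1) n1 adj(1)[of u]
      by (cases "u = n") (auto intro: rtrancl_on_into_rtrancl_on[OF rtrancl_on_refl])
    moreover have "(n, v) \<in> rtrancl_on {1..n} (parcs ?H)"
      using that(2) n1 adj(2)[of v]
      by (cases "v = n") (auto intro: rtrancl_on_into_rtrancl_on[OF rtrancl_on_refl])
    ultimately show ?thesis by (rule rtrancl_on_trans)
  qed
  then show ?thesis
    using n1 unfolding connected_def strongly_connected_def reachable_def by (auto simp: verts pverts_leafy_graph)
qed

lemma binomial_edge_ideal_leafy_graph: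
  "binomial_edge_ideal n leafy_graph = (J \<inter> polys (binvars n) :: 'k::field bpoly set)"
proof -
  have "{bvar (VX i) * bvar (VY j) - bvar (VX j) * bvar (VY i) |i j. i < j \<and> (i, j) \<in> parcs leafy_graph} =
    {minor i j :: 'k bpoly | i j. cone_edge k n i j}" (is "?G = ?G'")
  proof -
    have "i < j \<and> (i, j) \<in> parcs leafy_graph \<longleftrightarrow> cone_edge k n i j" for i j
      by (auto simp: leafy_graph_def cone_edge_def)
    then show ?thesis by (simp add: minor_def)
  qed
  moreover have "?G' \<subseteq> polys (binvars n)"
    by (auto simp: minor_def cone_edge_def binvars_def intro!: polys_diff polys_mult)
  ultimately show ?thesis
    unfolding binomial_edge_ideal_def edge_ideal_gens_def by (simp add: Idl_bpoly_ring)
qed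

end

theorem theorem1p2:
  fixes n d :: nat
  assumes "n \<ge> 3" and "n + 1 \<le> d" and "d \<le> 2 * n - 2"
  shows "\<exists>G :: nat pair_pre_digraph.
    pair_graph G \<and> pverts G = {1..n} \<and> Digraph_Component.connected (with_proj G) \<and>
    (let S = (bpoly_ring n :: 'k::field bpoly ring);
         J = (binomial_edge_ideal n G :: 'k bpoly set)
     in depth S (graded_max_ideal n) (quot_module S J) = enat (n + 1) \<and>
        krull_dim (S Quot J) = enat d)"
proof -
  \<comment> \<open>The bounds on d say exactly that k = d - n satisfies 1 \<le> k < n - 1.\<close>
  interpret leafy_clique "d - n" "n - 1" n
    using assms by unfold_locales auto
  have "n + (d - n) = d" using assms by simp
  then show ?thesis
    using depth_J[where 'k = 'k] krull_dim_J[where 'k = 'k]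
    by (intro exI[of _ leafy_graph])
      (simp add: pair_graph_leafy_graph connected_leafy_graph binomial_edge_ideal_leafy_graph pverts_leafy_graph Let_def)
qed

end
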